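(* Extension Roman Hitting Function, parameterized by the weight $\omega(f)=\sum_{x\in X}f(x)$ of the given function $f$, is W[3]-hard, even when the correspondence $\tau$ is injective.
   Context: A hypergraph is $H=(X,(s_i)_{i\in I})$ with finite $X$, finite index set $I$, $s_i\subseteq X$ (repetitions allowed). A correspondence is a map $\tau:X\to I$ with $x\in s_{\tau(x)}$ for all $x$. A function $g:X\to\{0,1,2\}$ is a Roman hitting function (rhf) if for every $i\in I$ there is $x\in s_i$ with $g(x)=2$ or there is $x$ with $\tau(x)=i$ and $g(x)=1$. Functions are ordered pointwise; an rhf $g$ is minimal if every rhf $h\le g$ equals $g$. Extension Roman Hitting Function: given $H$, $\tau$ and $f:X\to\{0,1,2\}$, decide whether there is a minimal rhf $g$ with $f\le g$. *)

theory Defs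
  imports Main "HOL-Library.FuncSet"
begin

section \<open>Machine model\<close>

text \<open>
  Computations are those of a WHILE language on binary trees (as in Jones, ``Computability and
  Complexity from a Programming Perspective'').  Since evaluating an expression is charged the
  size of all values that occur in it (in particular, copying is not free), a run of cost T only
  produces values of size polynomial in T and the input size, and costs agree with Turing machine
  time up to a polynomial.
\<close>

datatype data = Leaf | Node data data

fun dsize :: "data \<Rightarrow> nat" where
  "dsize Leaf = 1"
| "dsize (Node a b) = Suc (dsize a + dsize b)"

datatype expr = Var nat | LeafE | NodeE expr expr | Left expr | Right expr | Eq expr expr

type_synonym state = "nat \<Rightarrow> data"

fun dleft :: "data \<Rightarrow> data" where
  "dleft Leaf = Leaf"
| "dleft (Node a b) = a"

fun dright :: "data \<Rightarrow> data" where
  "dright Leaf = Leaf"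
| "dright (Node a b) = b"

fun eval :: "expr \<Rightarrow> state \<Rightarrow> data" where
  "eval (Var v) s = s v"
| "eval LeafE s = Leaf"
| "eval (NodeE a b) s = Node (eval a s) (eval b s)"
| "eval (Left a) s = dleft (eval a s)"
| "eval (Right a) s = dright (eval a s)"
| "eval (Eq a b) s = (if eval a s = eval b s then Node Leaf Leaf else Leaf)"

fun cost :: "expr \<Rightarrow> state \<Rightarrow> nat" where
  "cost (Var v) s = dsize (s v)"
| "cost LeafE s = 1"
| "cost (NodeE a b) s = cost a s + cost b s + dsize (eval (NodeE a b) s)"
| "cost (Left a) s = cost a s + dsize (eval (Left a) s)"
| "cost (Right a) s = cost a s + dsize (eval (Right a) s)"
| "cost (Eq a b) s = cost a s + cost b s + dsize (eval (Eq a b) s)"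

datatype com = Assign nat expr | Seq com com | Cond expr com com | While expr com

text \<open>
  \<open>exec c s t s'\<close>: started in state \<open>s\<close>, the program \<open>c\<close> halts in state \<open>s'\<close> at total
  cost \<open>t\<close>.  A test succeeds iff its value is not \<open>Leaf\<close>.
\<close>

inductive exec :: "com \<Rightarrow> state \<Rightarrow> nat \<Rightarrow> state \<Rightarrow> bool" where
  Assign: "exec (Assign v e) s (Suc (cost e s)) (s(v := eval e s))"
| Seq: "exec c s t s' \<Longrightarrow> exec c' s' t' s'' \<Longrightarrow> exec (Seq c c') s (Suc (t + t')) s''"
| CondTrue: "eval e s \<noteq> Leaf \<Longrightarrow> exec c s t s' \<Longrightarrow> exec (Cond e c c') s (Suc (cost e s + t)) s'"
| CondFalse: "eval e s = Leaf \<Longrightarrow> exec c' s t s' \<Longrightarrow> exec (Cond e c c') s (Suc (cost e s + t)) s'"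
| WhileFalse: "eval e s = Leaf \<Longrightarrow> exec (While e c) s (Suc (cost e s)) s"
| WhileTrue: "eval e s \<noteq> Leaf \<Longrightarrow> exec c s t s' \<Longrightarrow> exec (While e c) s' t' s'' \<Longrightarrow>
    exec (While e c) s (Suc (cost e s + t + t')) s''"

text \<open>Input and output are held in variable 0; all other variables are initially \<open>Leaf\<close>.\<close>

definition runs :: "com \<Rightarrow> data \<Rightarrow> nat \<Rightarrow> data \<Rightarrow> bool" where
  "runs c d t r \<longleftrightarrow> (\<exists>s. exec c ((\<lambda>_. Leaf)(0 := d)) t s \<and> s 0 = r)"

fun enc_nat :: "nat \<Rightarrow> data" where
  "enc_nat 0 = Leaf"
| "enc_nat (Suc n) = Node Leaf (enc_nat n)"

fun enc_list :: "data list \<Rightarrow> data" where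
  "enc_list [] = Leaf"
| "enc_list (d # ds) = Node d (enc_list ds)"

lemma enc_nat_inject [simp]: "enc_nat m = enc_nat n \<longleftrightarrow> m = n"
proof (induction m arbitrary: n)
  case 0
  then show ?case by (cases n) auto
next
  case (Suc m)
  then show ?case by (cases n) auto
qed

lemma inj_enc_nat [simp]: "inj enc_nat"
  by (auto intro: injI)

lemma enc_list_inject [simp]: "enc_list xs = enc_list ys \<longleftrightarrow> xs = ys"
proof (induction xs arbitrary: ys)
  case Nil
  then show ?case by (cases ys) auto
next
  case (Cons x xs)
  then show ?case by (cases ys) auto
qed

definition enc_nats :: "nat list \<Rightarrow> data" where
  "enc_nats ns = enc_list (map enc_nat ns)"

lemma enc_nats_inject [simp]: "enc_nats ms = enc_nats ns \<longleftrightarrow> ms = ns"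
  by (simp add: enc_nats_def)

lemma inj_enc_nats [simp]: "inj enc_nats"
  by (auto intro: injI)

definition computable :: "(nat \<Rightarrow> nat) \<Rightarrow> bool" where
  "computable f \<longleftrightarrow> (\<exists>c. \<forall>n. \<exists>t. runs c (enc_nat n) t (enc_nat (f n)))"

section \<open>Parameterized problems, reductions and the W hierarchy\<close>

text \<open>
  An instance is a pair of an (encoded) input and its parameter.  The set of instances is kept
  explicit, so that restricting a problem to special inputs is expressed by shrinking this set:
  a reduction to the restricted problem must output such special inputs only.
\<close>

record pproblem =
  instances :: "(data \<times> nat) set"
  yes :: "(data \<times> nat) set"

definition fpt_reducible :: "pproblem \<Rightarrow> pproblem \<Rightarrow> bool" (infix "\<le>fpt" 50) where
  "A \<le>fpt B \<longleftrightarrow> (\<exists>p f g c. computable f \<and> computable g \<and>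
     (\<forall>(x, k) \<in> instances A. \<exists>x' k' t.
        runs p (Node x (enc_nat k)) t (Node x' (enc_nat k')) \<and>
        t \<le> f k * dsize x ^ c \<and>
        k' \<le> g k \<and>
        (x', k') \<in> instances B \<and>
        ((x, k) \<in> yes A \<longleftrightarrow> (x', k') \<in> yes B)))"

text \<open>
  A circuit is a list of gates, whose arguments are given by their positions in the list; the
  last gate is the output.  Acyclicity is ensured by listing the gates in topological order.
\<close>

datatype gate = Input | Not nat | And "nat list" | Or "nat list"

type_synonym circuit = "gate list"

fun args :: "gate \<Rightarrow> nat list" where
  "args Input = []"
| "args (Not j) = [j]"
| "args (And js) = js"
| "args (Or js) = js"

fun fan_in_ok :: "gate \<Rightarrow> bool" where
  "fan_in_ok (And js) \<longleftrightarrow> distinct js \<and> length js \<ge> 2"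
| "fan_in_ok (Or js) \<longleftrightarrow> distinct js \<and> length js \<ge> 2"
| "fan_in_ok _ \<longleftrightarrow> True"

definition circuit :: "circuit \<Rightarrow> bool" where
  "circuit C \<longleftrightarrow> C \<noteq> [] \<and> (\<forall>i < length C. fan_in_ok (C ! i) \<and> (\<forall>j \<in> set (args (C ! i)). j < i))"

definition input_nodes :: "circuit \<Rightarrow> nat set" where
  "input_nodes C = {i. i < length C \<and> C ! i = Input}"

definition output_node :: "circuit \<Rightarrow> nat" where
  "output_node C = length C - 1"

definition io_path :: "circuit \<Rightarrow> nat list \<Rightarrow> bool" where
  "io_path C is \<longleftrightarrow> is \<noteq> [] \<and> set is \<subseteq> {..<length C} \<and>
     hd is \<in> input_nodes C \<and> last is = output_node C \<and>
     successively (\<lambda>i j. i \<in> set (args (C ! j))) is"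

definition depth_at_most :: "circuit \<Rightarrow> nat \<Rightarrow> bool" where
  "depth_at_most C d \<longleftrightarrow> (\<forall>is. io_path C is \<longrightarrow> length is - 1 \<le> d)"

definition large :: "gate \<Rightarrow> bool" where
  "large g \<longleftrightarrow> length (args g) > 2"

definition weft_at_most :: "circuit \<Rightarrow> nat \<Rightarrow> bool" where
  "weft_at_most C t \<longleftrightarrow> (\<forall>is. io_path C is \<longrightarrow> length (filter (\<lambda>i. large (C ! i)) is) \<le> t)"

text \<open>\<open>S\<close> is the set of input nodes that are set to true.\<close>

fun gate_value :: "nat set \<Rightarrow> (nat \<Rightarrow> bool) \<Rightarrow> nat \<Rightarrow> gate \<Rightarrow> bool" where
  "gate_value S v i Input \<longleftrightarrow> i \<in> S"
| "gate_value S v i (Not j) \<longleftrightarrow> \<not> v j"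
| "gate_value S v i (And js) \<longleftrightarrow> (\<forall>j \<in> set js. v j)"
| "gate_value S v i (Or js) \<longleftrightarrow> (\<exists>j \<in> set js. v j)"

text \<open>For a circuit, exactly one valuation of its nodes is consistent with \<open>S\<close>.\<close>

definition consistent :: "circuit \<Rightarrow> nat set \<Rightarrow> (nat \<Rightarrow> bool) \<Rightarrow> bool" where
  "consistent C S v \<longleftrightarrow> (\<forall>i < length C. v i \<longleftrightarrow> gate_value S v i (C ! i))"

definition accepts :: "circuit \<Rightarrow> nat set \<Rightarrow> bool" where
  "accepts C S \<longleftrightarrow> (\<exists>v. consistent C S v \<and> v (output_node C))"

fun enc_gate :: "gate \<Rightarrow> data" where
  "enc_gate Input = Node (enc_nat 0) Leaf"
| "enc_gate (Not j) = Node (enc_nat 1) (enc_nat j)"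
| "enc_gate (And js) = Node (enc_nat 2) (enc_nats js)"
| "enc_gate (Or js) = Node (enc_nat 3) (enc_nats js)"

lemma enc_gate_inject [simp]: "enc_gate g = enc_gate h \<longleftrightarrow> g = h"
  by (cases g; cases h) (simp_all del: enc_nat.simps)

definition enc_circuit :: "circuit \<Rightarrow> data" where
  "enc_circuit C = enc_list (map enc_gate C)"

lemma enc_circuit_inject [simp]: "enc_circuit C = enc_circuit D \<longleftrightarrow> C = D"
proof -
  have "inj enc_gate" by (auto intro: injI)
  then show ?thesis by (simp add: enc_circuit_def)
qed

definition weighted_circuit_sat :: "nat \<Rightarrow> nat \<Rightarrow> pproblem" where
  "weighted_circuit_sat t d =
    \<lparr>instances = {(enc_circuit C, k) | C k. circuit C \<and> weft_at_most C t \<and> depth_at_most C d},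
     yes = {(enc_circuit C, k) | C k. circuit C \<and> weft_at_most C t \<and> depth_at_most C d \<and>
              (\<exists>S \<subseteq> input_nodes C. card S = k \<and> accepts C S)}\<rparr>"

definition W :: "nat \<Rightarrow> pproblem set" where
  "W t = {A. \<exists>d. A \<le>fpt weighted_circuit_sat t d}"

definition W_hard :: "nat \<Rightarrow> pproblem \<Rightarrow> bool" where
  "W_hard t B \<longleftrightarrow> (\<forall>A \<in> W t. A \<le>fpt B)"

section \<open>Roman hitting functions\<close>

definition hypergraph :: "'a set \<Rightarrow> 'i set \<Rightarrow> ('i \<Rightarrow> 'a set) \<Rightarrow> bool" where
  "hypergraph X I s \<longleftrightarrow> finite X \<and> finite I \<and> (\<forall>i \<in> I. s i \<subseteq> X)"

definition correspondence :: "'a set \<Rightarrow> 'i set \<Rightarrow> ('i \<Rightarrow> 'a set) \<Rightarrow> ('a \<Rightarrow> 'i) \<Rightarrow> bool" where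
  "correspondence X I s \<tau> \<longleftrightarrow> \<tau> \<in> X \<rightarrow> I \<and> (\<forall>x \<in> X. x \<in> s (\<tau> x))"

definition rhf ::
  "'a set \<Rightarrow> 'i set \<Rightarrow> ('i \<Rightarrow> 'a set) \<Rightarrow> ('a \<Rightarrow> 'i) \<Rightarrow> ('a \<Rightarrow> nat) \<Rightarrow> bool" where
  "rhf X I s \<tau> g \<longleftrightarrow> g \<in> X \<rightarrow> {0, 1, 2} \<and>
     (\<forall>i \<in> I. (\<exists>x \<in> s i. g x = 2) \<or> (\<exists>x \<in> X. \<tau> x = i \<and> g x = 1))"

definition minimal_rhf ::
  "'a set \<Rightarrow> 'i set \<Rightarrow> ('i \<Rightarrow> 'a set) \<Rightarrow> ('a \<Rightarrow> 'i) \<Rightarrow> ('a \<Rightarrow> nat) \<Rightarrow> bool" where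
  "minimal_rhf X I s \<tau> g \<longleftrightarrow> rhf X I s \<tau> g \<and>
     (\<forall>h. rhf X I s \<tau> h \<and> (\<forall>x \<in> X. h x \<le> g x) \<longrightarrow> (\<forall>x \<in> X. h x = g x))"

definition extends_to_minimal_rhf ::
  "'a set \<Rightarrow> 'i set \<Rightarrow> ('i \<Rightarrow> 'a set) \<Rightarrow> ('a \<Rightarrow> 'i) \<Rightarrow> ('a \<Rightarrow> nat) \<Rightarrow> bool" where
  "extends_to_minimal_rhf X I s \<tau> f \<longleftrightarrow> (\<exists>g. minimal_rhf X I s \<tau> g \<and> (\<forall>x \<in> X. f x \<le> g x))"

definition weight :: "'a set \<Rightarrow> ('a \<Rightarrow> nat) \<Rightarrow> nat" where
  "weight X f = (\<Sum>x \<in> X. f x)"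

text \<open>
  As problem inputs, hypergraphs have vertices \<open>0, \<dots>, n - 1\<close> and edge indices \<open>0, \<dots>, m - 1\<close>.
  An input consists of a list \<open>es\<close> of \<open>m\<close> vertex lists and lists \<open>ts\<close> and \<open>fs\<close> of length \<open>n\<close>
  tabulating the correspondence and the given function.
\<close>

definition vertices :: "nat list \<Rightarrow> nat set" where
  "vertices ts = {..<length ts}"

definition indices :: "nat list list \<Rightarrow> nat set" where
  "indices es = {..<length es}"

definition edge :: "nat list list \<Rightarrow> nat \<Rightarrow> nat set" where
  "edge es i = set (es ! i)"

definition ext_rhf_input :: "nat list list \<Rightarrow> nat list \<Rightarrow> nat list \<Rightarrow> bool" where
  "ext_rhf_input es ts fs \<longleftrightarrow>
     hypergraph (vertices ts) (indices es) (edge es) \<and>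
     correspondence (vertices ts) (indices es) (edge es) ((!) ts) \<and>
     length fs = length ts \<and> (!) fs \<in> vertices ts \<rightarrow> {0, 1, 2}"

definition enc_ext_rhf :: "nat list list \<Rightarrow> nat list \<Rightarrow> nat list \<Rightarrow> data" where
  "enc_ext_rhf es ts fs = enc_list [enc_list (map enc_nats es), enc_nats ts, enc_nats fs]"

lemma enc_ext_rhf_inject [simp]:
  "enc_ext_rhf es ts fs = enc_ext_rhf es' ts' fs' \<longleftrightarrow> es = es' \<and> ts = ts' \<and> fs = fs'"
  by (simp add: enc_ext_rhf_def)

text \<open>The problem with inputs restricted to correspondences \<open>\<tau>\<close> on \<open>X\<close> such that \<open>P X \<tau>\<close>.\<close>

definition ext_rhf_where :: "(nat set \<Rightarrow> (nat \<Rightarrow> nat) \<Rightarrow> bool) \<Rightarrow> pproblem" where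
  "ext_rhf_where P =
    \<lparr>instances = {(enc_ext_rhf es ts fs, weight (vertices ts) ((!) fs)) | es ts fs.
       ext_rhf_input es ts fs \<and> P (vertices ts) ((!) ts)},
     yes = {(enc_ext_rhf es ts fs, weight (vertices ts) ((!) fs)) | es ts fs.
       ext_rhf_input es ts fs \<and> P (vertices ts) ((!) ts) \<and>
       extends_to_minimal_rhf (vertices ts) (indices es) (edge es) ((!) ts) ((!) fs)}\<rparr>"

definition ext_rhf :: pproblem where
  "ext_rhf = ext_rhf_where (\<lambda>X \<tau>. True)"

definition ext_rhf_injective :: pproblem where
  "ext_rhf_injective = ext_rhf_where (\<lambda>X \<tau>. inj_on \<tau> X)"

end

theory Submission
  imports Defs
begin

text \<open>
  A circuit of depth \<open>d\<close> and weft 3 is unfolded from its output into a formula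
  \<open>AND OR AND\<close> over clauses of at most \<open>2 ^ d\<close> literals.  Small gates between large ones are absorbed
  by distributing, which costs only a polynomial factor since \<open>d\<close> is fixed; disjunctions above or at
  the topmost large gate are replaced by guesses, of which a bounded number is needed.

  Everything that is guessed, the \<open>k\<close> true inputs included, is expressed by slots holding one value
  each.  The true inputs are guessed as the \<open>k + 1\<close> gaps between consecutive ones, because then both
  the truth and the falsity of an input are witnessed by a single slot.  To make the falsity of a
  whole clause witnessed by a single slot, slots are finally grouped into \<open>2 ^ d\<close>-tuples, so that the
  bottom level becomes a conjunction of statements ``tuple slot \<open>R\<close> does not hold \<open>w\<close>''.

  Such an \<open>AND OR AND\<close> formula is an extension problem: each tuple slot is a vertex with prescribed
  value 2 and each of its values \<open>w\<close> an edge containing it.  Choosing the private edge of the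
  vertex chooses \<open>w\<close> and forbids the value 2 on all other vertices of that edge; these represent the
  disjuncts falsified by \<open>w\<close>, and each disjunction is the edge of its disjuncts.  Every vertex in
  addition owns a singleton edge, which serves as its image under \<open>\<tau>\<close>.
\<close>

section \<open>Polynomial time on encoded data\<close>

text \<open>The innermost level of an extension instance is a conjunction of statements that each
  concern one choice: the edge chosen at one prescribed vertex misses a given vertex. Hence whatever
  occurs in a clause must fail because of a single slot. Tuple slots are filled independently of
  each other, so their agreement has to be part of the formula; since a disagreement involves two
  atoms only, it is excluded by disjunctions "no tuple contains \<open>\<alpha>\<close> or no tuple
  contains \<open>\<beta>\<close>".

  A guessed disjunction turns into a conjunction over its arguments \<open>a\<close> of
  "\<open>a\<close> is not the guess or the formula of \<open>a\<close> holds", which merges with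
  the topmost level. All arguments use the same labels further down, because only the guessed one is
  active. So only the binary branching at small conjunctions multiplies labels: there are fewer than
  \<open>2 ^ (d + 1)\<close> of them whatever the fan-in, and the number of tuple slots, half the
  weight, is bounded in \<open>k\<close> and \<open>d\<close>.\<close>

class enc =
  fixes encode :: "'a \<Rightarrow> data"
  assumes encode_inject [simp]: "encode x = encode y \<longleftrightarrow> x = y"

instantiation unit :: enc
begin
definition "encode (x :: unit) = Leaf"
instance by standard (simp add: encode_unit_def)
end

instantiation bool :: enc
begin
definition "encode b = (if b then Node Leaf Leaf else Leaf)"
instance by standard (simp add: encode_bool_def)
end

instantiation nat :: enc
begin
definition "encode n = enc_nat n"
instance by standard (simp add: encode_nat_def)
end

instantiation data :: enc
begin
definition "encode (d :: data) = d"
instance by standard (simp add: encode_data_def)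
end

instantiation prod :: (enc, enc) enc
begin
definition "encode p = Node (encode (fst p)) (encode (snd p))"
instance by standard (auto simp: encode_prod_def)
end

instantiation list :: (enc) enc
begin
definition "encode xs = enc_list (map encode xs)"
instance by standard (auto simp: encode_list_def inj_def)
end

instantiation gate :: enc
begin
definition "encode g = enc_gate g"
instance by standard (auto simp: encode_gate_def)
end

lemma encode_Pair [simp]: "encode (x, y) = Node (encode x) (encode y)"
  by (simp add: encode_prod_def)

lemma encode_Nil [simp]: "encode ([] :: 'a::enc list) = Leaf"
  by (simp add: encode_list_def)

lemma encode_Cons [simp]: "encode (x # xs) = Node (encode x) (encode xs)"
  by (simp add: encode_list_def)

lemma encode_0 [simp]: "encode (0 :: nat) = Leaf"
  by (simp add: encode_nat_def)

lemma encode_Suc [simp]: "encode (Suc n) = Node Leaf (encode n)"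
  by (simp add: encode_nat_def)

lemma encode_True [simp]: "encode True = Node Leaf Leaf"
  and encode_False [simp]: "encode False = Leaf"
  by (simp_all add: encode_bool_def)

lemma encode_unit [simp]: "encode (x :: unit) = Leaf"
  by (simp add: encode_unit_def)

section \<open>Sizes of encoded values and polynomial bounds\<close>

abbreviation sz :: "'a::enc \<Rightarrow> nat" where
  "sz x \<equiv> dsize (encode x)"

lemma dsize_pos [simp]: "0 < dsize d"
  by (cases d) auto

lemma dsize_ge_1 [simp]: "Suc 0 \<le> dsize d"
  by (cases d) auto

lemma sz_nat: "sz (n :: nat) = 2 * n + 1"
  by (induction n) auto

lemma sz_list: "sz xs = Suc (\<Sum>x\<leftarrow>xs. Suc (sz x))"
  by (induction xs) auto

text \<open>The base is at least 3, so constants, sums and products are absorbed by a larger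
  exponent and no coefficients are needed.\<close>

definition poly_bounded :: "('a::enc \<Rightarrow> nat) \<Rightarrow> bool" where
  "poly_bounded f \<longleftrightarrow> (\<exists>c. \<forall>x. f x \<le> (sz x + 2) ^ c)"

lemma polyb_mono: "poly_bounded g \<Longrightarrow> (\<And>x. f x \<le> g x) \<Longrightarrow> poly_bounded f"
  unfolding poly_bounded_def by (meson le_trans)

lemma polyb_const [intro!, simp]: "poly_bounded (\<lambda>x. n)"
  unfolding poly_bounded_def
proof (intro exI allI)
  fix x :: 'a
  have "n \<le> 2 ^ n" by (simp add: less_imp_le)
  also have "\<dots> \<le> (sz x + 2) ^ n" by (rule power_mono) auto
  finally show "n \<le> (sz x + 2) ^ n" .
qed

lemma polyb_sz [intro!, simp]: "poly_bounded (\<lambda>x. sz x)"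
  unfolding poly_bounded_def by (rule exI[of _ 1]) simp

lemma polyb_mult [intro!, simp]:
  assumes "poly_bounded f" "poly_bounded g" shows "poly_bounded (\<lambda>x. f x * g x)"
proof -
  obtain c c' where c: "\<And>x. f x \<le> (sz x + 2) ^ c" "\<And>x. g x \<le> (sz x + 2) ^ c'"
    using assms unfolding poly_bounded_def by blast
  have "f x * g x \<le> (sz x + 2) ^ (c + c')" for x
    unfolding power_add by (intro mult_mono c) auto
  then show ?thesis unfolding poly_bounded_def by blast
qed

lemma polyb_add [intro!, simp]:
  assumes "poly_bounded f" "poly_bounded g" shows "poly_bounded (\<lambda>x. f x + g x)"
proof -
  have "poly_bounded (\<lambda>x. 2 * ((f x + 1) * (g x + 1)))" if "poly_bounded (\<lambda>x. f x + 1)" "poly_bounded (\<lambda>x. g x + 1)"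
    by (rule polyb_mult[OF polyb_const polyb_mult[OF that]])
  moreover have suc: "poly_bounded (\<lambda>x. h x + 1)" if h: "poly_bounded h" for h :: "'a \<Rightarrow> nat"
  proof -
    obtain c where c: "\<And>x. h x \<le> (sz x + 2) ^ c" using h unfolding poly_bounded_def by blast
    have "h x + 1 \<le> (sz x + 2) ^ Suc c" for x
    proof -
      have "1 \<le> (sz x + 2) ^ c" by simp
      then have "h x + 1 \<le> 2 * (sz x + 2) ^ c" using c[of x] by linarith
      also have "\<dots> \<le> (sz x + 2) * (sz x + 2) ^ c" by (rule mult_right_mono) auto
      finally show ?thesis by simp
    qed
    then show ?thesis unfolding poly_bounded_def by blast
  qed
  ultimately have "poly_bounded (\<lambda>x. 2 * ((f x + 1) * (g x + 1)))" using assms by blast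
  then show ?thesis by (rule polyb_mono) (simp add: algebra_simps)
qed

lemma polyb_Suc [intro!, simp]: "poly_bounded f \<Longrightarrow> poly_bounded (\<lambda>x. Suc (f x))"
  using polyb_add[of f "\<lambda>_. 1"] by simp

lemma polyb_power [intro!, simp]: "poly_bounded f \<Longrightarrow> poly_bounded (\<lambda>x. f x ^ n)"
  by (induction n) auto

lemma polyb_comp:
  assumes g: "poly_bounded g" and f: "poly_bounded (\<lambda>x. sz (f x))"
  shows "poly_bounded (\<lambda>x. g (f x))"
proof -
  obtain c where c: "\<And>x. g x \<le> (sz x + 2) ^ c" using g unfolding poly_bounded_def by blast
  have "poly_bounded (\<lambda>x. (sz (f x) + 2) ^ c)" using f by auto
  then show ?thesis by (rule polyb_mono) (rule c)
qed

section \<open>Programs with bounded cost\<close>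

definition run :: "com \<Rightarrow> state \<Rightarrow> state \<Rightarrow> nat \<Rightarrow> bool" where
  "run p s s' T \<longleftrightarrow> (\<exists>t\<le>T. exec p s t s')"

lemma run_mono: "run p s s' T \<Longrightarrow> T \<le> T' \<Longrightarrow> run p s s' T'"
  unfolding run_def by (meson le_trans)

lemma run_Assign: "run (Assign v e) s (s(v := eval e s)) (Suc (cost e s))"
  unfolding run_def by (meson exec.Assign order_refl)

lemma run_Seq: "run p s s' T \<Longrightarrow> run q s' s'' T' \<Longrightarrow> run (Seq p q) s s'' (Suc (T + T'))"
  unfolding run_def by (meson exec.Seq add_mono Suc_le_mono)

lemma run_CondTrue: "eval e s \<noteq> Leaf \<Longrightarrow> run p s s' T \<Longrightarrow> run (Cond e p q) s s' (Suc (cost e s + T))"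
  unfolding run_def by (meson exec.CondTrue add_left_mono Suc_le_mono)

lemma run_CondFalse: "eval e s = Leaf \<Longrightarrow> run q s s' T \<Longrightarrow> run (Cond e p q) s s' (Suc (cost e s + T))"
  unfolding run_def by (meson exec.CondFalse add_left_mono Suc_le_mono)

lemma run_WhileFalse: "eval e s = Leaf \<Longrightarrow> run (While e p) s s (Suc (cost e s))"
  unfolding run_def by (meson exec.WhileFalse order_refl)

lemma run_WhileTrue:
  "eval e s \<noteq> Leaf \<Longrightarrow> run p s s' T \<Longrightarrow> run (While e p) s' s'' T' \<Longrightarrow>
    run (While e p) s s'' (Suc (cost e s + T + T'))"
  unfolding run_def by (meson exec.WhileTrue add_mono Suc_le_mono order_refl)

lemma dsize_eval_le_cost: "dsize (eval e s) \<le> cost e s"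
  by (cases e) auto

text \<open>The cost of an assignment includes the size of the value assigned, so no variable grows
  by more than the cost spent. Polynomial time thus bounds output sizes as well.\<close>

lemma dsize_exec: "exec p s t s' \<Longrightarrow> dsize (s' v) \<le> dsize (s v) + t"
proof (induction rule: exec.induct)
  case (Assign w e s)
  then show ?case using dsize_eval_le_cost[of e s] by auto
qed auto

text \<open>
  The program for a function may be run in any state whose scratch variables \<open>1, \<dots>, N - 1\<close> are
  \<open>Leaf\<close>, and it leaves all variables but variable 0 unchanged; so programs can be nested, and
  variables from \<open>N\<close> on survive a call.
\<close>

definition realizes :: "com \<Rightarrow> nat \<Rightarrow> ('a::enc \<Rightarrow> nat) \<Rightarrow> ('a \<Rightarrow> 'b::enc) \<Rightarrow> bool" where
  "realizes p N T f \<longleftrightarrow> poly_bounded T \<and> 0 < N \<and> (\<forall>x s. s 0 = encode x \<longrightarrow>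
     (\<forall>v. 0 < v \<and> v < N \<longrightarrow> s v = Leaf) \<longrightarrow> run p s (s(0 := encode (f x))) (T x))"

definition polytime :: "('a::enc \<Rightarrow> 'b::enc) \<Rightarrow> bool" where
  "polytime f \<longleftrightarrow> (\<exists>p N T. realizes p N T f)"

lemma ptI:
  assumes "poly_bounded T" "0 < N"
    and "\<And>x s. s 0 = encode x \<Longrightarrow> (\<And>v. 0 < v \<Longrightarrow> v < N \<Longrightarrow> s v = Leaf) \<Longrightarrow> run p s (s(0 := encode (f x))) (T x)"
  shows "polytime f"
  unfolding polytime_def realizes_def
  by (intro exI[of _ p] exI[of _ N] exI[of _ T] conjI allI impI assms) simp_all

lemma realizes_run:
  "realizes p N T f \<Longrightarrow> s 0 = encode x \<Longrightarrow> (\<And>v. 0 < v \<Longrightarrow> v < N \<Longrightarrow> s v = Leaf) \<Longrightarrow>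
    run p s (s(0 := encode (f x))) (T x)"
  by (auto simp: realizes_def)

lemma realizes_polyb: "realizes p N T f \<Longrightarrow> poly_bounded T"
  and realizes_pos: "realizes p N T f \<Longrightarrow> 0 < N"
  by (auto simp: realizes_def)

lemma polyb_sz_pt:
  assumes "polytime f" shows "poly_bounded (\<lambda>x. sz (f x))"
proof -
  obtain p N T where r: "realizes p N T f"
    using assms unfolding polytime_def by blast
  have "sz (f x) \<le> sz x + T x" for x
  proof -
    define s :: state where "s = (\<lambda>_. Leaf)(0 := encode x)"
    have "run p s (s(0 := encode (f x))) (T x)" by (rule realizes_run[OF r]) (auto simp: s_def)
    then obtain t where "t \<le> T x" "exec p s t (s(0 := encode (f x)))" unfolding run_def by blast
    with dsize_exec[OF this(2), of 0] show ?thesis by (simp add: s_def)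
  qed
  moreover have "poly_bounded (\<lambda>x. sz x + T x)" using realizes_polyb[OF r] by auto
  ultimately show ?thesis by (rule polyb_mono[rotated])
qed

lemma pt_comp:
  assumes f: "polytime f" and g: "polytime g" shows "polytime (\<lambda>x. g (f x))"
proof -
  obtain p N T where r: "realizes p N T f"
    using f unfolding polytime_def by blast
  obtain q N' T' where r': "realizes q N' T' g"
    using g unfolding polytime_def by blast
  show ?thesis
  proof (rule ptI[where p = "Seq p q" and N = "max N N'" and T = "\<lambda>x. Suc (T x + T' (f x))"])
    show "poly_bounded (\<lambda>x. Suc (T x + T' (f x)))"
      using realizes_polyb[OF r] polyb_comp[OF realizes_polyb[OF r'] polyb_sz_pt[OF f]] by auto
    fix x :: 'a and s :: state assume s: "s 0 = encode x" "\<And>v. 0 < v \<Longrightarrow> v < max N N' \<Longrightarrow> s v = Leaf"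
    have "run p s (s(0 := encode (f x))) (T x)" using s by (intro realizes_run[OF r]) auto
    moreover have "run q (s(0 := encode (f x))) ((s(0 := encode (f x)))(0 := encode (g (f x)))) (T' (f x))"
      using s by (intro realizes_run[OF r']) auto
    ultimately show "run (Seq p q) s (s(0 := encode (g (f x)))) (Suc (T x + T' (f x)))"
      using run_Seq by force
  qed (use realizes_pos[OF r] in simp)
qed

fun evars :: "expr \<Rightarrow> nat set" where
  "evars (Var v) = {v}"
| "evars LeafE = {}"
| "evars (NodeE a b) = evars a \<union> evars b"
| "evars (Left a) = evars a"
| "evars (Right a) = evars a"
| "evars (Eq a b) = evars a \<union> evars b"

lemma dsize_dleft: "dsize (dleft d) \<le> dsize d"
  and dsize_dright: "dsize (dright d) \<le> dsize d"
  by (cases d; simp)+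

lemma cost_linear: "evars e \<subseteq> {0} \<Longrightarrow> \<exists>K. \<forall>s. cost e s \<le> K * dsize (s 0)"
proof (induction e)
  case (Var v)
  then show ?case by (intro exI[of _ 1]) auto
next
  case LeafE
  then show ?case by (intro exI[of _ 1]) auto
next
  case (NodeE a b)
  then obtain K K' where K: "\<And>s. cost a s \<le> K * dsize (s 0)" "\<And>s. cost b s \<le> K' * dsize (s 0)"
    by force
  have "cost (NodeE a b) s \<le> (2 * K + 2 * K' + 1) * dsize (s 0)" for s
  proof -
    have "cost (NodeE a b) s \<le> 1 + 2 * cost a s + 2 * cost b s"
      using dsize_eval_le_cost[of a s] dsize_eval_le_cost[of b s] by simp
    also have "\<dots> \<le> dsize (s 0) + 2 * (K * dsize (s 0)) + 2 * (K' * dsize (s 0))"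
      using dsize_ge_1[of "s 0"] K[of s] by linarith
    finally show ?thesis by (simp add: algebra_simps)
  qed
  then show ?case by blast
next
  case (Left a)
  then obtain K where K: "\<And>s. cost a s \<le> K * dsize (s 0)" by auto
  have "cost (Left a) s \<le> (2 * K) * dsize (s 0)" for s
    using K[of s] dsize_eval_le_cost[of a s] dsize_dleft[of "eval a s"] by (simp add: algebra_simps)
  then show ?case by blast
next
  case (Right a)
  then obtain K where K: "\<And>s. cost a s \<le> K * dsize (s 0)" by auto
  have "cost (Right a) s \<le> (2 * K) * dsize (s 0)" for s
    using K[of s] dsize_eval_le_cost[of a s] dsize_dright[of "eval a s"] by (simp add: algebra_simps)
  then show ?case by blast
next
  case (Eq a b)
  then obtain K K' where K: "\<And>s. cost a s \<le> K * dsize (s 0)" "\<And>s. cost b s \<le> K' * dsize (s 0)"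
    by force
  have "cost (Eq a b) s \<le> (K + K' + 3) * dsize (s 0)" for s
  proof -
    have "cost (Eq a b) s \<le> 3 + cost a s + cost b s" by simp
    also have "\<dots> \<le> 3 * dsize (s 0) + K * dsize (s 0) + K' * dsize (s 0)"
      using dsize_ge_1[of "s 0"] K[of s] by linarith
    finally show ?thesis by (simp add: algebra_simps)
  qed
  then show ?case by blast
qed

lemma pt_expr:
  assumes e: "evars e \<subseteq> {0}" and f: "\<And>x s. s 0 = encode x \<Longrightarrow> eval e s = encode (f x)"
  shows "polytime f"
proof -
  obtain K where K: "\<And>s. cost e s \<le> K * dsize (s 0)" using cost_linear[OF e] by blast
  show ?thesis
  proof (rule ptI[where p = "Assign 0 e" and N = 1 and T = "\<lambda>x. Suc (K * sz x)"])
    fix x :: 'a and s :: state assume "s 0 = encode x"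
    then show "run (Assign 0 e) s (s(0 := encode (f x))) (Suc (K * sz x))"
      using run_Assign[of 0 e s] K[of s] f[of s x] by (auto intro: run_mono)
  qed auto
qed

lemma pt_id [intro!, simp]: "polytime (\<lambda>x. x)"
  by (rule pt_expr[of "Var 0"]) auto

lemma pt_const [intro!, simp]: "polytime (\<lambda>x. c)"
proof -
  have "\<exists>e. evars e = {} \<and> (\<forall>s. eval e s = d)" for d
  proof (induction d)
    case Leaf
    show ?case by (rule exI[of _ LeafE]) auto
  next
    case (Node a b)
    then obtain e e' where "evars e = {}" "evars e' = {}" "\<forall>s. eval e s = a" "\<forall>s. eval e' s = b" by blast
    then show ?case by (intro exI[of _ "NodeE e e'"]) auto
  qed
  then obtain e where "evars e = {}" "\<forall>s. eval e s = encode c" by blast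
  then show ?thesis by (intro pt_expr[of e]) auto
qed

lemma pt_Pair:
  assumes f: "polytime f" and g: "polytime g" shows "polytime (\<lambda>x. (f x, g x))"
proof -
  obtain p N1 T where r: "realizes p N1 T f"
    using f unfolding polytime_def by blast
  obtain q N2 T' where r': "realizes q N2 T' g"
    using g unfolding polytime_def by blast
  define N where "N = max N1 N2"
  \<comment> \<open>Variable \<open>N\<close> keeps the argument and \<open>Suc N\<close> the first
    result, above the scratch variables of \<open>p\<close> and \<open>q\<close>; both are reset to
    \<open>Leaf\<close>, their initial value, as \<open>realizes\<close> demands.\<close>
  define prog where "prog = Seq (Assign N (Var 0)) (Seq p (Seq (Assign (Suc N) (Var 0)) (Seq (Assign 0 (Var N))
     (Seq (Assign N LeafE) (Seq q (Seq (Assign 0 (NodeE (Var (Suc N)) (Var 0))) (Assign (Suc N) LeafE)))))))"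
  define B where "B = (\<lambda>x. T x + T' x + 2 * sz x + 3 * sz (f x) + 2 * sz (g x) + 20)"
  show ?thesis
  proof (rule ptI[where p = prog and N = "N + 2" and T = B])
    show "poly_bounded B" unfolding B_def using realizes_polyb[OF r] realizes_polyb[OF r'] polyb_sz_pt[OF f] polyb_sz_pt[OF g] by auto
    fix x :: 'a and s :: state assume s: "s 0 = encode x" "\<And>v. 0 < v \<Longrightarrow> v < N + 2 \<Longrightarrow> s v = Leaf"
    have N: "0 < N" "N1 \<le> N" "N2 \<le> N" using realizes_pos[OF r] by (auto simp: N_def)
    define s1 where "s1 = s(N := encode x)"
    define s2 where "s2 = s1(0 := encode (f x))"
    define s3 where "s3 = s2(Suc N := encode (f x))"
    define s4 where "s4 = s3(0 := encode x)"
    define s5 where "s5 = s4(N := Leaf)"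
    define s6 where "s6 = s5(0 := encode (g x))"
    define s7 where "s7 = s6(0 := encode (f x, g x))"
    have r1: "run (Assign N (Var 0)) s s1 (Suc (sz x))"
      using run_Assign[of N "Var 0" s] s by (simp add: s1_def)
    have r2: "run p s1 s2 (T x)" unfolding s2_def using s N by (intro realizes_run[OF r]) (auto simp: s1_def)
    have r3: "run (Assign (Suc N) (Var 0)) s2 s3 (Suc (sz (f x)))"
      using run_Assign[of "Suc N" "Var 0" s2] by (simp add: s3_def s2_def)
    have r4: "run (Assign 0 (Var N)) s3 s4 (Suc (sz x))"
      using run_Assign[of 0 "Var N" s3] N by (simp add: s4_def s3_def s2_def s1_def)
    have r5: "run (Assign N LeafE) s4 s5 (Suc 1)"
      using run_Assign[of N LeafE s4] by (simp add: s5_def)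
    have r6: "run q s5 s6 (T' x)" unfolding s6_def using s N
      by (intro realizes_run[OF r']) (auto simp: s5_def s4_def s3_def s2_def s1_def)
    have r7: "run (Assign 0 (NodeE (Var (Suc N)) (Var 0))) s6 s7 (Suc (sz (f x) + sz (g x) + Suc (sz (f x) + sz (g x))))"
      using run_Assign[of 0 "NodeE (Var (Suc N)) (Var 0)" s6] N
      by (simp add: s7_def s6_def s5_def s4_def s3_def)
    have r8: "run (Assign (Suc N) LeafE) s7 (s7(Suc N := Leaf)) (Suc 1)"
      using run_Assign[of "Suc N" LeafE s7] by simp
    have "run prog s (s7(Suc N := Leaf)) (B x)"
      unfolding prog_def
      by (rule run_mono[OF run_Seq[OF r1 run_Seq[OF r2 run_Seq[OF r3 run_Seq[OF r4 run_Seq[OF r5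
            run_Seq[OF r6 run_Seq[OF r7 r8]]]]]]]]) (simp add: B_def)
    moreover have "s7(Suc N := Leaf) = s(0 := encode (f x, g x))"
      using s N unfolding s7_def s6_def s5_def s4_def s3_def s2_def s1_def by (intro ext) auto
    ultimately show "run prog s (s(0 := encode (f x, g x))) (B x)" by simp
  qed simp
qed

lemma pt_If:
  assumes b: "polytime b" and f: "polytime f" and g: "polytime g" shows "polytime (\<lambda>x. if b x then f x else g x)"
proof -
  have pb: "polytime (\<lambda>x. (b x, x))" by (intro pt_Pair b pt_id)
  obtain p0 N0 T0 where r0: "realizes p0 N0 T0 (\<lambda>x. (b x, x))"
    using pb unfolding polytime_def by blast
  obtain p N1 T where r: "realizes p N1 T f"
    using f unfolding polytime_def by blast
  obtain q N2 T' where r': "realizes q N2 T' g"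
    using g unfolding polytime_def by blast
  define N where "N = max N0 (max N1 N2)"
  define prog where "prog = Seq p0 (Cond (Left (Var 0)) (Seq (Assign 0 (Right (Var 0))) p) (Seq (Assign 0 (Right (Var 0))) q))"
  define B where "B = (\<lambda>x. T0 x + T x + T' x + 4 * sz x + 100)"
  show ?thesis
  proof (rule ptI[where p = prog and N = N and T = B])
    show "poly_bounded B" unfolding B_def using realizes_polyb[OF r0] realizes_polyb[OF r] realizes_polyb[OF r'] by auto
    show "0 < N" using realizes_pos[OF r] by (simp add: N_def)
    fix x :: 'a and s :: state assume s: "s 0 = encode x" "\<And>v. 0 < v \<Longrightarrow> v < N \<Longrightarrow> s v = Leaf"
    have N: "N0 \<le> N" "N1 \<le> N" "N2 \<le> N" by (auto simp: N_def)
    define s1 where "s1 = s(0 := encode (b x, x))"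
    have 0: "run p0 s s1 (T0 x)" unfolding s1_def using s N by (intro realizes_run[OF r0]) auto
    have a: "run (Assign 0 (Right (Var 0))) s1 (s(0 := encode x)) (2 * sz x + 6)"
      using run_mono[OF run_Assign[of 0 "Right (Var 0)" s1], of "2 * sz x + 6"]
      by (simp add: s1_def encode_bool_def)
    show "run prog s (s(0 := encode (if b x then f x else g x))) (B x)"
    proof (cases "b x")
      case True
      have "run p (s(0 := encode x)) (s(0 := encode (f x))) (T x)"
        using realizes_run[OF r, of "s(0 := encode x)" x] s N by simp
      then have "run (Cond (Left (Var 0)) (Seq (Assign 0 (Right (Var 0))) p) (Seq (Assign 0 (Right (Var 0))) q)) s1
        (s(0 := encode (f x))) (T x + 4 * sz x + 99)"
        by (rule run_mono[OF run_CondTrue[OF _ run_Seq[OF a]], rotated]) (simp_all add: s1_def True)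
      from run_mono[OF run_Seq[OF 0 this], of "B x"] show ?thesis by (simp add: True prog_def B_def)
    next
      case False
      have "run q (s(0 := encode x)) (s(0 := encode (g x))) (T' x)"
        using realizes_run[OF r', of "s(0 := encode x)" x] s N by simp
      then have "run (Cond (Left (Var 0)) (Seq (Assign 0 (Right (Var 0))) p) (Seq (Assign 0 (Right (Var 0))) q)) s1
        (s(0 := encode (g x))) (T' x + 4 * sz x + 99)"
        by (rule run_mono[OF run_CondFalse[OF _ run_Seq[OF a]], rotated]) (simp_all add: s1_def False)
      from run_mono[OF run_Seq[OF 0 this], of "B x"] show ?thesis by (simp add: False prog_def B_def)
    qed
  qed
qed

text \<open>The only loop that is programmed; the list operations below are reduced to it. The bound
  \<open>M\<close> on all intermediate accumulators is a premise because iterating a polynomial-time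
  step may let sizes explode. The environment \<open>e\<close> is handed to the step since a program
  has a single argument.\<close>

lemma pt_foldl:
  fixes I :: "'e::enc \<Rightarrow> 'a::enc" and L :: "'e \<Rightarrow> 'b::enc list"
  assumes L: "polytime L" and I: "polytime I" and S: "polytime (\<lambda>z. S (fst z) (fst (snd z)) (snd (snd z)))"
    and M: "poly_bounded M" and bound: "\<And>e ys zs. L e = ys @ zs \<Longrightarrow> sz (foldl (S e) (I e) ys) \<le> M e"
  shows "polytime (\<lambda>e. foldl (S e) (I e) (L e))"
proof -
  obtain p1 N1 T1 where r1: "realizes p1 N1 T1 L" using L unfolding polytime_def by blast
  obtain p2 N2 T2 where r2: "realizes p2 N2 T2 I" using I unfolding polytime_def by blast
  obtain q N3 T3 where r3: "realizes q N3 T3 (\<lambda>z. S (fst z) (fst (snd z)) (snd (snd z)))"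
    using S unfolding polytime_def by blast
  obtain c where c: "\<And>z. T3 z \<le> (sz z + 2) ^ c"
    using realizes_polyb[OF r3] unfolding poly_bounded_def by blast
  define N where "N = max N1 (max N2 N3)"
  have N: "0 < N" "N1 \<le> N" "N2 \<le> N" "N3 \<le> N" using realizes_pos[OF r1] by (auto simp: N_def)
  define body where "body = Seq (Assign 0 (NodeE (Var N) (NodeE (Var 0) (Left (Var (Suc N))))))
    (Seq q (Assign (Suc N) (Right (Var (Suc N)))))"
  \<comment> \<open>Cost of one iteration on sizes \<open>n\<close>: the linear part pays for the
    test and the assignments, the power for the step \<open>q\<close>.\<close>
  define B :: "nat \<Rightarrow> nat" where "B n = 12 * n + 20 + (n + 10) ^ c" for n
  have loop: "run (While (Var (Suc N)) body) (s(0 := encode a, N := encode e, Suc N := encode ys))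
      (s(0 := encode (foldl (S e) a ys), N := encode e, Suc N := Leaf)) ((length ys + 1) * B (sz e + m + l))"
    if "\<And>zs ws. ys = zs @ ws \<Longrightarrow> sz (foldl (S e) a zs) \<le> m" "sz ys \<le> l"
      "\<And>v. 0 < v \<Longrightarrow> v < N \<Longrightarrow> s v = Leaf" for e a m l s and ys :: "'b list"
    using that
  proof (induction ys arbitrary: a)
    case Nil
    show ?case unfolding foldl_Nil encode_Nil
      by (rule run_mono[OF run_WhileFalse]) (simp_all add: B_def)
  next
    case (Cons y ys)
    let ?n = "sz e + m + l"
    define s0 where "s0 = s(0 := encode a, N := encode e, Suc N := encode (y # ys))"
    define s1 where "s1 = s0(0 := encode (e, a, y))"
    define s2 where "s2 = s1(0 := encode (S e a y))"
    define s3 where "s3 = s(0 := encode (S e a y), N := encode e, Suc N := encode ys)"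
    have a: "sz a \<le> m" using Cons.prems(1)[of "[]"] by simp
    have y: "sz y + sz ys \<le> l" using Cons.prems(2) by simp
    have 1: "run (Assign 0 (NodeE (Var N) (NodeE (Var 0) (Left (Var (Suc N)))))) s0 s1 (6 * ?n + 8)"
      using run_mono[OF run_Assign[of 0 "NodeE (Var N) (NodeE (Var 0) (Left (Var (Suc N))))" s0], of "6 * ?n + 8"]
        N a y Cons.prems(2) by (simp add: s0_def s1_def)
    have "T3 (e, a, y) \<le> (sz (e, a, y) + 2) ^ c" by (rule c)
    also have "\<dots> \<le> (?n + 10) ^ c" using a y by (intro power_mono) auto
    finally have 2: "run q s1 s2 ((?n + 10) ^ c)" unfolding s2_def
      using realizes_run[OF r3, of s1 "(e, a, y)"] Cons.prems(3) N
      by (auto simp: s1_def s0_def intro: run_mono)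
    have "s2(Suc N := encode ys) = s3"
      using N by (auto simp: s3_def s2_def s1_def s0_def fun_eq_iff)
    then have 3: "run (Assign (Suc N) (Right (Var (Suc N)))) s2 s3 (2 * ?n + 1)"
      using run_mono[OF run_Assign[of "Suc N" "Right (Var (Suc N))" s2], of "2 * ?n + 1"] N y Cons.prems(2)
      by (simp add: s2_def s1_def s0_def)
    have 4: "run (While (Var (Suc N)) body) s3
      (s(0 := encode (foldl (S e) (S e a y) ys), N := encode e, Suc N := Leaf)) ((length ys + 1) * B ?n)"
      unfolding s3_def
    proof (rule Cons.IH)
      show "sz (foldl (S e) (S e a y) zs) \<le> m" if "ys = zs @ ws" for zs ws
        using Cons.prems(1)[of "y # zs" ws] that by simp
    qed (use Cons.prems y in auto)
    have "run (While (Var (Suc N)) body) s0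
      (s(0 := encode (foldl (S e) a (y # ys)), N := encode e, Suc N := Leaf)) ((length (y # ys) + 1) * B ?n)"
      unfolding foldl_Cons
      using run_mono[OF run_WhileTrue[OF _ run_Seq[OF 1 run_Seq[OF 2 3]] 4[unfolded body_def]],
          of "(length (y # ys) + 1) * B ?n"] Cons.prems(2)
      unfolding body_def by (simp add: s0_def B_def)
    then show ?case unfolding s0_def .
  qed
  define prog where "prog = Seq (Assign N (Var 0)) (Seq p1 (Seq (Assign (Suc N) (Var 0)) (Seq (Assign 0 (Var N))
     (Seq p2 (Seq (While (Var (Suc N)) body) (Assign N LeafE))))))"
  define U where "U = (\<lambda>e. 20 + 2 * sz e + T1 e + sz (L e) + T2 e + (sz (L e) + 1) * B (sz e + M e + sz (L e)))"
  show ?thesis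
  proof (rule ptI[where p = prog and N = "N + 2" and T = U])
    show "poly_bounded U" unfolding U_def B_def
      using realizes_polyb[OF r1] realizes_polyb[OF r2] M polyb_sz_pt[OF L] by (intro polyb_add polyb_mult polyb_power) auto
    fix e :: 'e and s :: state
    assume s: "s 0 = encode e" "\<And>v. 0 < v \<Longrightarrow> v < N + 2 \<Longrightarrow> s v = Leaf"
    define s1 where "s1 = s(N := encode e)"
    define s2 where "s2 = s1(0 := encode (L e))"
    define s3 where "s3 = s2(Suc N := encode (L e))"
    define s4 where "s4 = s3(0 := encode e)"
    define s5 where "s5 = s(0 := encode (I e), N := encode e, Suc N := encode (L e))"
    define s6 where "s6 = s(0 := encode (foldl (S e) (I e) (L e)), N := encode e, Suc N := Leaf)"
    have a1: "run (Assign N (Var 0)) s s1 (Suc (sz e))"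
      using run_Assign[of N "Var 0" s] s by (simp add: s1_def)
    have a2: "run p1 s1 s2 (T1 e)" unfolding s2_def using s N
      by (intro realizes_run[OF r1]) (auto simp: s1_def)
    have a3: "run (Assign (Suc N) (Var 0)) s2 s3 (Suc (sz (L e)))"
      using run_Assign[of "Suc N" "Var 0" s2] by (simp add: s3_def s2_def)
    have a4: "run (Assign 0 (Var N)) s3 s4 (Suc (sz e))"
      using run_Assign[of 0 "Var N" s3] N by (simp add: s4_def s3_def s2_def s1_def)
    have "run p2 s4 (s4(0 := encode (I e))) (T2 e)" using s N
      by (intro realizes_run[OF r2]) (auto simp: s1_def s2_def s3_def s4_def)
    moreover have "s4(0 := encode (I e)) = s5"
      using N by (auto simp: s1_def s2_def s3_def s4_def s5_def fun_eq_iff)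
    ultimately have a5: "run p2 s4 s5 (T2 e)" by simp
    have "length zs \<le> sz zs" for zs :: "'b list" by (induction zs) auto
    then have "(length (L e) + 1) * B (sz e + M e + sz (L e)) \<le> (sz (L e) + 1) * B (sz e + M e + sz (L e))"
      by (intro mult_right_mono) auto
    then have a6: "run (While (Var (Suc N)) body) s5 s6 ((sz (L e) + 1) * B (sz e + M e + sz (L e)))"
      unfolding s5_def s6_def using s bound N by (intro run_mono[OF loop]) auto
    have a7: "run (Assign N LeafE) s6 (s6(N := Leaf)) (Suc 1)"
      using run_Assign[of N LeafE s6] by simp
    have "run prog s (s6(N := Leaf)) (U e)"
      unfolding prog_def
      by (rule run_mono[OF run_Seq[OF a1 run_Seq[OF a2 run_Seq[OF a3 run_Seq[OF a4 run_Seq[OF a5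
            run_Seq[OF a6 a7]]]]]]]) (simp add: U_def)
    moreover have "s6(N := Leaf) = s(0 := encode (foldl (S e) (I e) (L e)))"
      using s N unfolding s6_def by (auto simp: fun_eq_iff)
    ultimately show "run prog s (s(0 := encode (foldl (S e) (I e) (L e)))) (U e)" by simp
  qed simp
qed

section \<open>Closure properties of polynomial time\<close>

lemmas pt_intros = pt_id pt_const pt_Pair pt_If

text \<open>The program only sees encodings, so types with coinciding encodings are exchanged for
  free, such as non-empty lists and pairs, or numbers and unit lists.\<close>

lemma pt_retype: "polytime f \<Longrightarrow> (\<And>x. encode (f x) = encode (g x)) \<Longrightarrow> polytime g"
  unfolding polytime_def realizes_def by simp

lemma pt_fst: "polytime f \<Longrightarrow> polytime (\<lambda>x. fst (f x))"
  by (erule pt_comp, rule pt_expr[of "Left (Var 0)"]) (auto simp: encode_prod_def)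

lemma pt_snd: "polytime f \<Longrightarrow> polytime (\<lambda>x. snd (f x))"
  by (erule pt_comp, rule pt_expr[of "Right (Var 0)"]) (auto simp: encode_prod_def)

lemma pt_Cons: "polytime f \<Longrightarrow> polytime g \<Longrightarrow> polytime (\<lambda>x. f x # g x)"
  by (rule pt_retype[OF pt_Pair]) auto

text \<open>\<open>Eq\<close> compares trees; injectivity of \<open>encode\<close> turns this into
  equality of values.\<close>

lemma pt_eq:
  assumes "polytime f" "polytime g" shows "polytime (\<lambda>x. f x = g x)"
proof -
  have "polytime (\<lambda>p :: 'b \<times> 'b. fst p = snd p)"
    by (rule pt_expr[of "Eq (Left (Var 0)) (Right (Var 0))"]) (auto simp: encode_prod_def encode_bool_def)
  from pt_comp[OF pt_Pair[OF assms] this] show ?thesis by simp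
qed

lemma pt_not:
  assumes "polytime f" shows "polytime (\<lambda>x. \<not> f x)"
  using pt_eq[OF assms pt_const[of False]] by simp

lemma pt_conj:
  assumes "polytime f" "polytime g" shows "polytime (\<lambda>x. f x \<and> g x)"
proof -
  have "polytime (\<lambda>x. if f x then g x else False)" by (intro pt_If assms pt_const)
  moreover have "(\<lambda>x. if f x then g x else False) = (\<lambda>x. f x \<and> g x)" by auto
  ultimately show ?thesis by (simp only:)
qed

lemma pt_disj:
  assumes "polytime f" "polytime g" shows "polytime (\<lambda>x. f x \<or> g x)"
  using pt_not[OF pt_conj[OF pt_not[OF assms(1)] pt_not[OF assms(2)]]] by simp

lemma pt_imp:
  assumes "polytime f" "polytime g" shows "polytime (\<lambda>x. f x \<longrightarrow> g x)"
  using pt_disj[OF pt_not[OF assms(1)] assms(2)] unfolding imp_conv_disj .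

lemma pt_case_list:
  assumes L: "polytime L" and A: "polytime A" and B: "polytime (\<lambda>z. B (fst z) (fst (snd z)) (snd (snd z)))"
  shows "polytime (\<lambda>e. case L e of [] \<Rightarrow> A e | y # ys \<Rightarrow> B e y ys)"
proof -
  \<comment> \<open>A non-empty list and the pair of its head and tail have the same encoding, so
    decomposing it takes no computation. The constant \<open>undefined\<close> makes
    \<open>f\<close> total.\<close>
  define f where "f e = (if L e = [] then undefined else (hd (L e), tl (L e)))" for e
  have "polytime (\<lambda>e. encode (L e))" by (rule pt_retype[OF L]) (simp add: encode_data_def)
  then have "polytime (\<lambda>e. if L e = [] then encode (undefined :: 'b \<times> 'b list) else encode (L e))"
    by (intro pt_If pt_eq L pt_const)
  then have "polytime f"
  proof (rule pt_retype)
    show "encode (if L e = [] then encode (undefined :: 'b \<times> 'b list) else encode (L e)) = encode (f e)" for e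
      by (cases "L e") (simp_all add: f_def encode_data_def)
  qed
  from pt_comp[OF pt_Pair[OF pt_id this] B]
  have "polytime (\<lambda>e. if L e = [] then A e else B e (fst (f e)) (snd (f e)))"
    by (intro pt_If pt_eq L A pt_const) simp
  moreover have "(if L e = [] then A e else B e (fst (f e)) (snd (f e))) =
      (case L e of [] \<Rightarrow> A e | y # ys \<Rightarrow> B e y ys)" for e
    by (cases "L e") (simp_all add: f_def)
  ultimately show ?thesis by simp
qed

lemma pt_comp2:
  assumes "polytime (\<lambda>z. H (fst z) (snd z))" "polytime f" "polytime g" shows "polytime (\<lambda>x. H (f x) (g x))"
  using pt_comp[OF pt_Pair[OF assms(2,3)] assms(1)] by simp

lemma foldl_Cons_rev: "foldl (\<lambda>a x. f x # a) b xs = rev (map f xs) @ b"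
  by (induction xs arbitrary: b) auto

lemma sz_append: "Suc (sz (xs @ ys)) = sz xs + sz ys"
  by (simp add: sz_list)

lemma sz_le_append: "sz xs \<le> sz (xs @ ys)" "sz ys \<le> sz (xs @ ys)"
  by (simp_all add: sz_list)

lemma sz_rev [simp]: "sz (rev xs) = sz xs"
  by (simp add: sz_list rev_map[symmetric])

lemma length_le_sz: "length xs \<le> sz xs"
  by (induction xs) auto

lemma sz_elem: "x \<in> set xs \<Longrightarrow> sz x \<le> sz xs"
  by (induction xs) auto

lemma sz_list_bound: "(\<And>x. x \<in> set xs \<Longrightarrow> sz x \<le> m) \<Longrightarrow> sz xs \<le> Suc (length xs * Suc m)"
  by (induction xs) force+

lemma pt_rev: "polytime L \<Longrightarrow> polytime (\<lambda>e. rev (L e))"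
proof -
  assume L: "polytime L"
  have "polytime (\<lambda>e. foldl (\<lambda>a x. x # a) [] (L e))"
    by (rule pt_foldl[where M = "\<lambda>e. sz (L e)"] pt_intros pt_Cons pt_fst pt_snd L polyb_sz_pt)+
      (simp add: foldl_Cons_rev[of "\<lambda>x. x", simplified] sz_le_append)
  then show ?thesis by (simp add: foldl_Cons_rev[of "\<lambda>x. x", simplified])
qed

lemma pt_append:
  assumes "polytime F" "polytime G" shows "polytime (\<lambda>e. F e @ G e)"
proof -
  have "polytime (\<lambda>e. foldl (\<lambda>a x. x # a) (G e) (rev (F e)))"
  proof (rule pt_foldl[where M = "\<lambda>e. sz (F e) + sz (G e)"])
    fix e ys zs assume "rev (F e) = ys @ zs"
    then have "sz (rev (F e)) = sz (ys @ zs)" by simp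
    then show "sz (foldl (\<lambda>a x. x # a) (G e) ys) \<le> sz (F e) + sz (G e)"
      using sz_append[of "rev ys" "G e"] sz_le_append(1)[of ys zs]
      by (simp add: foldl_Cons_rev[of "\<lambda>x. x", simplified])
  qed (intro pt_rev pt_intros pt_Cons pt_fst pt_snd assms polyb_add polyb_sz_pt)+
  then show ?thesis by (simp add: foldl_Cons_rev[of "\<lambda>x. x", simplified])
qed

lemma pt_map:
  assumes L: "polytime L" and H: "polytime (\<lambda>z. H (fst z) (snd z))" shows "polytime (\<lambda>e. map (H e) (L e))"
proof -
  obtain c where c: "\<And>e x. sz (H e x) \<le> (sz (e, x) + 2) ^ c"
    using polyb_sz_pt[OF H] unfolding poly_bounded_def by (metis fst_conv snd_conv)
  have "polytime (\<lambda>e. foldl (\<lambda>a x. H e x # a) [] (L e))"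
  proof (rule pt_foldl[where M = "\<lambda>e. Suc (sz (L e) * Suc ((sz e + sz (L e) + 3) ^ c))"])
    fix e ys zs assume ys: "L e = ys @ zs"
    have "sz (H e x) \<le> (sz e + sz (L e) + 3) ^ c" if "x \<in> set ys" for x
    proof -
      have "sz (H e x) \<le> (sz (e, x) + 2) ^ c" by (rule c)
      also have "\<dots> \<le> (sz e + sz (L e) + 3) ^ c" using sz_elem[of x "L e"] ys that by (intro power_mono) auto
      finally show ?thesis .
    qed
    then have "sz (rev (map (H e) ys)) \<le> Suc (length ys * Suc ((sz e + sz (L e) + 3) ^ c))"
      using sz_list_bound[of "rev (map (H e) ys)"] by auto
    also have "\<dots> \<le> Suc (sz (L e) * Suc ((sz e + sz (L e) + 3) ^ c))"
      using length_le_sz[of "L e"] ys by (intro Suc_le_mono[THEN iffD2] mult_right_mono) auto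
    finally show "sz (foldl (\<lambda>a x. H e x # a) [] ys) \<le> Suc (sz (L e) * Suc ((sz e + sz (L e) + 3) ^ c))"
      by (simp add: foldl_Cons_rev)
  next
    show "poly_bounded (\<lambda>e. Suc (sz (L e) * Suc ((sz e + sz (L e) + 3) ^ c)))"
      using polyb_sz_pt[OF L] by (intro polyb_Suc polyb_mult polyb_power polyb_add) auto
  qed (intro pt_comp2[OF H] pt_intros pt_Cons pt_fst pt_snd L)+
  from pt_rev[OF this] show ?thesis by (simp add: foldl_Cons_rev)
qed

lemma foldl_append_concat: "foldl (\<lambda>a x. x @ a) b xs = concat (rev xs) @ b"
  by (induction xs arbitrary: b) auto

lemma sz_concat: "sz (concat xs) \<le> sz xs"
proof (induction xs)
  case (Cons x xs)
  then show ?case using sz_append[of x "concat xs"] by simp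
qed simp

lemma pt_concat:
  assumes L: "polytime L" shows "polytime (\<lambda>e. concat (L e))"
proof -
  have "polytime (\<lambda>e. foldl (\<lambda>a x. x @ a) [] (rev (L e)))"
  proof (rule pt_foldl[where M = "\<lambda>e. sz (L e)"])
    fix e ys zs assume "rev (L e) = ys @ zs"
    then have "sz (rev (L e)) = sz (ys @ zs)" by simp
    then show "sz (foldl (\<lambda>a x. x @ a) [] ys) \<le> sz (L e)"
      using sz_concat[of "rev ys"] sz_le_append(1)[of ys zs] by (simp add: foldl_append_concat)
  qed (intro pt_rev pt_intros pt_append pt_fst pt_snd L polyb_sz_pt)+
  then show ?thesis by (simp add: foldl_append_concat)
qed

lemma pt_filter:
  assumes "polytime L" "polytime (\<lambda>z. P (fst z) (snd z))" shows "polytime (\<lambda>e. filter (P e) (L e))"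
proof -
  have "concat (map (\<lambda>x. if p x then [x] else []) xs) = filter p xs" for p and xs :: "'b list"
    by (induction xs) auto
  moreover have "polytime (\<lambda>e. concat (map (\<lambda>x. if P e x then [x] else []) (L e)))"
    by (intro pt_concat pt_map pt_intros pt_Cons assms pt_fst pt_snd)
  ultimately show ?thesis by simp
qed

lemma pt_Bex:
  assumes "polytime L" "polytime (\<lambda>z. P (fst z) (snd z))" shows "polytime (\<lambda>e. \<exists>x\<in>set (L e). P e x)"
proof -
  have "polytime (\<lambda>e. \<not> filter (P e) (L e) = [])" by (intro pt_not pt_eq pt_filter assms pt_const)
  then show ?thesis by (simp add: filter_empty_conv)
qed

lemma pt_Ball:
  assumes "polytime L" "polytime (\<lambda>z. P (fst z) (snd z))" shows "polytime (\<lambda>e. \<forall>x\<in>set (L e). P e x)"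
  using pt_not[OF pt_Bex[OF assms(1) pt_not[OF assms(2)]]] by simp

lemma pt_mem:
  assumes "polytime f" "polytime L" shows "polytime (\<lambda>e. f e \<in> set (L e))"
proof -
  have "polytime (\<lambda>e. \<exists>x\<in>set (L e). x = f e)"
    by (intro pt_Bex pt_eq assms pt_comp[OF pt_fst[OF pt_id] assms(1)] pt_snd pt_id)
  then show ?thesis by simp
qed

lemma pt_Suc: "polytime f \<Longrightarrow> polytime (\<lambda>x. Suc (f x))"
  by (rule pt_retype[OF pt_Pair[OF pt_const[of "()"]]]) auto

text \<open>Numbers are encoded in unary, so \<open>n\<close> and a list of \<open>n\<close> units
  are the same tree; arithmetic becomes list processing.\<close>

lemma pt_replicate: "polytime f \<Longrightarrow> polytime (\<lambda>x. replicate (f x) ())"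
proof (rule pt_retype)
  fix x
  have "encode n = encode (replicate n ())" for n by (induction n) auto
  then show "encode (f x) = encode (replicate (f x) ())" .
qed

lemma pt_length: assumes "polytime L" shows "polytime (\<lambda>e. length (L e))"
proof (rule pt_retype)
  show "polytime (\<lambda>e. map (\<lambda>_. ()) (L e))" by (intro pt_map assms pt_const)
  have "encode (map (\<lambda>_. ()) xs) = encode (length xs)" for xs :: "'b list" by (induction xs) auto
  then show "encode (map (\<lambda>_. ()) (L e)) = encode (length (L e))" for e .
qed

lemma pt_add: fixes f g :: "'e::enc \<Rightarrow> nat" assumes "polytime f" "polytime g" shows "polytime (\<lambda>e. f e + g e)"
proof -
  have "polytime (\<lambda>e. length (replicate (f e) () @ replicate (g e) ()))"
    by (intro pt_length pt_append pt_replicate assms)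
  then show ?thesis by simp
qed

lemma pt_mult: fixes f g :: "'e::enc \<Rightarrow> nat" assumes "polytime f" "polytime g" shows "polytime (\<lambda>e. f e * g e)"
proof -
  have "polytime (\<lambda>e. length (concat (map (\<lambda>_. replicate (f e) ()) (replicate (g e) ()))))"
    by (intro pt_length pt_concat pt_map pt_replicate assms pt_comp[OF pt_fst[OF pt_id] assms(1)])
  then show ?thesis by (simp add: length_concat sum_list_replicate mult.commute)
qed

lemma pt_power: fixes f :: "'e::enc \<Rightarrow> nat" assumes "polytime f" shows "polytime (\<lambda>e. f e ^ n)"
  by (induction n) (simp_all add: pt_const pt_mult assms)

lemma pt_tl: "polytime L \<Longrightarrow> polytime (\<lambda>e. tl (L e))"
proof (erule pt_comp, rule pt_expr[of "Right (Var 0)"])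
  show "eval (Right (Var 0)) s = encode (tl xs)" if "s 0 = encode xs" for s and xs :: "'b list"
    using that by (cases xs) auto
qed simp

lemma foldl_tl: "foldl (\<lambda>a _. tl a) xs ys = drop (length ys) xs"
  by (induction ys arbitrary: xs) (auto simp: drop_Suc)

lemma sz_drop: "sz (drop n xs) \<le> sz xs"
  using sz_le_append(2)[of "drop n xs" "take n xs"] by simp

lemma pt_drop: assumes "polytime f" "polytime L" shows "polytime (\<lambda>e. drop (f e) (L e))"
proof -
  have "polytime (\<lambda>e. foldl (\<lambda>a _. tl a) (L e) (replicate (f e) ()))"
    by (rule pt_foldl[where M = "\<lambda>e. sz (L e)"], intro pt_replicate assms, intro assms,
        intro pt_tl pt_fst pt_snd pt_id, intro polyb_sz_pt assms) (simp add: foldl_tl sz_drop)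
  then show ?thesis by (simp add: foldl_tl)
qed

lemma pt_le: assumes "polytime f" "polytime g" shows "polytime (\<lambda>e. f e \<le> (g e :: nat))"
proof -
  have "polytime (\<lambda>e. drop (g e) (replicate (f e) ()) = [])"
    by (intro pt_eq pt_drop pt_replicate assms pt_const)
  then show ?thesis by simp
qed

lemma pt_less: assumes "polytime f" "polytime g" shows "polytime (\<lambda>e. f e < (g e :: nat))"
  using pt_le[OF pt_Suc[OF assms(1)] assms(2)] by (simp add: Suc_le_eq)

lemma foldl_enumerate:
  "foldl (\<lambda>a x. a @ [(length a, x)]) as xs = as @ enumerate (length as) xs"
  by (induction xs arbitrary: as) auto

lemma pt_enumerate: assumes L: "polytime L" shows "polytime (\<lambda>e. enumerate 0 (L e))"
proof -
  have "polytime (\<lambda>e. foldl (\<lambda>a x. a @ [(length a, x)]) [] (L e))"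
  proof (rule pt_foldl[where M = "\<lambda>e. Suc (sz (L e) * Suc (3 * sz (L e) + 3))"])
    fix e ys zs assume ys: "L e = ys @ zs"
    have "sz p \<le> 3 * sz (L e) + 3" if p: "p \<in> set (enumerate 0 ys)" for p
    proof -
      have "fst p < length ys" "snd p \<in> set (L e)"
        using p ys nth_mem[of "fst p" ys] by (auto simp: in_set_enumerate_eq)
      moreover have "length ys \<le> sz (L e)" using length_le_sz[of "L e"] ys by simp
      ultimately show ?thesis using sz_elem[of "snd p" "L e"] by (cases p) (simp add: sz_nat)
    qed
    then have "sz (enumerate 0 ys) \<le> Suc (length (enumerate 0 ys) * Suc (3 * sz (L e) + 3))"
      by (rule sz_list_bound)
    then have "sz (enumerate 0 ys) \<le> Suc (length ys * Suc (3 * sz (L e) + 3))"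
      by (simp only: length_enumerate)
    also have "\<dots> \<le> Suc (sz (L e) * Suc (3 * sz (L e) + 3))"
      using length_le_sz[of "L e"] ys by (intro Suc_le_mono[THEN iffD2] mult_right_mono) auto
    finally show "sz (foldl (\<lambda>a x. a @ [(length a, x)]) [] ys) \<le> Suc (sz (L e) * Suc (3 * sz (L e) + 3))"
      by (simp add: foldl_enumerate)
  next
    show "poly_bounded (\<lambda>e. Suc (sz (L e) * Suc (3 * sz (L e) + 3)))"
      using polyb_sz_pt[OF L] by (intro polyb_Suc polyb_mult polyb_add) auto
  qed (intro L pt_intros pt_append pt_Cons pt_length pt_fst pt_snd)+
  then show ?thesis by (simp add: foldl_enumerate)
qed

lemma pt_upt: assumes "polytime f" shows "polytime (\<lambda>e. [0..<f e])"
proof -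
  have "polytime (\<lambda>e. map fst (enumerate 0 (replicate (f e) ())))"
    by (intro pt_map pt_fst pt_snd pt_id pt_enumerate pt_replicate assms)
  then show ?thesis by (simp add: map_fst_enumerate)
qed

text \<open>A total variant of \<open>!\<close>, which is unspecified beyond the end of the list and
  hence cannot be shown to be computed by a program.\<close>

definition lookup :: "'a \<Rightarrow> 'a list \<Rightarrow> nat \<Rightarrow> 'a" where
  "lookup d xs i = (case drop i xs of [] \<Rightarrow> d | x # _ \<Rightarrow> x)"

lemma lookup_nth [simp]: "i < length xs \<Longrightarrow> lookup d xs i = xs ! i"
  by (simp add: lookup_def Cons_nth_drop_Suc[symmetric])

lemma pt_lookup: assumes "polytime L" "polytime f" shows "polytime (\<lambda>e. lookup d (L e) (f e))"
  unfolding lookup_def by (intro pt_case_list pt_drop assms pt_const pt_fst pt_snd pt_id)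

text \<open>Together with \<open>args\<close> this replaces case distinctions on gates: both are
  read off the two halves of the encoding, so definitions by \<open>kind\<close> and
  \<open>args\<close> are composed of polynomial-time operations.\<close>

fun kind :: "gate \<Rightarrow> nat" where
  "kind Input = 0"
| "kind (Not _) = 1"
| "kind (And _) = 2"
| "kind (Or _) = 3"

lemma encode_nats: "encode (ns :: nat list) = enc_nats ns"
  unfolding encode_list_def enc_nats_def by (simp add: encode_nat_def cong: map_cong)

lemma pt_kind: "polytime f \<Longrightarrow> polytime (\<lambda>e. kind (f e))"
proof (erule pt_comp, rule pt_expr[of "Left (Var 0)"])
  show "eval (Left (Var 0)) s = encode (kind g)" if "s 0 = encode g" for s and g :: gate
    using that by (cases g) (auto simp: encode_gate_def encode_nat_def)
qed simp

lemma pt_args: "polytime f \<Longrightarrow> polytime (\<lambda>e. args (f e))"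
proof (erule pt_comp)
  have 1: "polytime (\<lambda>g :: gate. dright (encode g))"
    by (rule pt_expr[of "Right (Var 0)"]) (auto simp: encode_data_def)
  have 2: "polytime (\<lambda>g :: gate. Node (dright (encode g)) Leaf)"
    by (rule pt_expr[of "NodeE (Right (Var 0)) LeafE"]) (auto simp: encode_data_def)
  have "polytime (\<lambda>g. if kind g = 1 then Node (dright (encode g)) Leaf else dright (encode g))"
    by (intro pt_If pt_eq pt_kind pt_id pt_const 1 2)
  then show "polytime args"
  proof (rule pt_retype)
    show "encode (if kind g = 1 then Node (dright (encode g)) Leaf else dright (encode g)) = encode (args g)" for g
      by (cases g) (auto simp: encode_gate_def encode_data_def encode_nats enc_nats_def)
  qed
qed

section \<open>Unfolding circuits of bounded depth and weft\<close>

text \<open>The distributive law. On conjunctions of disjunctions it forms their disjunction, on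
  disjunctions of conjunctions their conjunction. It joins two operands only, so lengths are
  multiplied once.\<close>

definition cross :: "'a list list \<Rightarrow> 'a list list \<Rightarrow> 'a list list" where
  "cross xs ys = concat (map (\<lambda>x. map (\<lambda>y. x @ y) ys) xs)"

text \<open>
  \<open>s\<close> is the value claimed for gate \<open>j\<close>, and \<open>e\<close> bounds the remaining depth.  The formulas of level
  \<open>w\<close> are meant for gates with at most \<open>w\<close> large gates on each path from an input; a large gate passes
  to the level below.  In \<open>F3\<close>, \<open>G p a\<close> says that \<open>a\<close> is not the argument guessed to be true at the
  disjunction reached along the path \<open>p\<close>.
\<close>

primrec F0 :: "(bool \<Rightarrow> nat \<Rightarrow> 'l) \<Rightarrow> circuit \<Rightarrow> nat \<Rightarrow> bool \<Rightarrow> nat \<Rightarrow> 'l list list" where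
  "F0 L C 0 s j = [[L s j]]"
| "F0 L C (Suc e) s j =
    (if kind (lookup Input C j) = 0 then [[L s j]]
     else if kind (lookup Input C j) = 1 then concat (map (F0 L C e (\<not> s)) (args (lookup Input C j)))
     else if (kind (lookup Input C j) = 2) = s then concat (map (F0 L C e s) (args (lookup Input C j)))
     else (case args (lookup Input C j) of [] \<Rightarrow> [] | a # as \<Rightarrow> (case as of [] \<Rightarrow> [] | b # bs \<Rightarrow>
       cross (F0 L C e s a) (F0 L C e s b))))"

primrec F1 :: "(bool \<Rightarrow> nat \<Rightarrow> 'l) \<Rightarrow> circuit \<Rightarrow> nat \<Rightarrow> bool \<Rightarrow> nat \<Rightarrow> 'l list list list" where
  "F1 L C 0 s j = [[[L s j]]]"
| "F1 L C (Suc e) s j =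
    (if kind (lookup Input C j) = 0 then [[[L s j]]]
     else if kind (lookup Input C j) = 1 then concat (map (F1 L C e (\<not> s)) (args (lookup Input C j)))
     else if (kind (lookup Input C j) = 2) = s then
       (if 2 < length (args (lookup Input C j)) then [concat (map (F0 L C e s) (args (lookup Input C j)))]
        else (case args (lookup Input C j) of [] \<Rightarrow> [] | a # as \<Rightarrow> (case as of [] \<Rightarrow> [] | b # bs \<Rightarrow>
          cross (F1 L C e s a) (F1 L C e s b))))
     else if 2 < length (args (lookup Input C j)) then map (F0 L C e s) (args (lookup Input C j))
     else concat (map (F1 L C e s) (args (lookup Input C j))))"

primrec F2 :: "(bool \<Rightarrow> nat \<Rightarrow> 'l) \<Rightarrow> circuit \<Rightarrow> nat \<Rightarrow> bool \<Rightarrow> nat \<Rightarrow> 'l list list list list" where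
  "F2 L C 0 s j = [[[[L s j]]]]"
| "F2 L C (Suc e) s j =
    (if kind (lookup Input C j) = 0 then [[[[L s j]]]]
     else if kind (lookup Input C j) = 1 then concat (map (F2 L C e (\<not> s)) (args (lookup Input C j)))
     else if (kind (lookup Input C j) = 2) = s then
       (if 2 < length (args (lookup Input C j)) then map (F1 L C e s) (args (lookup Input C j))
        else concat (map (F2 L C e s) (args (lookup Input C j))))
     else if 2 < length (args (lookup Input C j)) then [concat (map (F1 L C e s) (args (lookup Input C j)))]
     else (case args (lookup Input C j) of [] \<Rightarrow> [] | a # as \<Rightarrow> (case as of [] \<Rightarrow> [] | b # bs \<Rightarrow>
       cross (F2 L C e s a) (F2 L C e s b))))"

primrec F3 :: "(bool list \<Rightarrow> nat \<Rightarrow> 'l) \<Rightarrow> (bool \<Rightarrow> nat \<Rightarrow> 'l) \<Rightarrow> circuit \<Rightarrow> nat \<Rightarrow> bool \<Rightarrow> bool list \<Rightarrow> nat \<Rightarrow>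
    'l list list list list" where
  "F3 G L C 0 s p j = [[[[L s j]]]]"
| "F3 G L C (Suc e) s p j =
    (if kind (lookup Input C j) = 0 then [[[[L s j]]]]
     else if kind (lookup Input C j) = 1 then concat (map (F3 G L C e (\<not> s) p) (args (lookup Input C j)))
     else if (kind (lookup Input C j) = 2) = s then
       (if 2 < length (args (lookup Input C j)) then concat (map (F2 L C e s) (args (lookup Input C j)))
        else (case args (lookup Input C j) of [] \<Rightarrow> [] | a # as \<Rightarrow> (case as of [] \<Rightarrow> [] | b # bs \<Rightarrow>
          F3 G L C e s (p @ [True]) a @ F3 G L C e s (p @ [False]) b)))
     else map (\<lambda>b. [[[G p b]]]) (filter (\<lambda>b. b \<notin> set (args (lookup Input C j))) [0..<length C]) @
       concat (map (\<lambda>a. map (\<lambda>D. [[G p a]] # D)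
         (if 2 < length (args (lookup Input C j)) then F2 L C e s a else F3 G L C e s (p @ [True]) a))
         (args (lookup Input C j))))"

section \<open>Truth of the unfolded formulas\<close>

definition ev0 :: "('l \<Rightarrow> bool) \<Rightarrow> 'l list list \<Rightarrow> bool" where
  "ev0 I A \<longleftrightarrow> (\<forall>c\<in>set A. \<exists>l\<in>set c. I l)"

definition ev1 :: "('l \<Rightarrow> bool) \<Rightarrow> 'l list list list \<Rightarrow> bool" where
  "ev1 I A \<longleftrightarrow> (\<exists>t\<in>set A. ev0 I t)"

definition ev2 :: "('l \<Rightarrow> bool) \<Rightarrow> 'l list list list list \<Rightarrow> bool" where
  "ev2 I A \<longleftrightarrow> (\<forall>D\<in>set A. ev1 I D)"

lemma ev0_simps: "ev0 I [[l]] \<longleftrightarrow> I l" "ev0 I (A @ B) \<longleftrightarrow> ev0 I A \<and> ev0 I B"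
  "ev0 I (concat As) \<longleftrightarrow> (\<forall>A\<in>set As. ev0 I A)"
  "ev0 I (cross A B) \<longleftrightarrow> ev0 I A \<or> ev0 I B"
  by (auto simp: ev0_def cross_def ball_Un bex_Un)

lemma ev1_simps: "ev1 I [t] \<longleftrightarrow> ev0 I t" "ev1 I (A @ B) \<longleftrightarrow> ev1 I A \<or> ev1 I B"
  "ev1 I (concat Bs) \<longleftrightarrow> (\<exists>A\<in>set Bs. ev1 I A)" "ev1 I (map f xs) \<longleftrightarrow> (\<exists>x\<in>set xs. ev0 I (f x))"
  "ev1 I (cross A' B') \<longleftrightarrow> ev1 I A' \<and> ev1 I B'"
  "ev1 I (t # B) \<longleftrightarrow> ev0 I t \<or> ev1 I B" "ev1 I [] \<longleftrightarrow> False"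
  by (auto simp: ev1_def ev0_simps cross_def bex_Un)

lemma ev2_simps: "ev2 I [D] \<longleftrightarrow> ev1 I D" "ev2 I (B @ B') \<longleftrightarrow> ev2 I B \<and> ev2 I B'"
  "ev2 I (concat Bs) \<longleftrightarrow> (\<forall>A\<in>set Bs. ev2 I A)" "ev2 I (map f xs) \<longleftrightarrow> (\<forall>x\<in>set xs. ev1 I (f x))"
  "ev2 I (cross B' B) \<longleftrightarrow> ev2 I B' \<or> ev2 I B"
  by (auto simp: ev2_def ev1_simps cross_def ball_Un)

section \<open>Depth and weft at a single gate\<close>

definition path_to :: "circuit \<Rightarrow> nat list \<Rightarrow> nat \<Rightarrow> bool" where
  "path_to C is j \<longleftrightarrow> is \<noteq> [] \<and> set is \<subseteq> {..<length C} \<and> hd is \<in> input_nodes C \<and> last is = j \<and>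
     successively (\<lambda>i j. i \<in> set (args (C ! j))) is"

definition bounded :: "circuit \<Rightarrow> nat \<Rightarrow> nat \<Rightarrow> nat \<Rightarrow> bool" where
  "bounded C w e j \<longleftrightarrow> (\<forall>is. path_to C is j \<longrightarrow>
     length is - 1 \<le> e \<and> length (filter (\<lambda>i. large (C ! i)) is) \<le> w)"

lemma bounded_output: "depth_at_most C d \<Longrightarrow> weft_at_most C t \<Longrightarrow> bounded C t d (output_node C)"
  by (auto simp: depth_at_most_def weft_at_most_def bounded_def path_to_def io_path_def)

lemma args_less: "circuit C \<Longrightarrow> j < length C \<Longrightarrow> i \<in> set (args (C ! j)) \<Longrightarrow> i < j"
  by (auto simp: circuit_def)

lemma path_to_snoc:
  "path_to C is i \<Longrightarrow> j < length C \<Longrightarrow> i \<in> set (args (C ! j)) \<Longrightarrow> path_to C (is @ [j]) j"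
  by (auto simp: path_to_def successively_append_iff)

lemma args_nonempty:
  assumes "circuit C" "j < length C" "C ! j \<noteq> Input" shows "args (C ! j) \<noteq> []"
proof -
  have "fan_in_ok (C ! j)" using assms by (auto simp: circuit_def)
  then show ?thesis using assms(3) by (cases "C ! j") auto
qed

text \<open>Gates other than inputs have arguments, at smaller positions, so descending ends at an
  input. Depth and weft speak only of paths from inputs and would not constrain a gate that no such
  path reaches.\<close>

lemma path_to_exists: "circuit C \<Longrightarrow> j < length C \<Longrightarrow> \<exists>is. path_to C is j"
proof (induction j rule: less_induct)
  case (less j)
  show ?case
  proof (cases "C ! j = Input")
    case True
    then show ?thesis using less.prems by (intro exI[of _ "[j]"]) (auto simp: path_to_def input_nodes_def)
  next
    case False
    then obtain i where i: "i \<in> set (args (C ! j))"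
      using args_nonempty[OF less.prems] by (cases "args (C ! j)") auto
    then have "i < j" using args_less less.prems by blast
    then show ?thesis using less i path_to_snoc by (meson order.strict_trans)
  qed
qed

text \<open>Appending \<open>j\<close> to a path that ends at its argument costs one unit of depth,
  and one of weft if \<open>j\<close> is large. The existence of such a path gives the lower bounds
  on \<open>e\<close> and \<open>w\<close>.\<close>

lemma bounded_arg:
  assumes "circuit C" "j < length C" "i \<in> set (args (C ! j))" "bounded C w e j"
  shows "\<exists>e'. e = Suc e' \<and> bounded C (if large (C ! j) then w - 1 else w) e' i"
    and "large (C ! j) \<Longrightarrow> 0 < w"
proof -
  have i: "i < length C" using args_less[OF assms(1-3)] assms(2) by simp
  have *: "length is \<le> e \<and> length (filter (\<lambda>i. large (C ! i)) is) + of_bool (large (C ! j)) \<le> w"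
    if "path_to C is i" for "is"
  proof -
    have "path_to C (is @ [j]) j" using path_to_snoc[OF that assms(2,3)] .
    then show ?thesis using assms(4) unfolding bounded_def by fastforce
  qed
  obtain js where js: "path_to C js i" using path_to_exists[OF assms(1) i] by blast
  then have "js \<noteq> []" by (simp add: path_to_def)
  then obtain e' where e': "e = Suc e'" using *[OF js] by (cases e) auto
  moreover have "bounded C (if large (C ! j) then w - 1 else w) e' i"
    unfolding bounded_def using * e' by fastforce
  ultimately show "\<exists>e'. e = Suc e' \<and> bounded C (if large (C ! j) then w - 1 else w) e' i" by blast
  show "0 < w" if "large (C ! j)" using *[OF js] that by simp
qed

lemma bounded_0_Input:
  assumes "circuit C" "j < length C" "bounded C w 0 j" shows "C ! j = Input"
proof (rule ccontr)
  assume "C ! j \<noteq> Input"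
  then obtain i where "i \<in> set (args (C ! j))"
    using args_nonempty[OF assms(1,2)] by (cases "args (C ! j)") auto
  from bounded_arg(1)[OF assms(1,2) this assms(3)] show False by simp
qed

locale valuation =
  fixes C :: circuit and S :: "nat set" and v :: "nat \<Rightarrow> bool"
  assumes C: "circuit C" and v: "consistent C S v"
begin

lemma value_Not: "j < length C \<Longrightarrow> C ! j = Not i \<Longrightarrow> v j \<longleftrightarrow> \<not> v i"
  and value_And: "j < length C \<Longrightarrow> C ! j = And is \<Longrightarrow> v j \<longleftrightarrow> (\<forall>i\<in>set is. v i)"
  and value_Or: "j < length C \<Longrightarrow> C ! j = Or is \<Longrightarrow> v j \<longleftrightarrow> (\<exists>i\<in>set is. v i)"
  using v by (auto simp: consistent_def)

text \<open>By De Morgan, an \<open>And\<close> claimed true and an \<open>Or\<close> claimed false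
  both act as conjunctions, which is what \<open>(kind (C ! j) = 2) = s\<close> tests; the two
  remaining combinations act as disjunctions.\<close>

lemma gate_cases [consumes 2, case_names Input Not conj disj]:
  assumes j: "j < length C" and bnd: "bounded C w (Suc e) j"
    and I: "kind (C ! j) = 0 \<Longrightarrow> C ! j = Input \<Longrightarrow> P"
    and N: "\<And>i. kind (C ! j) = 1 \<Longrightarrow> args (C ! j) = [i] \<Longrightarrow> i < length C \<Longrightarrow>
      bounded C w e i \<Longrightarrow> v j = s \<longleftrightarrow> v i = (\<not> s) \<Longrightarrow> P"
    and A: "\<And>is. (kind (C ! j) = 2) = s \<Longrightarrow> kind (C ! j) \<noteq> 0 \<Longrightarrow> kind (C ! j) \<noteq> 1 \<Longrightarrow> args (C ! j) = is \<Longrightarrow>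
      (\<And>i. i \<in> set is \<Longrightarrow> i < length C \<and> i < j \<and> bounded C (if 2 < length is then w - 1 else w) e i) \<Longrightarrow>
      (2 < length is \<Longrightarrow> 0 < w) \<Longrightarrow> 2 \<le> length is \<Longrightarrow> v j = s \<longleftrightarrow> (\<forall>i\<in>set is. v i = s) \<Longrightarrow> P"
    and O: "\<And>is. (kind (C ! j) = 2) \<noteq> s \<Longrightarrow> kind (C ! j) \<noteq> 0 \<Longrightarrow> kind (C ! j) \<noteq> 1 \<Longrightarrow> args (C ! j) = is \<Longrightarrow>
      (\<And>i. i \<in> set is \<Longrightarrow> i < length C \<and> i < j \<and> bounded C (if 2 < length is then w - 1 else w) e i) \<Longrightarrow>
      (2 < length is \<Longrightarrow> 0 < w) \<Longrightarrow> 2 \<le> length is \<Longrightarrow> v j = s \<longleftrightarrow> (\<exists>i\<in>set is. v i = s) \<Longrightarrow> P"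
  shows P
proof -
  have b: "i < length C \<and> i < j \<and> bounded C (if 2 < length (args (C ! j)) then w - 1 else w) e i"
    and w: "2 < length (args (C ! j)) \<Longrightarrow> 0 < w" if "i \<in> set (args (C ! j))" for i
    using bounded_arg[OF C j that bnd] args_less[OF C j that] j by (auto simp: large_def)
  have f: "fan_in_ok (C ! j)" using C j by (auto simp: circuit_def)
  show P
  proof (cases "C ! j")
    case Input
    then show P using I by simp
  next
    case (Not i)
    show P by (rule N[of i]) (use Not b[of i] value_Not[OF j Not] in auto)
  next
    case (And "is")
    have "is \<noteq> []" using f And by auto
    then have w: "2 < length is \<Longrightarrow> 0 < w" using w And by (cases "is") auto
    show P
    proof (cases s)
      case True
      then show P by (intro A[of "is"]) (use And b f w value_And[OF j And] in auto)
    next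
      case False
      then show P by (intro O[of "is"]) (use And b f w value_And[OF j And] in auto)
    qed
  next
    case (Or "is")
    have "is \<noteq> []" using f Or by auto
    then have w: "2 < length is \<Longrightarrow> 0 < w" using w Or by (cases "is") auto
    show P
    proof (cases s)
      case True
      then show P by (intro O[of "is"]) (use Or b f w value_Or[OF j Or] in auto)
    next
      case False
      then show P by (intro A[of "is"]) (use Or b f w value_Or[OF j Or] in auto)
    qed
  qed
qed

lemma length_2:
  assumes "2 \<le> length xs" "\<not> 2 < length xs" shows "\<exists>a b. xs = [a, b]"
proof -
  have "length xs = Suc (Suc 0)" using assms by simp
  then show ?thesis by (auto simp: length_Suc_conv)
qed

context
  fixes I :: "'l \<Rightarrow> bool" and L :: "bool \<Rightarrow> nat \<Rightarrow> 'l"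
  assumes L: "\<And>s j. j < length C \<Longrightarrow> C ! j = Input \<Longrightarrow> I (L s j) \<longleftrightarrow> v j = s"
begin

text \<open>At weft 0 a disjunction has exactly two arguments, so the two that \<open>F0\<close>
  inspects are all of them.\<close>

lemma F0_correct: "j < length C \<Longrightarrow> bounded C 0 e j \<Longrightarrow> ev0 I (F0 L C e s j) \<longleftrightarrow> v j = s"
proof (induction e arbitrary: s j)
  case 0
  then show ?case using bounded_0_Input[OF C] L by (auto simp: ev0_simps)
next
  case (Suc e)
  note j = Suc.prems(1)
  from Suc.prems show ?case
  proof (cases rule: gate_cases[where s = s])
    case Input
    then show ?thesis using j L by (simp add: ev0_simps)
  next
    case (Not i)
    then show ?thesis using j Suc.IH by (simp add: ev0_simps)
  next
    case (conj "is")
    then have "i < length C \<and> bounded C 0 e i" if "i \<in> set is" for i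
      using conj(5)[OF that] by (auto split: if_splits)
    with conj show ?thesis using j Suc.IH by (simp add: ev0_simps)
  next
    case (disj "is")
    then obtain a b where "is = [a, b]" using length_2 by blast
    then show ?thesis using disj j Suc.IH by (simp add: ev0_simps)
  qed
qed

lemma F1_correct: "j < length C \<Longrightarrow> bounded C 1 e j \<Longrightarrow> ev1 I (F1 L C e s j) \<longleftrightarrow> v j = s"
proof (induction e arbitrary: s j)
  case 0
  then show ?case using bounded_0_Input[OF C] L by (auto simp: ev0_simps ev1_simps)
next
  case (Suc e)
  note j = Suc.prems(1)
  from Suc.prems show ?case
  proof (cases rule: gate_cases[where s = s])
    case Input
    then show ?thesis using j L by (simp add: ev0_simps ev1_simps)
  next
    case (Not i)
    then show ?thesis using j Suc.IH by (simp add: ev1_simps)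
  next
    case (conj "is")
    show ?thesis
    proof (cases "2 < length is")
      case True
      then show ?thesis using conj j F0_correct by (simp add: ev0_simps ev1_simps)
    next
      case False
      then obtain a b where "is = [a, b]" using length_2 conj by blast
      then show ?thesis using conj j Suc.IH by (simp add: ev1_simps)
    qed
  next
    case (disj "is")
    then show ?thesis using j Suc.IH F0_correct by (cases "2 < length is") (simp_all add: ev1_simps)
  qed
qed

lemma F2_correct: "j < length C \<Longrightarrow> bounded C 2 e j \<Longrightarrow> ev2 I (F2 L C e s j) \<longleftrightarrow> v j = s"
proof (induction e arbitrary: s j)
  case 0
  then show ?case using bounded_0_Input[OF C] L by (auto simp: ev0_simps ev1_simps ev2_simps)
next
  case (Suc e)
  note j = Suc.prems(1)
  from Suc.prems show ?case
  proof (cases rule: gate_cases[where s = s])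
    case Input
    then show ?thesis using j L by (simp add: ev0_simps ev1_simps ev2_simps)
  next
    case (Not i)
    then show ?thesis using j Suc.IH by (simp add: ev2_simps)
  next
    case (conj "is")
    then show ?thesis using j Suc.IH F1_correct by (cases "2 < length is") (simp_all add: ev2_simps)
  next
    case (disj "is")
    show ?thesis
    proof (cases "2 < length is")
      case True
      then show ?thesis using disj j F1_correct by (simp add: ev1_simps ev2_simps)
    next
      case False
      then obtain a b where "is = [a, b]" using length_2 disj by blast
      then show ?thesis using disj j Suc.IH by (simp add: ev2_simps)
    qed
  qed
qed

text \<open>A disjunct added to every member makes the whole conjunction conditional. In this way
  \<open>F3\<close> switches off the arguments that are not guessed.\<close>

lemma ev2_guard:
  "ev2 I (map (\<lambda>D. t # D) B) \<longleftrightarrow> ev0 I t \<or> ev2 I B"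
  by (auto simp: ev2_def ev1_simps)

text \<open>Sound for every guess in range: the conjuncts for positions that are no arguments force
  \<open>\<gamma> p\<close> to be an argument, whose guard then fails, so that its formula is in
  force. Each extension of \<open>p\<close> uses up depth, so \<open>length p + e \<le> M\<close>
  keeps all labels in the range where \<open>G\<close> is specified.\<close>

lemma F3_sound:
  assumes G: "\<And>p a. p \<noteq> [] \<Longrightarrow> length p < M \<Longrightarrow> a < length C \<Longrightarrow> I (G p a) \<longleftrightarrow> \<gamma> p \<noteq> a"
    and \<gamma>: "\<And>p. p \<noteq> [] \<Longrightarrow> length p < M \<Longrightarrow> \<gamma> p < length C"
  shows "j < length C \<Longrightarrow> bounded C 3 e j \<Longrightarrow> p \<noteq> [] \<Longrightarrow> length p + e \<le> M \<Longrightarrow>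
    ev2 I (F3 G L C e s p j) \<Longrightarrow> v j = s"
proof (induction e arbitrary: s j p)
  case 0
  then show ?case using bounded_0_Input[OF C] L by (auto simp: ev0_simps ev1_simps ev2_simps)
next
  case (Suc e)
  note j = Suc.prems(1)
  have p: "p \<noteq> []" "length p < M" using Suc.prems by auto
  have ih: "ev2 I (F3 G L C e s (p @ [b]) i) \<Longrightarrow> v i = s" if "i < length C" "bounded C 3 e i" for i b
    using Suc.IH[OF that, of "p @ [b]"] Suc.prems by simp
  from Suc.prems(1,2) show ?case
  proof (cases rule: gate_cases[where s = s])
    case Input
    then show ?thesis using j L Suc.prems(5) by (simp add: ev0_simps ev1_simps ev2_simps)
  next
    case (Not i)
    then show ?thesis using Suc.IH[of i p "\<not> s"] Suc.prems by (simp add: ev2_simps)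
  next
    case (conj "is")
    show ?thesis
    proof (cases "2 < length is")
      case True
      then show ?thesis using conj j F2_correct Suc.prems(5) by (simp add: ev2_simps)
    next
      case False
      then obtain a b where "is = [a, b]" using length_2 conj by blast
      then show ?thesis using conj j ih[of a True] ih[of b False] Suc.prems(5) by (simp add: ev2_simps)
    qed
  next
    case (disj "is")
    have *: "\<And>b. b < length C \<Longrightarrow> b \<notin> set is \<Longrightarrow> \<gamma> p \<noteq> b"
      using Suc.prems(5) disj j G[OF p] by (simp add: ev0_simps ev1_simps ev2_simps)
    then have a: "\<gamma> p \<in> set is" using \<gamma>[OF p] by blast
    have "ev2 I (if 2 < length is then F2 L C e s (\<gamma> p) else F3 G L C e s (p @ [True]) (\<gamma> p))"
      using Suc.prems(5) disj j G[OF p \<gamma>[OF p]] a by (auto simp: ev0_simps ev2_simps(2,3) ev2_guard)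
    then have "v (\<gamma> p) = s"
      using disj(5)[OF a] F2_correct ih[of "\<gamma> p" True] by (cases "2 < length is") auto
    then show ?thesis using disj a by blast
  qed
qed

end

text \<open>Unlike soundness this holds for a suitable guess only, so \<open>I\<close> depends on
  \<open>\<gamma>\<close>. Admitting every \<open>\<gamma>'\<close> that agrees with
  \<open>\<gamma>\<close> on the extensions of \<open>p\<close> allows guesses found for different
  subformulas to be combined.\<close>

lemma F3_complete:
  fixes I :: "(bool list \<Rightarrow> nat) \<Rightarrow> 'l \<Rightarrow> bool"
  assumes L: "\<And>\<gamma> s j. j < length C \<Longrightarrow> C ! j = Input \<Longrightarrow> I \<gamma> (L s j) \<longleftrightarrow> v j = s"
    and G: "\<And>\<gamma> p a. p \<noteq> [] \<Longrightarrow> length p < M \<Longrightarrow> a < length C \<Longrightarrow> I \<gamma> (G p a) \<longleftrightarrow> \<gamma> p \<noteq> a"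
  shows "j < length C \<Longrightarrow> bounded C 3 e j \<Longrightarrow> p \<noteq> [] \<Longrightarrow> length p + e \<le> M \<Longrightarrow> v j = s \<Longrightarrow>
    \<exists>\<gamma>. (\<forall>p'. \<gamma> p' < length C) \<and>
      (\<forall>\<gamma>'. (\<forall>q. \<gamma>' (p @ q) = \<gamma> (p @ q)) \<longrightarrow> ev2 (I \<gamma>') (F3 G L C e s p j))"
proof (induction e arbitrary: s j p)
  case 0
  then show ?case using bounded_0_Input[OF C] L
    by (intro exI[of _ "\<lambda>_. j"]) (auto simp: ev0_simps ev1_simps ev2_simps)
next
  case (Suc e)
  note j = Suc.prems(1)
  have p: "p \<noteq> []" "length p < M" using Suc.prems by auto
  have ih: "\<exists>\<gamma>. (\<forall>p'. \<gamma> p' < length C) \<and>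
      (\<forall>\<gamma>'. (\<forall>q. \<gamma>' (p @ b # q) = \<gamma> (p @ b # q)) \<longrightarrow> ev2 (I \<gamma>') (F3 G L C e s (p @ [b]) i))"
    if "i < length C" "bounded C 3 e i" "v i = s" for i b
    using Suc.IH[of i "p @ [b]" s] that Suc.prems by simp
  from Suc.prems(1,2) show ?case
  proof (cases rule: gate_cases[where s = s])
    case Input
    then show ?thesis using j L Suc.prems(5)
      by (intro exI[of _ "\<lambda>_. j"]) (auto simp: ev0_simps ev1_simps ev2_simps)
  next
    case (Not i)
    then show ?thesis using Suc.IH[of i p "\<not> s"] Suc.prems by (simp add: ev2_simps)
  next
    case (conj "is")
    show ?thesis
    proof (cases "2 < length is")
      case True
      have "v i = s" if "i \<in> set is" for i using conj that Suc.prems(5) by simp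
      then have "ev2 (I \<gamma>) (F2 L C e s i)" if "i \<in> set is" for i \<gamma>
        using conj(5)[OF that] True F2_correct[of "I \<gamma>" L i e s] L that by simp
      then show ?thesis using conj j True
        by (intro exI[of _ "\<lambda>_. j"]) (auto simp: ev2_simps(2,3))
    next
      case False
      then obtain a b where ab: "is = [a, b]" using length_2 conj by blast
      have v: "v a = s" "v b = s" using conj ab Suc.prems(5) by auto
      have cb: "a < length C" "b < length C" "bounded C 3 e a" "bounded C 3 e b"
        using conj(5)[of a] conj(5)[of b] ab by auto
      obtain \<gamma>1 where 1: "\<And>p'. \<gamma>1 p' < length C"
        "\<And>\<gamma>'. (\<forall>q. \<gamma>' (p @ True # q) = \<gamma>1 (p @ True # q)) \<Longrightarrow> ev2 (I \<gamma>') (F3 G L C e s (p @ [True]) a)"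
        using ih[OF cb(1,3) v(1), of True] by blast
      obtain \<gamma>2 where 2: "\<And>p'. \<gamma>2 p' < length C"
        "\<And>\<gamma>'. (\<forall>q. \<gamma>' (p @ False # q) = \<gamma>2 (p @ False # q)) \<Longrightarrow> ev2 (I \<gamma>') (F3 G L C e s (p @ [False]) b)"
        using ih[OF cb(2,4) v(2), of False] by blast
      \<comment> \<open>The arguments of a small conjunction use labels below
        \<open>p @ [True]\<close> and \<open>p @ [False]\<close>, which are disjoint, so the two
        guesses can be merged.\<close>
      define \<gamma> where "\<gamma> l = (if \<exists>q. l = p @ True # q then \<gamma>1 l else \<gamma>2 l)" for l
      show ?thesis
      proof (intro exI[of _ \<gamma>] conjI allI impI)
        show "\<gamma> p' < length C" for p' using 1 2 by (simp add: \<gamma>_def)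
        fix \<gamma>' assume \<gamma>': "\<forall>q. \<gamma>' (p @ q) = \<gamma> (p @ q)"
        have "ev2 (I \<gamma>') (F3 G L C e s (p @ [True]) a)" by (rule 1(2)) (simp add: \<gamma>' \<gamma>_def)
        moreover have "ev2 (I \<gamma>') (F3 G L C e s (p @ [False]) b)" by (rule 2(2)) (simp add: \<gamma>' \<gamma>_def)
        ultimately show "ev2 (I \<gamma>') (F3 G L C (Suc e) s p j)"
          using conj j ab by (simp add: ev2_simps(2))
      qed
    qed
  next
    case (disj "is")
    then obtain a where a: "a \<in> set is" "v a = s" using Suc.prems(5) by blast
    have ca: "a < length C" "bounded C (if 2 < length is then 2 else 3) e a" using disj(5)[OF a(1)] by auto
    obtain \<gamma>0 where 0: "\<And>p'. \<gamma>0 p' < length C"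
      "\<And>\<gamma>'. (\<forall>q. \<gamma>' (p @ True # q) = \<gamma>0 (p @ True # q)) \<Longrightarrow>
        ev2 (I \<gamma>') (if 2 < length is then F2 L C e s a else F3 G L C e s (p @ [True]) a)"
    proof (cases "2 < length is")
      case True
      have "ev2 (I \<gamma>) (F2 L C e s a)" for \<gamma>
        using F2_correct[of "I \<gamma>" L a e s] L a ca True by simp
      then show ?thesis using that[of "\<lambda>_. a"] ca True by simp
    next
      case False
      then show ?thesis using ih[OF ca(1) _ a(2), of True] that ca by auto
    qed
    \<comment> \<open>The label \<open>p\<close> does not extend \<open>p @ [True]\<close>, so the
      update leaves \<open>\<gamma>0\<close> intact where the subformula of \<open>a\<close> reads
      it.\<close>
    show ?thesis
    proof (intro exI[of _ "\<gamma>0(p := a)"] conjI allI impI)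
      show "(\<gamma>0(p := a)) p' < length C" for p' using 0 ca by simp
      fix \<gamma>' assume \<gamma>': "\<forall>q. \<gamma>' (p @ q) = (\<gamma>0(p := a)) (p @ q)"
      have pa: "\<gamma>' p = a" using \<gamma>'[rule_format, of "[]"] by simp
      have "ev2 (I \<gamma>') (if 2 < length is then F2 L C e s a else F3 G L C e s (p @ [True]) a)"
        by (rule 0(2)) (simp add: \<gamma>')
      \<comment> \<open>For \<open>i = a\<close> the subformula holds, for
        \<open>i \<noteq> a\<close> the guard does; this is why all arguments may share the label
        \<open>p @ [True]\<close>.\<close>
      then have "ev2 (I \<gamma>') (map (\<lambda>D. [[G p i]] # D)
         (if 2 < length is then F2 L C e s i else F3 G L C e s (p @ [True]) i))" if "i \<in> set is" for i
        using G[OF p, of i \<gamma>'] disj(5)[OF that] pa by (cases "i = a") (auto simp: ev2_def ev1_simps ev0_simps)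
      moreover have "ev2 (I \<gamma>') (map (\<lambda>b. [[[G p b]]]) (filter (\<lambda>b. b \<notin> set is) [0..<length C]))"
        using G[OF p, of _ \<gamma>'] pa a by (auto simp: ev2_simps ev1_simps ev0_simps)
      ultimately show "ev2 (I \<gamma>') (F3 G L C (Suc e) s p j)"
        using disj j by (auto simp: ev2_simps(2,3))
    qed
  qed
qed

end

text \<open>\<open>cross\<close> at a small disjunction adds the lengths of two clauses, so each
  level at most doubles them; this is the origin of \<open>2 ^ d\<close>. In \<open>F1\<close> and
  \<open>F2\<close> it joins lists of clauses, or lists of these, and leaves the clauses as they
  are.\<close>

lemma length_F0: "c \<in> set (F0 L C e s j) \<Longrightarrow> length c \<le> 2 ^ e"
proof (induction e arbitrary: s j c)
  case (Suc e)
  have le: "(2::nat) ^ e \<le> 2 ^ Suc e" by simp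
  show ?case using Suc.prems
    by (auto simp: cross_def split: if_splits list.splits dest!: Suc.IH intro: order_trans[OF _ le] add_mono)
qed auto

lemma length_F1: "t \<in> set (F1 L C e s j) \<Longrightarrow> c \<in> set t \<Longrightarrow> length c \<le> 2 ^ e"
proof (induction e arbitrary: s j t c)
  case (Suc e)
  have le: "n \<le> 2 ^ e \<Longrightarrow> n \<le> 2 ^ Suc e" for n :: nat by simp
  show ?case using Suc.prems
    by (auto simp: cross_def simp del: power_Suc split: if_splits list.splits
        intro!: le intro: Suc.IH length_F0)
qed auto

lemma length_F2: "D \<in> set (F2 L C e s j) \<Longrightarrow> t \<in> set D \<Longrightarrow> c \<in> set t \<Longrightarrow> length c \<le> 2 ^ e"
proof (induction e arbitrary: s j D t c)
  case (Suc e)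
  have le: "n \<le> 2 ^ e \<Longrightarrow> n \<le> 2 ^ Suc e" for n :: nat by simp
  show ?case using Suc.prems
    by (auto simp: cross_def simp del: power_Suc split: if_splits list.splits
        intro!: le intro: Suc.IH length_F1)
qed auto

lemma length_F3: "D \<in> set (F3 G L C e s p j) \<Longrightarrow> t \<in> set D \<Longrightarrow> c \<in> set t \<Longrightarrow> length c \<le> 2 ^ e"
proof (induction e arbitrary: s p j D t c)
  case (Suc e)
  have le: "n \<le> 2 ^ e \<Longrightarrow> n \<le> 2 ^ Suc e" for n :: nat by simp
  show ?case using Suc.prems
    by (auto simp: cross_def simp del: power_Suc split: if_splits list.splits
        intro!: le intro: Suc.IH length_F2)
qed auto

section \<open>Extending to minimal Roman hitting functions\<close>

text \<open>The singleton edge at \<open>v\<close> demands value 1 or 2 at \<open>v\<close>. No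
  vertex corresponds to an edge of \<open>Es\<close>, so these can be served by value 2 only, and
  the problem becomes one of ordinary hitting sets.\<close>

lemma rhf_own_edges:
  assumes Es: "\<forall>E\<in>set Es. set E \<subseteq> {..<N}"
  shows "rhf (vertices [0..<N]) (indices (map (\<lambda>v. [v]) [0..<N] @ Es)) (edge (map (\<lambda>v. [v]) [0..<N] @ Es))
      ((!) [0..<N]) g \<longleftrightarrow>
    (\<forall>x<N. g x = 1 \<or> g x = 2) \<and> (\<forall>E\<in>set Es. \<exists>x\<in>set E. g x = 2)" (is "rhf ?X ?I ?s ?t g \<longleftrightarrow> ?R")
proof -
  have own: "?s i = {i}" if "i < N" for i using that by (simp add: edge_def nth_append)
  have oth: "?s (N + i) = set (Es ! i)" for i by (simp add: edge_def nth_append)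
  have I: "?I = {..<N} \<union> ((+) N) ` {..<length Es}"
  proof -
    have "i \<in> (+) N ` {..<length Es}" if "i < N + length Es" "\<not> i < N" for i
      by (rule image_eqI[of _ _ "i - N"]) (use that in auto)
    then show ?thesis by (auto simp: indices_def)
  qed
  have 1: "(\<exists>x\<in>?s i. g x = 2) \<or> (\<exists>x\<in>?X. ?t x = i \<and> g x = 1) \<longleftrightarrow> g i = 1 \<or> g i = 2" if "i < N" for i
    using that own[OF that] by (auto simp: vertices_def)
  have 2: "(\<exists>x\<in>?s (N + i). g x = 2) \<or> (\<exists>x\<in>?X. ?t x = N + i \<and> g x = 1) \<longleftrightarrow> (\<exists>x\<in>set (Es ! i). g x = 2)" for i
    by (auto simp: vertices_def oth)
  have "rhf ?X ?I ?s ?t g \<longleftrightarrow> (\<forall>x<N. g x \<in> {0, 1, 2}) \<and> (\<forall>x<N. g x = 1 \<or> g x = 2) \<and>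
      (\<forall>i<length Es. \<exists>x\<in>set (Es ! i). g x = 2)"
    unfolding rhf_def I ball_Un ball_simps(9) 2 using 1 by (auto simp: vertices_def Pi_iff)
  also have "\<dots> \<longleftrightarrow> ?R" by (auto simp: all_set_conv_all_nth)
  finally show ?thesis .
qed

text \<open>The private-edge criterion for extending \<open>P\<close> to a minimal hitting set:
  \<open>c v\<close> is an edge with \<open>v\<close> as its only vertex of value 2, which keeps
  \<open>v\<close> from being lowered. The other vertices of \<open>c v\<close> then have value 1,
  and every edge must still be hit.\<close>

lemma extends_own_edges:
  assumes Es: "\<forall>E\<in>set Es. set E \<subseteq> {..<N}" and P: "P \<subseteq> {..<N}"
    and f: "\<And>x. x < N \<Longrightarrow> f x = (if x \<in> P then 2 else 0)"
  shows "extends_to_minimal_rhf (vertices [0..<N]) (indices (map (\<lambda>v. [v]) [0..<N] @ Es))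
      (edge (map (\<lambda>v. [v]) [0..<N] @ Es)) ((!) [0..<N]) f \<longleftrightarrow>
    (\<exists>c. (\<forall>v\<in>P. c v \<in> set Es \<and> set (c v) \<inter> P = {v}) \<and>
      (\<forall>E\<in>set Es. \<exists>u\<in>set E. u \<in> P \<or> (\<forall>v\<in>P. u \<notin> set (c v))))" (is "?L \<longleftrightarrow> ?R")
proof
  note rhf = rhf_own_edges[OF Es]
  have X: "vertices [0..<N] = {..<N}" by (simp add: vertices_def)
  assume ?L
  then obtain g where min_g: "minimal_rhf (vertices [0..<N]) (indices (map (\<lambda>v. [v]) [0..<N] @ Es))
      (edge (map (\<lambda>v. [v]) [0..<N] @ Es)) ((!) [0..<N]) g" and fg: "\<And>x. x < N \<Longrightarrow> f x \<le> g x"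
    unfolding extends_to_minimal_rhf_def X by blast
  have g: "\<forall>x<N. g x = 1 \<or> g x = 2" "\<forall>E\<in>set Es. \<exists>x\<in>set E. g x = 2"
    using min_g unfolding minimal_rhf_def rhf by blast+
  have min: "\<forall>x<N. h x = g x"
    if "\<forall>x<N. h x = 1 \<or> h x = 2" "\<forall>E\<in>set Es. \<exists>x\<in>set E. h x = 2" "\<forall>x<N. h x \<le> g x" for h
    using min_g that unfolding minimal_rhf_def rhf unfolding X by blast
  have g2: "g v = 2" if "v \<in> P" for v
    using fg[of v] f[of v] g(1) that P by force
  have "\<exists>E\<in>set Es. {x \<in> set E. g x = 2} = {v}" if v: "v \<in> P" for v
  proof (rule ccontr)
    assume no: "\<not> ?thesis"
    have vN: "v < N" using v P by auto
    \<comment> \<open>Without a private edge, lowering \<open>v\<close> to 1 leaves every edge hit,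
      against minimality.\<close>
    have "\<forall>x<N. (g(v := 1)) x = g x"
    proof (rule min)
      show "\<forall>E\<in>set Es. \<exists>x\<in>set E. (g(v := 1)) x = 2"
      proof
        fix E assume E: "E \<in> set Es"
        then obtain x where x: "x \<in> set E" "g x = 2" using g by blast
        from no E have "{x \<in> set E. g x = 2} \<noteq> {v}" by blast
        then obtain y where "y \<in> set E" "g y = 2" "y \<noteq> v" using x by blast
        then show "\<exists>x\<in>set E. (g(v := 1)) x = 2" by auto
      qed
    qed (use g g2[OF v] in auto)
    then show False using g2[OF v] vN by auto
  qed
  then obtain c where c: "\<And>v. v \<in> P \<Longrightarrow> c v \<in> set Es \<and> {x \<in> set (c v). g x = 2} = {v}" by metis
  show ?R
  proof (intro exI[of _ c] conjI ballI)
    show "c v \<in> set Es" if "v \<in> P" for v using c that by blast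
    show "set (c v) \<inter> P = {v}" if "v \<in> P" for v using c[OF that] g2 that by blast
    fix E assume "E \<in> set Es"
    then obtain u where u: "u \<in> set E" "g u = 2" using g by blast
    have "u \<in> P" if "v \<in> P" "u \<in> set (c v)" for v
    proof -
      have "u \<in> {x \<in> set (c v). g x = 2}" using that u by simp
      then show ?thesis using c[OF that(1)] that(1) by simp
    qed
    then show "\<exists>u\<in>set E. u \<in> P \<or> (\<forall>v\<in>P. u \<notin> set (c v))" using u by blast
  qed
next
  note rhf = rhf_own_edges[OF Es]
  have X: "vertices [0..<N] = {..<N}" by (simp add: vertices_def)
  assume ?R
  then obtain c where "(\<forall>v\<in>P. c v \<in> set Es \<and> set (c v) \<inter> P = {v}) \<and>
      (\<forall>E\<in>set Es. \<exists>u\<in>set E. u \<in> P \<or> (\<forall>v\<in>P. u \<notin> set (c v)))" ..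
  then have c: "\<And>v. v \<in> P \<Longrightarrow> c v \<in> set Es" "\<And>v. v \<in> P \<Longrightarrow> set (c v) \<inter> P = {v}"
    and hit: "\<And>E. E \<in> set Es \<Longrightarrow> \<exists>u\<in>set E. u \<in> P \<or> (\<forall>v\<in>P. u \<notin> set (c v))" by simp_all
  \<comment> \<open>The largest candidate: value 2 wherever no private edge forbids it.\<close>
  define g0 :: "nat \<Rightarrow> nat" where "g0 u = (if u \<in> P \<or> (\<forall>v\<in>P. u \<notin> set (c v)) then 2 else 1)" for u
  define Q where "Q h \<longleftrightarrow> (\<forall>x<N. h x = 1 \<or> h x = 2) \<and> (\<forall>E\<in>set Es. \<exists>x\<in>set E. h x = 2) \<and> (\<forall>x<N. h x \<le> g0 x)"
    for h :: "nat \<Rightarrow> nat"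
  have "\<exists>x\<in>set E. g0 x = 2" if "E \<in> set Es" for E
    using hit[OF that] by (auto simp: g0_def)
  then have "Q g0" by (auto simp: Q_def g0_def)
  \<comment> \<open>Least weight below \<open>g0\<close> yields minimality. The vertices of
    \<open>P\<close> keep value 2, because on \<open>c v\<close> only \<open>v\<close> has value 2
    under \<open>g0\<close>.\<close>
  then obtain h where h: "Q h" and least: "\<And>h'. Q h' \<Longrightarrow> (\<Sum>x<N. h x) \<le> (\<Sum>x<N. h' x)"
    using ex_has_least_nat[of Q g0 "\<lambda>h. \<Sum>x<N. h x"] by blast
  have h2: "h v = 2" if v: "v \<in> P" for v
  proof -
    obtain u where u: "u \<in> set (c v)" "h u = 2" using h c(1)[OF v] by (auto simp: Q_def)
    then have "u < N" using Es c(1)[OF v] by blast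
    then have "h u \<le> g0 u" using h by (simp add: Q_def)
    then have "u \<in> P" using u that by (auto simp: g0_def split: if_splits)
    then show ?thesis using u c(2)[OF that] by auto
  qed
  show ?L
    unfolding extends_to_minimal_rhf_def minimal_rhf_def rhf unfolding X
  proof (intro exI[of _ h] conjI allI impI ballI)
    fix h' x assume h': "((\<forall>x<N. h' x = 1 \<or> h' x = 2) \<and> (\<forall>E\<in>set Es. \<exists>x\<in>set E. h' x = 2)) \<and> (\<forall>x\<in>{..<N}. h' x \<le> h x)"
      and x: "x \<in> {..<N}"
    have "Q h'" unfolding Q_def
    proof (intro conjI allI impI)
      show "h' y \<le> g0 y" if "y < N" for y
        using h' h that unfolding Q_def by (meson lessThan_iff order_trans)
    qed (use h' in auto)
    then have "(\<Sum>x<N. h' x) = (\<Sum>x<N. h x)"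
      using h' by (intro antisym[OF sum_mono least[OF \<open>Q h'\<close>]]) auto
    then show "h' x = h x" using h' x by (intro sum_mono_inv[of h' "{..<N}" h]) auto
  qed (use h h2 f in \<open>auto simp: Q_def\<close>)
qed

section \<open>Choosing one item per slot\<close>

text \<open>
  An atom is a pair of a slot and a value.  A literal is represented by the list of all atoms that
  falsify it; hence a clause is falsified by a tuple \<open>w\<close> of atoms iff \<open>w\<close> meets each of its literals.
\<close>

definition kills :: "'a list \<Rightarrow> 'a list list \<Rightarrow> bool" where
  "kills w c \<longleftrightarrow> (\<forall>l\<in>set c. \<exists>\<alpha>\<in>set w. \<alpha> \<in> set l)"

text \<open>The quantifiers are those of an extension instance: each \<open>D\<close> is an edge,
  some vertex \<open>t\<close> on it keeps value 2, and none of the chosen edges contains this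
  vertex.\<close>

definition avoids :: "('s list \<Rightarrow> ('s \<times> 'v) list) \<Rightarrow> 's list list \<Rightarrow> ('s \<times> 'v) list list list list list \<Rightarrow> bool" where
  "avoids \<chi> Rs \<Phi> \<longleftrightarrow> (\<forall>D\<in>set \<Phi>. \<exists>t\<in>set D. \<forall>c\<in>set t. \<forall>R\<in>set Rs. \<not> kills (\<chi> R) c)"

definition picks :: "('s \<Rightarrow> 's \<times> 'v) \<Rightarrow> 's list \<Rightarrow> ('s \<times> 'v) list \<Rightarrow> bool" where
  "picks \<sigma> slots atoms \<longleftrightarrow> (\<forall>r\<in>set slots. \<sigma> r \<in> set atoms \<and> fst (\<sigma> r) = r)"

definition holds :: "('s \<Rightarrow> 's \<times> 'v) \<Rightarrow> 's list \<Rightarrow> ('s \<times> 'v) list \<Rightarrow> bool" where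
  "holds \<sigma> slots l \<longleftrightarrow> (\<forall>r\<in>set slots. \<sigma> r \<notin> set l)"

text \<open>Each disjunct is one clause with one literal that has one falsifying atom, so it says
  that no tuple contains this atom.\<close>

definition conflict_clauses :: "('a \<Rightarrow> 'a \<Rightarrow> bool) \<Rightarrow> 'a list \<Rightarrow> 'a list list list list list" where
  "conflict_clauses cf atoms =
    concat (map (\<lambda>\<alpha>. map (\<lambda>\<beta>. [[[[\<alpha>]]], [[[\<beta>]]]]) (filter (cf \<alpha>) atoms)) atoms)"

text \<open>As \<open>cf\<close> relates any two values of one slot, the conflict clauses force
  \<open>\<chi> R = map \<sigma> R\<close> for a single choice \<open>\<sigma>\<close>. A clause
  then fails under \<open>\<sigma>\<close> iff some tuple collects a falsifying slot for each of its
  literals, that is, iff some \<open>\<chi> R\<close> kills it.\<close>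

lemma tuple_choice:
  fixes slots :: "'s list" and atoms :: "('s \<times> 'v) list"
  assumes q: "0 < q" and ne: "slots \<noteq> []"
    and len: "\<And>D t c. D \<in> set \<Phi> \<Longrightarrow> t \<in> set D \<Longrightarrow> c \<in> set t \<Longrightarrow> length c \<le> q"
    and cf: "\<And>\<alpha> \<beta>. fst \<alpha> = fst \<beta> \<Longrightarrow> \<alpha> \<noteq> \<beta> \<Longrightarrow> cf \<alpha> \<beta>"
  shows "(\<exists>\<chi>. (\<forall>R\<in>set (List.n_lists q slots). \<chi> R \<in> set (List.n_lists q atoms) \<and> map fst (\<chi> R) = R) \<and>
      avoids \<chi> (List.n_lists q slots) (conflict_clauses cf atoms @ \<Phi>)) \<longleftrightarrow>
    (\<exists>\<sigma>. picks \<sigma> slots atoms \<and> (\<forall>r\<in>set slots. \<forall>r'\<in>set slots. \<not> cf (\<sigma> r) (\<sigma> r')) \<and> ev2 (holds \<sigma> slots) \<Phi>)"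
    (is "?L \<longleftrightarrow> ?R")
proof
  assume ?L
  then obtain \<chi> where \<chi>: "\<And>R. set R \<subseteq> set slots \<Longrightarrow> length R = q \<Longrightarrow> set (\<chi> R) \<subseteq> set atoms \<and> length (\<chi> R) = q \<and> map fst (\<chi> R) = R"
    and av: "avoids \<chi> (List.n_lists q slots) (conflict_clauses cf atoms @ \<Phi>)"
    by (auto simp: set_n_lists)
  have nc: "\<not> cf \<alpha> \<beta>" if "set R \<subseteq> set slots" "length R = q" "\<alpha> \<in> set (\<chi> R)"
    "set R' \<subseteq> set slots" "length R' = q" "\<beta> \<in> set (\<chi> R')" for R R' \<alpha> \<beta>
  proof
    assume "cf \<alpha> \<beta>"
    moreover have "\<alpha> \<in> set atoms" "\<beta> \<in> set atoms" using that \<chi> by blast+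
    ultimately have "[[[[\<alpha>]]], [[[\<beta>]]]] \<in> set (conflict_clauses cf atoms @ \<Phi>)"
      by (auto simp: conflict_clauses_def)
    from av[unfolded avoids_def, rule_format, OF this] show False
      using that by (auto simp: kills_def set_n_lists)
  qed
  \<comment> \<open>The value of a slot is read off its constant tuple, which is non-empty by
    \<open>0 < q\<close>.\<close>
  define \<sigma> where "\<sigma> r = hd (\<chi> (replicate q r))" for r
  have \<sigma>: "\<sigma> r \<in> set (\<chi> (replicate q r)) \<and> fst (\<sigma> r) = r" if "r \<in> set slots" for r
  proof -
    have "set (replicate q r) \<subseteq> set slots" using that by auto
    then have "map fst (\<chi> (replicate q r)) = replicate q r" using \<chi> by simp
    then show ?thesis using q unfolding \<sigma>_def by (cases "\<chi> (replicate q r)"; cases q) auto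
  qed
  have rep: "set (replicate q r) \<subseteq> set slots" if "r \<in> set slots" for r using that by auto
  have eq: "\<chi> R = map \<sigma> R" if "set R \<subseteq> set slots" "length R = q" for R
  proof (rule nth_equalityI)
    show len: "length (\<chi> R) = length (map \<sigma> R)" using \<chi>[OF that] that by simp
    fix i assume i: "i < length (\<chi> R)"
    have "map fst (\<chi> R) ! i = R ! i" using \<chi>[OF that] by simp
    then have "fst (\<chi> R ! i) = R ! i" using i by simp
    moreover have "R ! i \<in> set slots" using i len that(1) nth_mem[of i R] by auto
    moreover from this have "\<not> cf (\<chi> R ! i) (\<sigma> (R ! i))"
      using nc[OF that nth_mem[OF i] rep[of "R ! i"] _ conjunct1[OF \<sigma>[of "R ! i"]]] by simp
    ultimately have "\<chi> R ! i = \<sigma> (R ! i)"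
      using cf \<sigma> by metis
    then show "\<chi> R ! i = map \<sigma> R ! i" using i len by simp
  qed
  show ?R
  proof (intro exI[of _ \<sigma>] conjI ballI)
    show "picks \<sigma> slots atoms" unfolding picks_def
      using \<sigma> \<chi>[OF rep] by (metis length_replicate subsetD)
    show "\<not> cf (\<sigma> r) (\<sigma> r')" if "r \<in> set slots" "r' \<in> set slots" for r r'
      by (rule nc[OF rep[OF that(1)] _ conjunct1[OF \<sigma>[OF that(1)]] rep[OF that(2)] _ conjunct1[OF \<sigma>[OF that(2)]]]) auto
    show "ev2 (holds \<sigma> slots) \<Phi>" unfolding ev2_def ev1_def ev0_def
    proof
      fix D assume D: "D \<in> set \<Phi>"
      then obtain t where t: "t \<in> set D" "\<And>c R. c \<in> set t \<Longrightarrow> R \<in> set (List.n_lists q slots) \<Longrightarrow> \<not> kills (\<chi> R) c"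
        using av unfolding avoids_def by fastforce
      have "\<exists>l\<in>set c. holds \<sigma> slots l" if c: "c \<in> set t" for c
      proof (rule ccontr)
        assume "\<not> ?thesis"
        then obtain r where r: "\<And>l. l \<in> set c \<Longrightarrow> r l \<in> set slots \<and> \<sigma> (r l) \<in> set l"
          unfolding holds_def by metis
        \<comment> \<open>One falsifying slot per literal of \<open>c\<close>, padded with an
          arbitrary slot to length \<open>q\<close>; this is where \<open>length c \<le> q\<close>
          enters.\<close>
        define R where "R = map r c @ replicate (q - length c) (hd slots)"
        have R: "set R \<subseteq> set slots" "length R = q"
          using r ne len[OF D t(1) c] by (auto simp: R_def)
        have "kills (\<chi> R) c" unfolding kills_def eq[OF R] using r by (force simp: R_def)
        then show False using t(2)[OF c] R by (auto simp: set_n_lists)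
      qed
      then show "\<exists>t\<in>set D. \<forall>c\<in>set t. \<exists>l\<in>set c. holds \<sigma> slots l" using t(1) by blast
    qed
  qed
next
  assume ?R
  then obtain \<sigma> where \<sigma>: "picks \<sigma> slots atoms" "\<And>r r'. r \<in> set slots \<Longrightarrow> r' \<in> set slots \<Longrightarrow> \<not> cf (\<sigma> r) (\<sigma> r')"
    "ev2 (holds \<sigma> slots) \<Phi>" by blast
  have 1: "\<exists>t\<in>set D. \<forall>c\<in>set t. \<forall>R\<in>set (List.n_lists q slots). \<not> kills (map \<sigma> R) c"
    if D: "D \<in> set \<Phi>" for D
  proof -
    obtain t where t: "t \<in> set D" "\<forall>c\<in>set t. \<exists>l\<in>set c. holds \<sigma> slots l"
      using \<sigma>(3) D unfolding ev2_def ev1_def ev0_def by blast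
    have "\<not> kills (map \<sigma> R) c" if "c \<in> set t" "R \<in> set (List.n_lists q slots)" for c R
      using t(2) that unfolding kills_def holds_def by (fastforce simp: set_n_lists)
    then show ?thesis using t by blast
  qed
  have 2: "\<exists>t\<in>set D. \<forall>c\<in>set t. \<forall>R\<in>set (List.n_lists q slots). \<not> kills (map \<sigma> R) c"
    if D: "D \<in> set (conflict_clauses cf atoms)" for D
  proof -
    obtain \<alpha> \<beta> where D: "D = [[[[\<alpha>]]], [[[\<beta>]]]]" "cf \<alpha> \<beta>" using D by (auto simp: conflict_clauses_def)
    show ?thesis
    proof (rule ccontr)
      assume "\<not> ?thesis"
      then have "\<exists>R\<in>set (List.n_lists q slots). \<alpha> \<in> \<sigma> ` set R" "\<exists>R\<in>set (List.n_lists q slots). \<beta> \<in> \<sigma> ` set R"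
        using D by (auto simp: kills_def)
      then show False using \<sigma>(2) D(2) by (auto simp: set_n_lists)
    qed
  qed
  show ?L
  proof (intro exI[of _ "map \<sigma>"] conjI ballI)
    show "avoids (map \<sigma>) (List.n_lists q slots) (conflict_clauses cf atoms @ \<Phi>)"
      unfolding avoids_def using 1 2 by auto
    fix R assume "R \<in> set (List.n_lists q slots)"
    then have R: "set R \<subseteq> set slots" "length R = q" by (auto simp: set_n_lists)
    then show "map \<sigma> R \<in> set (List.n_lists q atoms)" using \<sigma>(1) by (auto simp: set_n_lists picks_def)
    show "map fst (map \<sigma> R) = R" unfolding map_map
      by (rule map_idI) (use R \<sigma>(1) in \<open>auto simp: picks_def\<close>)
  qed
qed

text \<open>Either a tuple slot \<open>(R, [], [])\<close> or a disjunct \<open>([], D, t)\<close>.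
  Tuples are non-empty, so the first component tells them apart; \<open>D\<close> records the edge
  on which the disjunct lies.\<close>

type_synonym ('s, 'l) vertex = "'s list \<times> 'l list list list \<times> 'l list list"

definition vertex_list :: "'s list list \<Rightarrow> 'l list list list list \<Rightarrow> ('s, 'l) vertex list" where
  "vertex_list Rs \<Phi> = map (\<lambda>R. (R, [], [])) Rs @ concat (map (\<lambda>D. map (\<lambda>t. ([], D, t)) D) \<Phi>)"

text \<open>Besides the vertex of its own slot tuple, the edge of \<open>w\<close> contains exactly
  the disjuncts that must lose value 2 when \<open>w\<close> is chosen.\<close>

definition incident :: "('s \<times> 'v) list \<Rightarrow> ('s, ('s \<times> 'v) list) vertex \<Rightarrow> bool" where
  "incident w x \<longleftrightarrow> (if fst x = [] then \<exists>c\<in>set (snd (snd x)). kills w c else fst x = map fst w)"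

definition select :: "('a \<Rightarrow> bool) \<Rightarrow> 'a list \<Rightarrow> nat list" where
  "select P V = map fst (filter (\<lambda>p. P (snd p)) (enumerate 0 V))"

lemma set_select: "set (select P V) = {u. u < length V \<and> P (V ! u)}"
  unfolding select_def by (force simp: in_set_enumerate_eq image_iff)

definition other_edges :: "('s \<times> 'v) list list \<Rightarrow> ('s, ('s \<times> 'v) list) vertex list \<Rightarrow>
    ('s \<times> 'v) list list list list list \<Rightarrow> nat list list" where
  "other_edges ws V \<Phi> = map (\<lambda>w. select (incident w) V) ws @
     map (\<lambda>D. select (\<lambda>x. fst x = [] \<and> fst (snd x) = D) V) \<Phi>"

text \<open>The edge of a \<open>D\<close> contains no prescribed vertex, so a private edge at the
  vertex of \<open>R\<close> belongs to some \<open>w\<close> with \<open>map fst w = R\<close>.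
  Edges of tuples are hit by the prescribed vertex of their slots; the edge of \<open>D\<close> is
  hit iff one of its disjuncts lies on no chosen edge.\<close>

lemma extends_iff_choice:
  fixes Rs :: "'s list list" and ws :: "('s \<times> 'v) list list" and \<Phi> :: "('s \<times> 'v) list list list list list"
  assumes dist: "distinct Rs" and ne: "[] \<notin> set Rs" and ws: "\<And>w. w \<in> set ws \<Longrightarrow> map fst w \<in> set Rs"
  defines "V \<equiv> vertex_list Rs \<Phi>"
  defines "N \<equiv> length V"
  assumes f: "\<And>x. x < N \<Longrightarrow> f x = (if fst (V ! x) = [] then 0 else 2)"
  shows "extends_to_minimal_rhf (vertices [0..<N]) (indices (map (\<lambda>v. [v]) [0..<N] @ other_edges ws V \<Phi>))
      (edge (map (\<lambda>v. [v]) [0..<N] @ other_edges ws V \<Phi>)) ((!) [0..<N]) f \<longleftrightarrow>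
    (\<exists>\<chi>. (\<forall>R\<in>set Rs. \<chi> R \<in> set ws \<and> map fst (\<chi> R) = R) \<and> avoids \<chi> Rs \<Phi>)" (is "_ \<longleftrightarrow> ?R")
proof -
  define P where "P = {u. u < N \<and> fst (V ! u) \<noteq> []}"
  have set_V: "set V = (\<lambda>R. (R, [], [])) ` set Rs \<union> {([], D, t) | D t. D \<in> set \<Phi> \<and> t \<in> set D}"
    by (auto simp: V_def vertex_list_def)
  have V1: "V ! u = (Rs ! u, [], [])" "u < N" if "u < length Rs" for u
    using that by (auto simp: V_def N_def vertex_list_def nth_append)
  have V2: "fst (V ! u) = []" if "u < N" "\<not> u < length Rs" for u
  proof -
    let ?T = "concat (map (\<lambda>D. map (\<lambda>t. ([], D, t)) D) \<Phi>) :: ('s, ('s \<times> 'v) list) vertex list"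
    have "V ! u = ?T ! (u - length Rs)" "u - length Rs < length ?T"
      using that by (simp_all add: V_def N_def vertex_list_def nth_append)
    then have "V ! u \<in> set ?T" using nth_mem[of "u - length Rs" ?T] by (simp only:)
    then show ?thesis by auto
  qed
  have ne': "Rs ! u \<noteq> []" if "u < length Rs" for u using ne that by (metis nth_mem)
  have P: "u \<in> P \<longleftrightarrow> u < length Rs" for u
    using V1 V2 ne' by (cases "u < length Rs") (auto simp: P_def)
  let ?e = "\<lambda>w. select (incident w) V" and ?d = "\<lambda>D. select (\<lambda>x. fst x = [] \<and> fst (snd x) = D) V"
  let ?c = "\<lambda>c. (\<forall>v\<in>P. c v \<in> set (other_edges ws V \<Phi>) \<and> set (c v) \<inter> P = {v}) \<and>
      (\<forall>E\<in>set (other_edges ws V \<Phi>). \<exists>u\<in>set E. u \<in> P \<or> (\<forall>v\<in>P. u \<notin> set (c v)))"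
  have Es: "set (other_edges ws V \<Phi>) = ?e ` set ws \<union> ?d ` set \<Phi>" by (simp add: other_edges_def)
  have e_P: "set (?e w) \<inter> P = {u. u < length Rs \<and> Rs ! u = map fst w}" for w
    using V1 ne' by (auto simp: set_select P incident_def N_def[symmetric])
  have d_P: "set (?d D) \<inter> P = {}" for D by (auto simp: set_select P_def)
  have "(\<exists>c. ?c c) \<longleftrightarrow> ?R"
  proof
    assume "\<exists>c. ?c c"
    then obtain c where "?c c" by (rule exE)
    then have c: "\<And>v. v \<in> P \<Longrightarrow> c v \<in> ?e ` set ws \<union> ?d ` set \<Phi>" "\<And>v. v \<in> P \<Longrightarrow> set (c v) \<inter> P = {v}"
      and hit: "\<And>E. E \<in> ?d ` set \<Phi> \<Longrightarrow> \<exists>u\<in>set E. u \<in> P \<or> (\<forall>v\<in>P. u \<notin> set (c v))"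
      unfolding Es by simp_all
    have "\<exists>w\<in>set ws. c u = ?e w \<and> map fst w = Rs ! u" if "u < length Rs" for u
    proof -
      have u: "u \<in> P" using that P by simp
      have "c u \<notin> ?d ` set \<Phi>" using c(2)[OF u] d_P by fastforce
      then obtain w where w: "w \<in> set ws" "c u = ?e w" using c(1)[OF u] by blast
      then have "{v. v < length Rs \<and> Rs ! v = map fst w} = {u}" using c(2)[OF u] e_P[of w] by simp
      from equalityD2[THEN subsetD, OF this singletonI] have "map fst w = Rs ! u" by simp
      then show ?thesis using w by blast
    qed
    then obtain W where W: "\<And>u. u < length Rs \<Longrightarrow> W u \<in> set ws \<and> c u = ?e (W u) \<and> map fst (W u) = Rs ! u"
      by metis
    have "\<exists>u<length Rs. Rs ! u = R" if "R \<in> set Rs" for R using that by (simp add: in_set_conv_nth)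
    then obtain pos where pos: "\<And>R. R \<in> set Rs \<Longrightarrow> pos R < length Rs \<and> Rs ! pos R = R" by metis
    show ?R
    proof (intro exI[of _ "\<lambda>R. W (pos R)"] conjI ballI)
      show "W (pos R) \<in> set ws" "map fst (W (pos R)) = R" if "R \<in> set Rs" for R using pos[OF that] W by auto
      show "avoids (\<lambda>R. W (pos R)) Rs \<Phi>" unfolding avoids_def
      proof
        fix D assume D: "D \<in> set \<Phi>"
        then obtain u where u: "u \<in> set (?d D)" "u \<in> P \<or> (\<forall>v\<in>P. u \<notin> set (c v))" using hit by blast
        have uN: "u < length V" and u0: "fst (V ! u) = []" "fst (snd (V ! u)) = D" using u(1) by (auto simp: set_select)
        have up: "u \<notin> P" using u(1) d_P by blast
        define t where "t = snd (snd (V ! u))"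
        have "V ! u = ([], D, t)" using u0 by (simp add: t_def prod_eq_iff)
        then have t: "t \<in> set D" using nth_mem[OF uN] unfolding set_V using ne by auto
        have "\<not> kills (W (pos R)) cl" if "cl \<in> set t" "R \<in> set Rs" for cl R
        proof
          assume "kills (W (pos R)) cl"
          then have "u \<in> set (?e (W (pos R)))" using uN u0 that by (auto simp: set_select incident_def t_def)
          moreover have "pos R \<in> P" using pos[OF that(2)] P by simp
          ultimately show False using u(2) up W[of "pos R"] pos[OF that(2)] by metis
        qed
        then show "\<exists>t\<in>set D. \<forall>c\<in>set t. \<forall>R\<in>set Rs. \<not> kills (W (pos R)) c" using t by blast
      qed
    qed
  next
    assume ?R
    then obtain \<chi> where \<chi>: "\<And>R. R \<in> set Rs \<Longrightarrow> \<chi> R \<in> set ws \<and> map fst (\<chi> R) = R" and av: "avoids \<chi> Rs \<Phi>" by blast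
    have "?c (\<lambda>v. ?e (\<chi> (Rs ! v)))"
    proof (intro conjI ballI)
      fix v assume v: "v \<in> P"
      then have vl: "v < length Rs" "Rs ! v \<in> set Rs" using P by auto
      show "?e (\<chi> (Rs ! v)) \<in> set (other_edges ws V \<Phi>)" unfolding Es using \<chi>[OF vl(2)] by blast
      show "set (?e (\<chi> (Rs ! v))) \<inter> P = {v}"
        unfolding e_P using \<chi>[OF vl(2)] vl dist by (auto simp: nth_eq_iff_index_eq)
    next
      fix E assume "E \<in> set (other_edges ws V \<Phi>)"
      then consider w where "w \<in> set ws" "E = ?e w" | D where "D \<in> set \<Phi>" "E = ?d D" unfolding Es by blast
      then show "\<exists>u\<in>set E. u \<in> P \<or> (\<forall>v\<in>P. u \<notin> set (?e (\<chi> (Rs ! v))))"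
      proof cases
        case 1
        then obtain u where "u < length Rs" "Rs ! u = map fst w" using ws by (metis in_set_conv_nth)
        then have "u \<in> set E \<inter> P" using e_P 1 by blast
        then show ?thesis by blast
      next
        case 2
        then obtain t where t: "t \<in> set D" "\<And>c R. c \<in> set t \<Longrightarrow> R \<in> set Rs \<Longrightarrow> \<not> kills (\<chi> R) c"
          using av unfolding avoids_def by blast
        then have "([], D, t) \<in> set V" unfolding set_V using 2 by blast
        then obtain u where u: "u < length V" "V ! u = ([], D, t)" by (metis in_set_conv_nth)
        have "u \<in> set E" using u 2 by (simp add: set_select)
        moreover have "u \<notin> set (?e (\<chi> (Rs ! v)))" if "v \<in> P" for v
          using that t(2) u by (auto simp: set_select incident_def P)
        ultimately show ?thesis by blast
      qed
    qed
    then show "\<exists>c. ?c c" by (rule exI[where x = "\<lambda>v. ?e (\<chi> (Rs ! v))"])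
  qed
  moreover have "\<forall>E\<in>set (other_edges ws V \<Phi>). set E \<subseteq> {..<N}"
    by (auto simp: other_edges_def set_select N_def)
  moreover have "P \<subseteq> {..<N}" by (auto simp: P_def)
  moreover have "f x = (if x \<in> P then 2 else 0)" if "x < N" for x using f[OF that] that by (simp add: P_def)
  ultimately show ?thesis using extends_own_edges[of "other_edges ws V \<Phi>" N P f] by (simp only:)
qed

section \<open>Encoding a set of inputs by gaps\<close>

text \<open>Gaps \<open>{a r..<b r}\<close> alternate with chosen positions, beginning and ending
  with a gap; \<open>b k = n\<close> is a sentinel behind all positions.\<close>

locale gaps =
  fixes k n :: nat and a b :: "nat \<Rightarrow> nat"
  assumes a0: "a 0 = 0" and a_Suc: "\<And>r. r < k \<Longrightarrow> a (Suc r) = Suc (b r)"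
    and ab: "\<And>r. r \<le> k \<Longrightarrow> a r \<le> b r" and bk: "b k = n"
begin

lemma b_mono: "r < r' \<Longrightarrow> r' \<le> k \<Longrightarrow> b r < b r'"
proof (induction r' rule: less_induct)
  case (less r')
  then obtain m where m: "r' = Suc m" by (cases r') auto
  have "b m < b r'" using a_Suc[of m] ab[of r'] less.prems m by simp
  then show ?case using less.IH[of m] less.prems m by (cases "r = m") auto
qed

lemma inj_b: "inj_on b {..<k}"
  by (rule linorder_inj_onI) (use b_mono in \<open>fastforce+\<close>)

lemma card_b: "card (b ` {..<k}) = k"
  using card_image[OF inj_b] by simp

lemma hit_iff: "j < n \<Longrightarrow> (\<forall>r\<le>k. b r \<noteq> j) \<longleftrightarrow> j \<notin> b ` {..<k}"
  using bk by (auto simp: le_less)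

text \<open>The gaps and the points \<open>b r\<close> with \<open>r < k\<close> partition the
  positions. Being chosen thus becomes a condition on each slot separately.\<close>

lemma gap_iff: "j < n \<Longrightarrow> (\<forall>r\<le>k. \<not> (a r \<le> j \<and> j < b r)) \<longleftrightarrow> j \<in> b ` {..<k}"
proof
  assume j: "j < n" and *: "\<forall>r\<le>k. \<not> (a r \<le> j \<and> j < b r)"
  define r where "r = (LEAST r. j < b r)"
  have r: "j < b r" "r \<le> k"
    unfolding r_def using j bk by (auto intro: LeastI[of _ k] Least_le)
  then have "\<not> a r \<le> j" using * by blast
  then obtain m where m: "r = Suc m" using a0 by (cases r) auto
  then have "\<not> j < b m" using not_less_Least[of m "\<lambda>r. j < b r"] r_def by simp
  moreover have "a r = Suc (b m)" using a_Suc[of m] r m by simp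
  ultimately have "j = b m" using \<open>\<not> a r \<le> j\<close> by simp
  then show "j \<in> b ` {..<k}" using r m by simp
next
  assume j: "j < n" and "j \<in> b ` {..<k}"
  then obtain i where i: "i < k" "j = b i" by blast
  show "\<forall>r\<le>k. \<not> (a r \<le> j \<and> j < b r)"
  proof (intro allI impI)
    fix r assume r: "r \<le> k"
    show "\<not> (a r \<le> j \<and> j < b r)"
    proof (cases "r \<le> i")
      case True
      then have "b r \<le> b i" using b_mono[of r i] i by (cases "r = i") auto
      then show ?thesis using i by simp
    next
      case False
      then obtain m where m: "r = Suc m" "i \<le> m" by (cases r) auto
      then have "b i \<le> b m" using b_mono[of i m] r by (cases "i = m") auto
      then show ?thesis using a_Suc[of m] m r i by simp
    qed
  qed
qed

end

lemma gaps_of_set: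
  assumes "S \<subseteq> {..<n}" "card S = k"
  obtains a b where "gaps k n a b" "b ` {..<k} = S"
proof -
  have fin: "finite S" using assms(1) finite_subset by blast
  define xs where "xs = sorted_list_of_set S"
  have xs: "sorted_wrt (<) xs" "set xs = S" "length xs = k"
    using fin assms by (auto simp: xs_def)
  define b where "b r = (if r < k then xs ! r else n)" for r
  define a where "a r = (case r of 0 \<Rightarrow> 0 | Suc m \<Rightarrow> Suc (b m))" for r
  have b: "b m < b (Suc m)" if "m < k" for m
    using xs assms(1) that nth_mem[of m xs] sorted_wrt_nth_less[OF xs(1), of m "Suc m"] by (auto simp: b_def)
  have "gaps k n a b"
  proof
    show "a r \<le> b r" if "r \<le> k" for r using b that by (cases r) (auto simp: a_def Suc_le_eq)
  qed (simp_all add: a_def b_def)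
  moreover have "b ` {..<k} = S"
    using xs by (auto simp: b_def in_set_conv_nth image_iff)
  ultimately show thesis by (rule that)
qed

text \<open>Arguments precede their gates, so a valuation is extended gate by gate.\<close>

lemma consistent_exists: "circuit C \<Longrightarrow> \<exists>v. consistent C S v"
proof -
  assume C: "circuit C"
  have "\<exists>v. \<forall>i<m. v i \<longleftrightarrow> gate_value S v i (C ! i)" if "m \<le> length C" for m
    using that
  proof (induction m)
    case (Suc m)
    then obtain v where v: "\<And>i. i < m \<Longrightarrow> v i \<longleftrightarrow> gate_value S v i (C ! i)" by auto
    define v' where "v' = v(m := gate_value S v m (C ! m))"
    have "gate_value S v' i (C ! i) \<longleftrightarrow> gate_value S v i (C ! i)" if "i \<le> m" for i
    proof -
      have "v' j \<longleftrightarrow> v j" if "j \<in> set (args (C ! i))" for j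
        using args_less[OF C _ that] Suc.prems \<open>i \<le> m\<close> by (auto simp: v'_def)
      then show ?thesis by (cases "C ! i") auto
    qed
    note eq = this
    have "v' i \<longleftrightarrow> gate_value S v' i (C ! i)" if "i < Suc m" for i
      using eq[of i] v[of i] that by (cases "i = m") (simp_all add: v'_def del: fun_upd_apply, simp_all)
    then show ?case by blast
  qed simp
  from this[of "length C"] show ?thesis by (simp add: consistent_def)
qed

text \<open>
  The slot \<open>([], r)\<close> holds the \<open>r\<close>-th gap \<open>(a, b)\<close>: for \<open>r < k\<close>, \<open>b\<close> is the \<open>r\<close>-th true input, while
  \<open>b\<close> is the number of gates for \<open>r = k\<close>, and the inputs from \<open>a\<close> to \<open>b - 1\<close> are false.  The slot
  \<open>(p, 0)\<close> with \<open>p \<noteq> []\<close> holds the guess \<open>j\<close> at the path \<open>p\<close>, stored as \<open>(0, j)\<close>.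
\<close>

type_synonym slot = "bool list \<times> nat"
type_synonym atom = "slot \<times> nat \<times> nat"

text \<open>The list depends on \<open>d\<close> alone and enters programs as a constant, so any
  enumeration will do. The label \<open>[]\<close> is reserved for gaps. Length \<open>d\<close>
  suffices because the output starts with label \<open>[True]\<close> and depth
  \<open>d\<close>.\<close>

definition labels :: "nat \<Rightarrow> bool list list" where
  "labels d = (SOME ps. distinct ps \<and> set ps = {p. p \<noteq> [] \<and> length p < Suc d})"

lemma labels: "distinct (labels d)" "set (labels d) = {p. p \<noteq> [] \<and> length p < Suc d}"
proof -
  have "finite {p :: bool list. set p \<subseteq> UNIV \<and> length p \<le> d}" by (rule finite_lists_length_le) simp
  then have "finite {p :: bool list. p \<noteq> [] \<and> length p < Suc d}" by (rule rev_finite_subset) auto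
  from someI_ex[OF finite_distinct_list[OF this, unfolded conj_commute[of "set _ = _"]]]
  show "distinct (labels d)" "set (labels d) = {p. p \<noteq> [] \<and> length p < Suc d}"
    unfolding labels_def by blast+
qed

definition slots :: "nat \<Rightarrow> nat \<Rightarrow> slot list" where
  "slots d k = map (\<lambda>r. ([], r)) [0..<Suc k] @ map (\<lambda>p. (p, 0)) (labels d)"

definition valid_gap :: "circuit \<Rightarrow> nat \<Rightarrow> atom \<Rightarrow> bool" where
  "valid_gap C k \<alpha> \<longleftrightarrow> fst (snd \<alpha>) \<le> snd (snd \<alpha>) \<and> (snd (fst \<alpha>) = 0 \<longrightarrow> fst (snd \<alpha>) = 0) \<and>
     (if snd (fst \<alpha>) = k then snd (snd \<alpha>) = length C
      else snd (snd \<alpha>) < length C \<and> kind (lookup Input C (snd (snd \<alpha>))) = 0)"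

definition gap_atoms :: "circuit \<Rightarrow> nat \<Rightarrow> atom list" where
  "gap_atoms C k = filter (valid_gap C k) (concat (map (\<lambda>r. concat (map (\<lambda>a. map (\<lambda>b. (([], r), (a, b)))
     [0..<Suc (length C)]) [0..<Suc (length C)])) [0..<Suc k]))"

definition atoms :: "nat \<Rightarrow> circuit \<Rightarrow> nat \<Rightarrow> atom list" where
  "atoms d C k = gap_atoms C k @ concat (map (\<lambda>p. map (\<lambda>j. ((p, 0), (0, j))) [0..<length C]) (labels d))"

text \<open>Besides two values for one slot, neighbouring gaps that do not fit together clash. The
  conditions of \<open>gaps\<close> that concern a single slot are built into
  \<open>valid_gap\<close>.\<close>

definition clash :: "atom \<Rightarrow> atom \<Rightarrow> bool" where
  "clash \<alpha> \<beta> \<longleftrightarrow> fst \<alpha> = fst \<beta> \<and> snd \<alpha> \<noteq> snd \<beta> \<or>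
     fst (fst \<alpha>) = [] \<and> fst (fst \<beta>) = [] \<and> snd (fst \<beta>) = Suc (snd (fst \<alpha>)) \<and> fst (snd \<beta>) \<noteq> Suc (snd (snd \<alpha>))"

text \<open>The truth of input \<open>j\<close> is refuted by a gap covering \<open>j\<close>, its
  falsity by a gap ending at \<open>j\<close>.\<close>

definition lit :: "circuit \<Rightarrow> nat \<Rightarrow> bool \<Rightarrow> nat \<Rightarrow> atom list" where
  "lit C k s j = filter (\<lambda>\<alpha>. if s then fst (snd \<alpha>) \<le> j \<and> j < snd (snd \<alpha>) else snd (snd \<alpha>) = j) (gap_atoms C k)"

definition guess :: "bool list \<Rightarrow> nat \<Rightarrow> atom list" where
  "guess p j = [((p, 0), (0, j))]"

lemma set_gap_atoms: "\<alpha> \<in> set (gap_atoms C k) \<longleftrightarrow>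
    (\<exists>r a b. \<alpha> = (([], r), (a, b)) \<and> r \<le> k \<and> b \<le> length C \<and> a \<le> b \<and> (r = 0 \<longrightarrow> a = 0) \<and>
       (if r = k then b = length C else b \<in> input_nodes C))"
proof -
  have kind: "kind g = 0 \<longleftrightarrow> g = Input" for g by (cases g) auto
  obtain p r a b where \<alpha>: "\<alpha> = ((p, r), (a, b))" by (metis prod.collapse)
  have "\<alpha> \<in> set (concat (map (\<lambda>r. concat (map (\<lambda>a. map (\<lambda>b. (([], r), (a, b)))
      [0..<Suc (length C)]) [0..<Suc (length C)])) [0..<Suc k])) \<longleftrightarrow>
    p = [] \<and> r \<le> k \<and> a \<le> length C \<and> b \<le> length C"
    unfolding \<alpha> by (auto simp: less_Suc_eq_le image_iff simp del: upt_Suc)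
  then show ?thesis
    unfolding gap_atoms_def set_filter mem_Collect_eq by (auto simp: \<alpha> kind valid_gap_def input_nodes_def)
qed

lemma set_atoms: "\<alpha> \<in> set (atoms d C k) \<longleftrightarrow> \<alpha> \<in> set (gap_atoms C k) \<or>
    (\<exists>p j. \<alpha> = ((p, 0), (0, j)) \<and> p \<noteq> [] \<and> length p < Suc d \<and> j < length C)"
  by (auto simp: atoms_def labels)

lemma set_slots: "set (slots d k) = (\<lambda>r. ([], r)) ` {..k} \<union> (\<lambda>p. (p, 0)) ` {p. p \<noteq> [] \<and> length p < Suc d}"
  by (auto simp: slots_def labels image_iff less_Suc_eq_le simp del: upt_Suc)

lemma distinct_slots: "distinct (slots d k)"
  by (auto simp: slots_def labels distinct_map inj_on_def simp del: upt_Suc)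

lemma holds_slots: "holds \<sigma> (slots d k) l \<longleftrightarrow>
    (\<forall>r\<le>k. \<sigma> ([], r) \<notin> set l) \<and> (\<forall>p. p \<noteq> [] \<longrightarrow> length p < Suc d \<longrightarrow> \<sigma> (p, 0) \<notin> set l)"
  unfolding holds_def set_slots by auto

context
  fixes C :: circuit and k d :: nat and a b :: "nat \<Rightarrow> nat" and \<gamma> :: "bool list \<Rightarrow> nat"
    and \<sigma> :: "slot \<Rightarrow> atom"
  assumes gaps: "gaps k (length C) a b" and inp: "\<And>r. r < k \<Longrightarrow> b r \<in> input_nodes C"
    and gap: "\<And>r. r \<le> k \<Longrightarrow> \<sigma> ([], r) = (([], r), (a r, b r))"
    and lab: "\<And>p. p \<noteq> [] \<Longrightarrow> length p < Suc d \<Longrightarrow> \<sigma> (p, 0) = ((p, 0), (0, \<gamma> p))"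
begin

interpretation gaps k "length C" a b by (rule gaps)

lemma gap_atom: "r \<le> k \<Longrightarrow> (([], r), (a r, b r)) \<in> set (gap_atoms C k)"
  using ab[of r] a0 bk inp[of r] by (auto simp: set_gap_atoms input_nodes_def le_less)

lemma holds_lit:
  assumes "j < length C" shows "holds \<sigma> (slots d k) (lit C k s j) \<longleftrightarrow> (j \<in> b ` {..<k}) = s"
proof -
  have "\<sigma> (p, 0) \<notin> set (lit C k s j)" if "p \<noteq> []" "length p < Suc d" for p
    using lab[OF that] that(1) by (auto simp: lit_def set_gap_atoms)
  then have "holds \<sigma> (slots d k) (lit C k s j) \<longleftrightarrow>
      (\<forall>r\<le>k. \<not> (if s then a r \<le> j \<and> j < b r else b r = j))"
    using gap_atom gap by (auto simp: holds_slots lit_def)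
  then show ?thesis using gap_iff[OF assms] hit_iff[OF assms] by (cases s) simp_all
qed

lemma holds_guess: "p \<noteq> [] \<Longrightarrow> length p < Suc d \<Longrightarrow> holds \<sigma> (slots d k) (guess p j) \<longleftrightarrow> \<gamma> p \<noteq> j"
  by (auto simp: holds_slots guess_def gap lab)

end

text \<open>Gap slots without clash amount to a set of exactly \<open>k\<close> inputs, as their
  ends increase strictly, and label slots to a guess \<open>\<gamma>\<close>. The unfolding is
  complete for some guess and sound for all.\<close>

lemma weighted_sat_iff_picks:
  assumes C: "circuit C" and weft: "weft_at_most C 3" and depth: "depth_at_most C d"
  shows "(\<exists>S\<subseteq>input_nodes C. card S = k \<and> accepts C S) \<longleftrightarrow>
    (\<exists>\<sigma>. picks \<sigma> (slots d k) (atoms d C k) \<and>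
      (\<forall>r\<in>set (slots d k). \<forall>r'\<in>set (slots d k). \<not> clash (\<sigma> r) (\<sigma> r')) \<and>
      ev2 (holds \<sigma> (slots d k)) (F3 guess (lit C k) C d True [True] (length C - 1)))"
proof
  have out: "length C - 1 < length C" using C by (auto simp: circuit_def)
  have bnd: "bounded C 3 d (length C - 1)" using bounded_output[OF depth weft] by (simp add: output_node_def)
  assume "\<exists>S\<subseteq>input_nodes C. card S = k \<and> accepts C S"
  then obtain S v where S: "S \<subseteq> input_nodes C" "card S = k" and cons: "consistent C S v" and v_out: "v (length C - 1)"
    by (auto simp: accepts_def output_node_def)
  have "S \<subseteq> {..<length C}" using S by (auto simp: input_nodes_def)
  from gaps_of_set[OF this S(2)] obtain a b where g: "gaps k (length C) a b" and b: "b ` {..<k} = S" .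
  interpret valuation C S v by unfold_locales (fact C, fact cons)
  define \<sigma> :: "(bool list \<Rightarrow> nat) \<Rightarrow> slot \<Rightarrow> atom" where
    "\<sigma> \<gamma> r = (if fst r = [] then (r, (a (snd r), b (snd r))) else (r, (0, \<gamma> (fst r))))" for \<gamma> r
  have inp: "\<And>r. r < k \<Longrightarrow> b r \<in> input_nodes C" using b S by auto
  have s1: "\<And>r. r \<le> k \<Longrightarrow> \<sigma> \<gamma> ([], r) = (([], r), (a r, b r))" for \<gamma> by (simp add: \<sigma>_def)
  have s2: "\<And>p. p \<noteq> [] \<Longrightarrow> length p < Suc d \<Longrightarrow> \<sigma> \<gamma> (p, 0) = ((p, 0), (0, \<gamma> p))" for \<gamma> by (simp add: \<sigma>_def)
  have vj: "v j \<longleftrightarrow> j \<in> S" if "j < length C" "C ! j = Input" for j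
    using cons that by (simp add: consistent_def)
  have "\<exists>\<gamma>. (\<forall>p. \<gamma> p < length C) \<and> (\<forall>\<gamma>'. (\<forall>q. \<gamma>' ([True] @ q) = \<gamma> ([True] @ q)) \<longrightarrow>
    ev2 (holds (\<sigma> \<gamma>') (slots d k)) (F3 guess (lit C k) C d True [True] (length C - 1)))"
  proof (rule F3_complete[where I = "\<lambda>\<gamma>. holds (\<sigma> \<gamma>) (slots d k)" and M = "Suc d"])
    show "holds (\<sigma> \<gamma>) (slots d k) (lit C k s j) \<longleftrightarrow> v j = s" if "j < length C" "C ! j = Input" for \<gamma> s j
      using holds_lit[OF g inp s1 s2 that(1)] vj[OF that] b by simp
    show "holds (\<sigma> \<gamma>) (slots d k) (guess p j) \<longleftrightarrow> \<gamma> p \<noteq> j" if "p \<noteq> []" "length p < Suc d" for \<gamma> p j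
      using holds_guess[OF g inp s1 s2 that] .
  qed (use out bnd v_out in auto)
  then obtain \<gamma> where \<gamma>: "\<And>p. \<gamma> p < length C"
    "ev2 (holds (\<sigma> \<gamma>) (slots d k)) (F3 guess (lit C k) C d True [True] (length C - 1))" by blast
  show "\<exists>\<sigma>. picks \<sigma> (slots d k) (atoms d C k) \<and>
      (\<forall>r\<in>set (slots d k). \<forall>r'\<in>set (slots d k). \<not> clash (\<sigma> r) (\<sigma> r')) \<and>
      ev2 (holds \<sigma> (slots d k)) (F3 guess (lit C k) C d True [True] (length C - 1))"
  proof (intro exI[of _ "\<sigma> \<gamma>"] conjI ballI)
    show "picks (\<sigma> \<gamma>) (slots d k) (atoms d C k)"
      using gap_atom[OF g inp s1 s2] \<gamma>(1) by (auto simp: picks_def set_slots set_atoms \<sigma>_def)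
    show "\<not> clash (\<sigma> \<gamma> r) (\<sigma> \<gamma> r')" if "r \<in> set (slots d k)" "r' \<in> set (slots d k)" for r r'
      using that gaps.a_Suc[OF g] by (auto simp: set_slots clash_def \<sigma>_def)
  qed (rule \<gamma>)
next
  have out: "length C - 1 < length C" using C by (auto simp: circuit_def)
  have bnd: "bounded C 3 d (length C - 1)" using bounded_output[OF depth weft] by (simp add: output_node_def)
  assume "\<exists>\<sigma>. picks \<sigma> (slots d k) (atoms d C k) \<and>
      (\<forall>r\<in>set (slots d k). \<forall>r'\<in>set (slots d k). \<not> clash (\<sigma> r) (\<sigma> r')) \<and>
      ev2 (holds \<sigma> (slots d k)) (F3 guess (lit C k) C d True [True] (length C - 1))"
  then obtain \<sigma> where picks: "picks \<sigma> (slots d k) (atoms d C k)"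
    and clash: "\<And>r r'. r \<in> set (slots d k) \<Longrightarrow> r' \<in> set (slots d k) \<Longrightarrow> \<not> clash (\<sigma> r) (\<sigma> r')"
    and ev: "ev2 (holds \<sigma> (slots d k)) (F3 guess (lit C k) C d True [True] (length C - 1))" by blast
  define a where "a r = fst (snd (\<sigma> ([], r)))" for r
  define b where "b r = snd (snd (\<sigma> ([], r)))" for r
  define \<gamma> where "\<gamma> p = snd (snd (\<sigma> (p, 0)))" for p
  have gap: "\<sigma> ([], r) = (([], r), (a r, b r)) \<and> a r \<le> b r \<and> (r = 0 \<longrightarrow> a r = 0) \<and>
      (if r = k then b r = length C else b r \<in> input_nodes C)" if "r \<le> k" for r
  proof -
    have "([], r) \<in> set (slots d k)" using that by (auto simp: set_slots)
    then have "\<sigma> ([], r) \<in> set (atoms d C k)" "fst (\<sigma> ([], r)) = ([], r)" using picks by (auto simp: picks_def)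
    then show ?thesis by (auto simp: set_atoms set_gap_atoms a_def b_def)
  qed
  have lab: "\<sigma> (p, 0) = ((p, 0), (0, \<gamma> p)) \<and> \<gamma> p < length C" if "p \<noteq> []" "length p < Suc d" for p
  proof -
    have "(p, 0) \<in> set (slots d k)" using that by (auto simp: set_slots)
    then have "\<sigma> (p, 0) \<in> set (atoms d C k)" "fst (\<sigma> (p, 0)) = (p, 0)" using picks by (auto simp: picks_def)
    then show ?thesis using that by (auto simp: set_atoms set_gap_atoms \<gamma>_def)
  qed
  have g: "gaps k (length C) a b"
  proof
    show "a (Suc r) = Suc (b r)" if "r < k" for r
      using clash[of "([], r)" "([], Suc r)"] gap[of r] gap[of "Suc r"] that by (auto simp: set_slots clash_def)
  qed (use gap in force)+
  have inp: "\<And>r. r < k \<Longrightarrow> b r \<in> input_nodes C" using gap by (metis less_imp_le nat_neq_iff)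
  have s1: "\<And>r. r \<le> k \<Longrightarrow> \<sigma> ([], r) = (([], r), (a r, b r))" using gap by blast
  have s2: "\<And>p. p \<noteq> [] \<Longrightarrow> length p < Suc d \<Longrightarrow> \<sigma> (p, 0) = ((p, 0), (0, \<gamma> p))" using lab by blast
  define S where "S = b ` {..<k}"
  obtain v where cons: "consistent C S v" using consistent_exists[OF C] by blast
  interpret valuation C S v by unfold_locales (fact C, fact cons)
  have vj: "v j \<longleftrightarrow> j \<in> S" if "j < length C" "C ! j = Input" for j
    using cons that by (simp add: consistent_def)
  have v_out: "v (length C - 1) = True"
  proof (rule F3_sound[where I = "holds \<sigma> (slots d k)" and M = "Suc d" and \<gamma> = \<gamma> and e = d and p = "[True]"
        and L = "lit C k" and G = guess])
    show "holds \<sigma> (slots d k) (lit C k s j) \<longleftrightarrow> v j = s" if "j < length C" "C ! j = Input" for s j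
      using holds_lit[OF g inp s1 s2 that(1)] vj[OF that] S_def by simp
    show "holds \<sigma> (slots d k) (guess p j) \<longleftrightarrow> \<gamma> p \<noteq> j" if "p \<noteq> []" "length p < Suc d" for p j
      using holds_guess[OF g inp s1 s2 that] .
  qed (use out bnd ev lab in auto)
  then show "\<exists>S\<subseteq>input_nodes C. card S = k \<and> accepts C S"
    using cons v_out inp gaps.card_b[OF g] by (intro exI[of _ S]) (auto simp: S_def accepts_def output_node_def)
qed

section \<open>The reduction is polynomial\<close>

lemmas pt_rules = pt_id pt_const pt_Pair pt_If pt_fst pt_snd pt_Cons pt_Suc pt_eq pt_not pt_conj pt_disj pt_imp
  pt_case_list pt_append pt_map pt_concat pt_filter pt_Bex pt_Ball pt_mem pt_length pt_add pt_mult pt_power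
  pt_le pt_less pt_enumerate pt_upt pt_lookup pt_kind pt_args

lemma pt_cross: "polytime f \<Longrightarrow> polytime g \<Longrightarrow> polytime (\<lambda>x. cross (f x) (g x))"
  by (rule pt_comp2[where H = cross]) (unfold cross_def, intro pt_rules)

text \<open>The tuple length \<open>n\<close> is a constant of the program, so the number of tuples
  is polynomial in the length of the list.\<close>

lemma pt_n_lists: "polytime f \<Longrightarrow> polytime (\<lambda>x. List.n_lists n (f x))"
proof (erule pt_comp)
  show "polytime (\<lambda>xs. List.n_lists n xs)"
    by (induction n) (simp_all only: List.n_lists.simps, (intro pt_rules | assumption)+)
qed

lemma pt_kills: "polytime f \<Longrightarrow> polytime g \<Longrightarrow> polytime (\<lambda>x. kills (f x) (g x))"
  by (rule pt_comp2[where H = kills]) (unfold kills_def, intro pt_rules)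

lemma pt_slots: "polytime f \<Longrightarrow> polytime (\<lambda>x. slots d (f x))"
  by (erule pt_comp) (unfold slots_def, intro pt_rules)

lemma pt_gap_atoms: "polytime f \<Longrightarrow> polytime g \<Longrightarrow> polytime (\<lambda>x. gap_atoms (f x) (g x))"
  by (rule pt_comp2[where H = gap_atoms]) (unfold gap_atoms_def valid_gap_def, intro pt_rules)

lemma pt_atoms: "polytime f \<Longrightarrow> polytime g \<Longrightarrow> polytime (\<lambda>x. atoms d (f x) (g x))"
  by (rule pt_comp2[where H = "atoms d"]) (unfold atoms_def, intro pt_rules pt_gap_atoms)

lemma pt_lit: "polytime (\<lambda>z. lit (fst (fst z)) (snd (fst z)) s (snd z))"
  unfolding lit_def by (cases s; simp only: if_True if_False; intro pt_rules pt_gap_atoms)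

text \<open>Depth \<open>e\<close> and claimed value \<open>s\<close> are constants of the program,
  not input: the induction unrolls the recursion into nested calls, and each depth gets its own
  polynomial.\<close>

lemma pt_F0: "polytime (\<lambda>z. F0 (lit (fst (fst z)) (snd (fst z))) (fst (fst z)) e s (snd z))"
proof (induction e arbitrary: s)
  case 0
  show ?case unfolding F0.simps by (intro pt_rules pt_lit)
next
  case (Suc e)
  note ih = pt_comp2[where H = "\<lambda>x j. F0 (lit (fst x) (snd x)) (fst x) e s j", OF Suc.IH[of s]]
    pt_comp2[where H = "\<lambda>x j. F0 (lit (fst x) (snd x)) (fst x) e (\<not> s) j", OF Suc.IH[of "\<not> s"]]
  show ?case unfolding F0.simps by (intro pt_rules pt_cross pt_lit ih)
qed

lemma pt_F1: "polytime (\<lambda>z. F1 (lit (fst (fst z)) (snd (fst z))) (fst (fst z)) e s (snd z))"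
proof (induction e arbitrary: s)
  case 0
  show ?case unfolding F1.simps by (intro pt_rules pt_lit)
next
  case (Suc e)
  note ih = pt_comp2[where H = "\<lambda>x j. F1 (lit (fst x) (snd x)) (fst x) e s j", OF Suc.IH[of s]]
    pt_comp2[where H = "\<lambda>x j. F1 (lit (fst x) (snd x)) (fst x) e (\<not> s) j", OF Suc.IH[of "\<not> s"]]
    pt_comp2[where H = "\<lambda>x j. F0 (lit (fst x) (snd x)) (fst x) e s j", OF pt_F0]
  show ?case unfolding F1.simps by (intro pt_rules pt_cross pt_lit ih)
qed

lemma pt_F2: "polytime (\<lambda>z. F2 (lit (fst (fst z)) (snd (fst z))) (fst (fst z)) e s (snd z))"
proof (induction e arbitrary: s)
  case 0
  show ?case unfolding F2.simps by (intro pt_rules pt_lit)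
next
  case (Suc e)
  note ih = pt_comp2[where H = "\<lambda>x j. F2 (lit (fst x) (snd x)) (fst x) e s j", OF Suc.IH[of s]]
    pt_comp2[where H = "\<lambda>x j. F2 (lit (fst x) (snd x)) (fst x) e (\<not> s) j", OF Suc.IH[of "\<not> s"]]
    pt_comp2[where H = "\<lambda>x j. F1 (lit (fst x) (snd x)) (fst x) e s j", OF pt_F1]
  show ?case unfolding F2.simps by (intro pt_rules pt_cross pt_lit ih)
qed

lemma pt_F3: "polytime (\<lambda>z. F3 guess (lit (fst (fst z)) (snd (fst z))) (fst (fst z)) e s p (snd z))"
proof (induction e arbitrary: s p)
  case 0
  show ?case unfolding F3.simps by (intro pt_rules pt_lit)
next
  case (Suc e)
  note ih = pt_comp2[where H = "\<lambda>x j. F3 guess (lit (fst x) (snd x)) (fst x) e s (p @ [True]) j", OF Suc.IH]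
    pt_comp2[where H = "\<lambda>x j. F3 guess (lit (fst x) (snd x)) (fst x) e s (p @ [False]) j", OF Suc.IH]
    pt_comp2[where H = "\<lambda>x j. F3 guess (lit (fst x) (snd x)) (fst x) e (\<not> s) p j", OF Suc.IH]
    pt_comp2[where H = "\<lambda>x j. F2 (lit (fst x) (snd x)) (fst x) e s j", OF pt_F2]
  show ?case unfolding F3.simps guess_def by (intro pt_rules pt_cross pt_lit ih[unfolded guess_def])
qed

definition formula :: "nat \<Rightarrow> circuit \<Rightarrow> nat \<Rightarrow> atom list list list list list" where
  "formula d C k = conflict_clauses clash (atoms d C k) @ F3 guess (lit C k) C d True [True] (length C - 1)"

lemma pt_conflict_clauses: "polytime f \<Longrightarrow> polytime (\<lambda>x. conflict_clauses clash (f x))"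
  by (erule pt_comp) (unfold conflict_clauses_def clash_def, intro pt_rules)

lemma pt_pred: "polytime f \<Longrightarrow> polytime (\<lambda>x. f x - 1 :: nat)"
proof (erule pt_comp, rule pt_expr[of "Right (Var 0)"])
  show "eval (Right (Var 0)) s = encode (n - 1)" if "s 0 = encode n" for s and n :: nat
    using that by (cases n) auto
qed simp

lemma pt_formula: "polytime f \<Longrightarrow> polytime g \<Longrightarrow> polytime (\<lambda>x. formula d (f x) (g x))"
proof (rule pt_comp2[where H = "formula d"])
  show "polytime (\<lambda>z. formula d (fst z) (snd z))" unfolding formula_def
    by (intro pt_rules pt_conflict_clauses pt_atoms pt_pred
        pt_comp2[where H = "\<lambda>x j. F3 guess (lit (fst x) (snd x)) (fst x) d True [True] j", OF pt_F3])
qed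

lemma pt_vertex_list: "polytime f \<Longrightarrow> polytime g \<Longrightarrow> polytime (\<lambda>x. vertex_list (f x) (g x))"
  by (rule pt_comp2[where H = vertex_list]) (unfold vertex_list_def, intro pt_rules)

lemma pt_incident: "polytime f \<Longrightarrow> polytime g \<Longrightarrow> polytime (\<lambda>x. incident (f x) (g x))"
  by (rule pt_comp2[where H = incident]) (unfold incident_def, intro pt_rules pt_kills)

lemma pt_other_edges: "polytime f \<Longrightarrow> polytime g \<Longrightarrow> polytime h \<Longrightarrow> polytime (\<lambda>x. other_edges (f x) (g x) (h x))"
proof -
  assume f: "polytime f" "polytime g" "polytime h"
  have "polytime (\<lambda>z. other_edges (fst z) (fst (snd z)) (snd (snd z)))"
    unfolding other_edges_def select_def by (intro pt_rules pt_incident)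
  from pt_comp[OF pt_Pair[OF f(1) pt_Pair[OF f(2,3)]] this] show ?thesis by simp
qed

section \<open>The reduction and its correctness\<close>

definition red_vertices :: "nat \<Rightarrow> circuit \<Rightarrow> nat \<Rightarrow> (slot, atom list) vertex list" where
  "red_vertices d C k = vertex_list (List.n_lists (2 ^ d) (slots d k)) (formula d C k)"

definition red_edges :: "nat \<Rightarrow> circuit \<Rightarrow> nat \<Rightarrow> nat list list" where
  "red_edges d C k = map (\<lambda>v. [v]) [0..<length (red_vertices d C k)] @
     other_edges (List.n_lists (2 ^ d) (atoms d C k)) (red_vertices d C k) (formula d C k)"

definition red_fun :: "nat \<Rightarrow> circuit \<Rightarrow> nat \<Rightarrow> nat list" where
  "red_fun d C k = map (\<lambda>x. if fst x = [] then 0 else 2) (red_vertices d C k)"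

text \<open>Value 2 for each tuple of slots, written without reference to the circuit so that it
  bounds the new parameter.\<close>

definition red_weight :: "nat \<Rightarrow> nat \<Rightarrow> nat" where
  "red_weight d k = 2 * length (slots d k) ^ (2 ^ d)"

text \<open>The three components have different types and cannot form a list; nested pairs closed by
  \<open>()\<close> have the encoding that \<open>enc_ext_rhf\<close> requires.\<close>

definition reduction :: "nat \<Rightarrow> circuit \<times> nat \<Rightarrow> (nat list list \<times> nat list \<times> nat list \<times> unit) \<times> nat" where
  "reduction d x = ((red_edges d (fst x) (snd x), [0..<length (red_vertices d (fst x) (snd x))],
     red_fun d (fst x) (snd x), ()), red_weight d (snd x))"

lemma pt_reduction: "polytime (reduction d)"
proof -
  have "polytime (\<lambda>x. reduction d x)"
    unfolding reduction_def red_edges_def red_fun_def red_weight_def red_vertices_def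
    by (intro pt_rules pt_other_edges pt_vertex_list pt_n_lists pt_slots pt_atoms pt_formula)
  then show ?thesis .
qed

lemma weighted_sat_iff_extends:
  assumes C: "circuit C" and weft: "weft_at_most C 3" and depth: "depth_at_most C d"
  shows "(\<exists>S\<subseteq>input_nodes C. card S = k \<and> accepts C S) \<longleftrightarrow>
    extends_to_minimal_rhf (vertices [0..<length (red_vertices d C k)]) (indices (red_edges d C k))
      (edge (red_edges d C k)) ((!) [0..<length (red_vertices d C k)]) ((!) (red_fun d C k))"
proof -
  let ?q = "2 ^ d :: nat"
  have "slots d k \<noteq> []" by (simp add: slots_def)
  have len: "length c \<le> ?q" if "D \<in> set (F3 guess (lit C k) C d True [True] (length C - 1))" "t \<in> set D" "c \<in> set t" for D t c
    using length_F3[OF that] .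
  have cf: "fst \<alpha> = fst \<beta> \<Longrightarrow> \<alpha> \<noteq> \<beta> \<Longrightarrow> clash \<alpha> \<beta>" for \<alpha> \<beta> by (auto simp: clash_def prod_eq_iff)
  have ws: "map fst w \<in> set (List.n_lists ?q (slots d k))" if "w \<in> set (List.n_lists ?q (atoms d C k))" for w
    using that by (fastforce simp: set_n_lists set_atoms set_gap_atoms set_slots)
  have dist: "distinct (List.n_lists ?q (slots d k))" by (rule distinct_n_lists[OF distinct_slots])
  have ne: "[] \<notin> set (List.n_lists ?q (slots d k))" by (auto simp: set_n_lists)
  note weighted_sat_iff_picks[OF C weft depth]
  also have "(\<exists>\<sigma>. picks \<sigma> (slots d k) (atoms d C k) \<and>
      (\<forall>r\<in>set (slots d k). \<forall>r'\<in>set (slots d k). \<not> clash (\<sigma> r) (\<sigma> r')) \<and>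
      ev2 (holds \<sigma> (slots d k)) (F3 guess (lit C k) C d True [True] (length C - 1))) \<longleftrightarrow>
    (\<exists>\<chi>. (\<forall>R\<in>set (List.n_lists ?q (slots d k)). \<chi> R \<in> set (List.n_lists ?q (atoms d C k)) \<and> map fst (\<chi> R) = R) \<and>
      avoids \<chi> (List.n_lists ?q (slots d k)) (formula d C k))"
    unfolding formula_def
    by (rule tuple_choice[OF _ \<open>slots d k \<noteq> []\<close> len cf, symmetric]) simp
  also have "\<dots> \<longleftrightarrow> extends_to_minimal_rhf (vertices [0..<length (red_vertices d C k)]) (indices (red_edges d C k))
      (edge (red_edges d C k)) ((!) [0..<length (red_vertices d C k)]) ((!) (red_fun d C k))"
    unfolding red_edges_def red_vertices_def
    by (rule extends_iff_choice[OF dist ne ws, symmetric]) (auto simp: red_fun_def red_vertices_def)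
  finally show ?thesis .
qed

lemma red_weight: "weight (vertices [0..<length (red_vertices d C k)]) ((!) (red_fun d C k)) = red_weight d k"
proof -
  let ?Rs = "List.n_lists (2 ^ d) (slots d k)"
  have "weight (vertices [0..<length (red_vertices d C k)]) ((!) (red_fun d C k)) = sum_list (red_fun d C k)"
    by (simp add: weight_def vertices_def red_fun_def sum_list_sum_nth atLeast0LessThan)
  also have "\<dots> = sum_list (map (\<lambda>R. if R = [] then 0 else 2) ?Rs)"
    by (simp add: red_fun_def red_vertices_def vertex_list_def map_concat o_def sum_list_0 if_distrib cong: map_cong)
  also have "map (\<lambda>R. if R = [] then 0 else 2) ?Rs = map (\<lambda>_. 2) ?Rs"
    by (rule map_cong) (auto simp: set_n_lists)
  finally show ?thesis by (simp add: red_weight_def length_n_lists sum_list_triv)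
qed

lemma red_input: "ext_rhf_input (red_edges d C k) [0..<length (red_vertices d C k)] (red_fun d C k)"
proof -
  let ?N = "length (red_vertices d C k)"
  have sub: "set E \<subseteq> {..<?N}" if "E \<in> set (red_edges d C k)" for E
    using that by (auto simp: red_edges_def other_edges_def set_select)
  have "edge (red_edges d C k) i \<subseteq> {..<?N}" if "i < length (red_edges d C k)" for i
    unfolding edge_def using sub[OF nth_mem[OF that]] .
  then have "hypergraph (vertices [0..<?N]) (indices (red_edges d C k)) (edge (red_edges d C k))"
    by (auto simp: hypergraph_def vertices_def indices_def)
  moreover have "correspondence (vertices [0..<?N]) (indices (red_edges d C k)) (edge (red_edges d C k)) ((!) [0..<?N])"
    by (auto simp: correspondence_def vertices_def indices_def edge_def red_edges_def nth_append)
  ultimately show ?thesis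
    by (auto simp: ext_rhf_input_def red_fun_def vertices_def)
qed

lemma encode_reduction:
  "encode (reduction d (C, k)) = Node (enc_ext_rhf (red_edges d C k) [0..<length (red_vertices d C k)] (red_fun d C k))
     (enc_nat (red_weight d k))"
  by (simp add: reduction_def enc_ext_rhf_def encode_nats encode_nat_def encode_list_def[of "red_edges d C k"] cong: map_cong)

section \<open>Composing with a given reduction\<close>

fun cvars :: "com \<Rightarrow> nat set" where
  "cvars (Assign v e) = insert v (evars e)"
| "cvars (Seq p q) = cvars p \<union> cvars q"
| "cvars (Cond e p q) = evars e \<union> cvars p \<union> cvars q"
| "cvars (While e p) = evars e \<union> cvars p"

lemma finite_cvars: "finite (cvars p)"
proof -
  have "finite (evars e)" for e by (induction e) auto
  then show ?thesis by (induction p) auto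
qed

lemma eval_frame: "M \<notin> evars e \<Longrightarrow> eval e (s(M := z)) = eval e s"
  by (induction e) auto

lemma cost_frame: "M \<notin> evars e \<Longrightarrow> cost e (s(M := z)) = cost e s"
  by (induction e) (auto simp: eval_frame)

text \<open>Allows a value to be saved in a fresh variable while a given program runs, of which only
  its result is known.\<close>

lemma exec_frame: "exec p s t s' \<Longrightarrow> M \<notin> cvars p \<Longrightarrow> exec p (s(M := z)) t (s'(M := z))"
proof (induction rule: exec.induct)
  case (Assign v e s)
  then have "exec (Assign v e) (s(M := z)) (Suc (cost e s)) (s(M := z, v := eval e s))"
    using exec.Assign[of v e "s(M := z)"] by (simp only: cvars.simps insert_iff de_Morgan_disj eval_frame cost_frame not_False_eq_True)
  moreover have "s(M := z, v := eval e s) = s(v := eval e s, M := z)"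
    using Assign by (intro fun_upd_twist) simp
  ultimately show ?case by (simp only:)
next
  case (Seq c s t s' c' t' s'')
  then show ?case by (simp add: exec.Seq del: fun_upd_apply)
next
  case (CondTrue e s c t s' c')
  then show ?case using exec.CondTrue[of e "s(M := z)"] by (simp add: eval_frame cost_frame del: fun_upd_apply)
next
  case (CondFalse e s c' t s' c)
  then show ?case using exec.CondFalse[of e "s(M := z)"] by (simp add: eval_frame cost_frame del: fun_upd_apply)
next
  case (WhileFalse e s c)
  then show ?case using exec.WhileFalse[of e "s(M := z)"] by (simp add: eval_frame cost_frame del: fun_upd_apply)
next
  case (WhileTrue e s c t s' t' s'')
  then show ?case using exec.WhileTrue[of e "s(M := z)"] by (simp add: eval_frame cost_frame del: fun_upd_apply)
qed

text \<open>The given reduction may leave anything in its variables, whereas \<open>realizes\<close>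
  expects \<open>Leaf\<close> in the scratch variables. There is no empty command, hence the
  assignment in the base case.\<close>

fun clear :: "nat \<Rightarrow> com" where
  "clear 0 = Assign 1 LeafE"
| "clear (Suc n) = Seq (clear n) (Assign (Suc n) LeafE)"

lemma run_clear: "\<exists>s'. run (clear n) s s' (3 * n + 2) \<and> s' 0 = s 0 \<and> (\<forall>v. 0 < v \<and> v \<le> n \<longrightarrow> s' v = Leaf)"
proof (induction n)
  case 0
  have 1: "run (clear 0) s (s(1 := Leaf)) (3 * 0 + 2)"
    using run_Assign[of 1 LeafE s] by (simp add: numeral_2_eq_2 del: fun_upd_apply)
  show ?case by (intro exI[of _ "s(1 := Leaf)"] conjI 1) auto
next
  case (Suc n)
  then obtain s' where s': "run (clear n) s s' (3 * n + 2)" "s' 0 = s 0" "\<And>v. 0 < v \<Longrightarrow> v \<le> n \<Longrightarrow> s' v = Leaf" by blast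
  have "run (Assign (Suc n) LeafE) s' (s'(Suc n := Leaf)) 2"
    using run_Assign[of "Suc n" LeafE s'] by (simp add: numeral_2_eq_2)
  from run_mono[OF run_Seq[OF s'(1) this], of "3 * Suc n + 2"]
  have 1: "run (clear (Suc n)) s (s'(Suc n := Leaf)) (3 * Suc n + 2)" by simp
  show ?case by (intro exI[of _ "s'(Suc n := Leaf)"] conjI 1) (use s' in \<open>auto simp: le_Suc_eq\<close>)
qed

lemma run_realizes_cleared:
  assumes r: "realizes q N T f" and s: "s 0 = encode x"
  shows "\<exists>s'. run (Seq (clear N) q) s s' (3 * N + 3 + T x) \<and> s' 0 = encode (f x)"
proof -
  obtain s1 where s1: "run (clear N) s s1 (3 * N + 2)" "s1 0 = s 0" "\<And>v. 0 < v \<Longrightarrow> v \<le> N \<Longrightarrow> s1 v = Leaf"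
    using run_clear[of N s] by blast
  have "run q s1 (s1(0 := encode (f x))) (T x)" using s1 s by (intro realizes_run[OF r]) auto
  from run_mono[OF run_Seq[OF s1(1) this], of "3 * N + 3 + T x"] show ?thesis
    by (intro exI[of _ "s1(0 := encode (f x))"]) simp
qed

text \<open>Supplies the computability of the new time and parameter bounds, which are polynomials
  in an old bound and \<open>k\<close>.\<close>

lemma computable_pt:
  assumes f: "computable f" and G: "polytime G"
  shows "computable (\<lambda>k. G (f k, k))"
proof -
  obtain p where p: "\<And>n. \<exists>t. runs p (enc_nat n) t (enc_nat (f n))" using f unfolding computable_def by blast
  obtain q N T where q: "realizes q N T G" using G unfolding polytime_def by blast
  have "infinite (UNIV - insert 0 (cvars p))" using finite_cvars by (simp add: Diff_infinite_finite)
  then obtain M where M: "M \<notin> cvars p" "M \<noteq> 0" by (metis Diff_iff ex_in_conv finite.emptyI insertCI)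
  define prog where "prog = Seq (Assign M (Var 0)) (Seq p (Seq (Assign 0 (NodeE (Var 0) (Var M))) (Seq (clear N) q)))"
  have "\<exists>t. runs prog (enc_nat n) t (enc_nat (G (f n, n)))" for n
  proof -
    define s0 :: state where "s0 = (\<lambda>_. Leaf)(0 := enc_nat n)"
    obtain t s where s: "exec p s0 t s" "s 0 = enc_nat (f n)" using p[of n] by (auto simp: runs_def s0_def)
    have 1: "run (Assign M (Var 0)) s0 (s0(M := enc_nat n)) (Suc (dsize (enc_nat n)))"
      using run_Assign[of M "Var 0" s0] by (simp add: s0_def)
    have 2: "run p (s0(M := enc_nat n)) (s(M := enc_nat n)) t"
      using exec_frame[OF s(1) M(1)] unfolding run_def by blast
    obtain T1 where 3: "run (Assign 0 (NodeE (Var 0) (Var M))) (s(M := enc_nat n))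
        ((s(M := enc_nat n))(0 := encode (f n, n))) T1"
      using run_Assign[of 0 "NodeE (Var 0) (Var M)" "s(M := enc_nat n)"] s M by (auto simp: encode_nat_def)
    obtain s' T2 where 4: "run (Seq (clear N) q) ((s(M := enc_nat n))(0 := encode (f n, n))) s' T2" "s' 0 = encode (G (f n, n))"
      using run_realizes_cleared[OF q, of "(s(M := enc_nat n))(0 := encode (f n, n))" "(f n, n)"] by auto
    from run_Seq[OF 1 run_Seq[OF 2 run_Seq[OF 3 4(1)]]] obtain t' where "exec prog s0 t' s'"
      unfolding prog_def run_def by blast
    then show ?thesis using 4(2) unfolding runs_def s0_def encode_nat_def by blast
  qed
  then show ?thesis unfolding computable_def by blast
qed

text \<open>The correspondence produced is always the identity on \<open>{..<N}\<close>, so one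
  reduction serves every restriction \<open>P\<close> that the identity meets.\<close>

lemma W3_reduces:
  assumes A: "A \<le>fpt weighted_circuit_sat 3 d" and P: "\<And>N. P {..<N} ((!) [0..<N])"
  shows "A \<le>fpt ext_rhf_where P"
proof -
  obtain p f g c where f: "computable f" and g: "computable g"
    and pA: "\<forall>(x, k)\<in>instances A. \<exists>x' k' t.
        runs p (Node x (enc_nat k)) t (Node x' (enc_nat k')) \<and> t \<le> f k * dsize x ^ c \<and> k' \<le> g k \<and>
        (x', k') \<in> instances (weighted_circuit_sat 3 d) \<and>
        ((x, k) \<in> yes A \<longleftrightarrow> (x', k') \<in> yes (weighted_circuit_sat 3 d))"
    using A unfolding fpt_reducible_def by (elim exE conjE)
  obtain q N T where q: "realizes q N T (reduction d)" using pt_reduction unfolding polytime_def by blast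
  obtain e where e: "\<And>x. T x \<le> (sz x + 2) ^ e" using realizes_polyb[OF q] unfolding poly_bounded_def by blast
  \<comment> \<open>The summand 20 covers additive costs and encoding overhead, and makes
    \<open>m k\<close> at least 2, which absorbs a doubling below.\<close>
  define m where "m k = f k + 2 * k + (3 * N + 20)" for k
  define F where "F k = m k ^ (e + 2)" for k
  \<comment> \<open>The base is the number of slots for the largest parameter \<open>g k\<close>
    that the given reduction can produce.\<close>
  define h where "h k = 2 * (Suc (g k) + length (labels d)) ^ (2 ^ d)" for k
  have "polytime (\<lambda>z. (fst z + 2 * snd z + (3 * N + 20)) ^ (e + 2))" by (intro pt_rules)
  from computable_pt[OF f this] have F: "computable F" by (simp add: F_def[abs_def] m_def)
  have "polytime (\<lambda>z :: nat \<times> nat. 2 * (Suc (fst z) + length (labels d)) ^ (2 ^ d))" by (intro pt_rules)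
  from computable_pt[OF g this] have h: "computable h" by (simp add: h_def[abs_def])
  show ?thesis
    unfolding fpt_reducible_def
  proof (rule exI[of _ "Seq p (Seq (clear N) q)"], rule exI[of _ F], rule exI[of _ h],
      rule exI[of _ "(c + 1) * (e + 2)"], intro conjI ballI F h, clarify)
    fix x k assume "(x, k) \<in> instances A"
    from pA[rule_format, OF this, unfolded prod.case] obtain x' k' t where run_p: "runs p (Node x (enc_nat k)) t (Node x' (enc_nat k'))"
      and t: "t \<le> f k * dsize x ^ c" and k': "k' \<le> g k"
      and inst: "(x', k') \<in> instances (weighted_circuit_sat 3 d)"
      and yes: "(x, k) \<in> yes A \<longleftrightarrow> (x', k') \<in> yes (weighted_circuit_sat 3 d)" by blast
    obtain C where C: "x' = enc_circuit C" "circuit C" "weft_at_most C 3" "depth_at_most C d"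
      using inst by (auto simp: weighted_circuit_sat_def)
    have enc: "encode (C, k') = Node x' (enc_nat k')"
      by (simp add: C(1) enc_circuit_def encode_list_def encode_nat_def encode_gate_def cong: map_cong)
    obtain s where s: "exec p ((\<lambda>_. Leaf)(0 := Node x (enc_nat k))) t s" "s 0 = encode (C, k')"
      using run_p unfolding runs_def enc by blast
    obtain s' where s': "run (Seq (clear N) q) s s' (3 * N + 3 + T (C, k'))" "s' 0 = encode (reduction d (C, k'))"
      using run_realizes_cleared[OF q, of s "(C, k')"] s(2) by blast
    let ?es = "red_edges d C k'" and ?ts = "[0..<length (red_vertices d C k')]" and ?fs = "red_fun d C k'"
    from run_Seq[OF _ s'(1), of p _ t] s(1)
    obtain t' where t': "t' \<le> Suc (t + (3 * N + 3 + T (C, k')))"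
      "exec (Seq p (Seq (clear N) q)) ((\<lambda>_. Leaf)(0 := Node x (enc_nat k))) t' s'"
      unfolding run_def by blast
    have "t' \<le> F k * dsize x ^ ((c + 1) * (e + 2))"
    proof -
      \<comment> \<open>With exponent \<open>c + 1\<close>, \<open>Y\<close> dominates both
        \<open>dsize x\<close> and \<open>dsize x ^ c\<close>, also for
        \<open>c = 0\<close>.\<close>
      define Y where "Y = dsize x ^ (c + 1)"
      have Y: "1 \<le> Y" "dsize x \<le> Y" "dsize x ^ c \<le> Y"
        unfolding Y_def by (simp_all add: dsize_ge_1 Suc_leI)
      have tY: "t \<le> f k * Y" using t Y(3) by (meson le_trans mult_le_mono2)
      have "sz (C, k') \<le> dsize (Node x (enc_nat k)) + t"
        using dsize_exec[OF s(1), of 0] s(2) by simp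
      also have "dsize (Node x (enc_nat k)) = dsize x + 2 * k + 2"
        using sz_nat[of k] by (simp add: encode_nat_def)
      finally have "sz (C, k') + 2 \<le> dsize x + (2 * k + 4) + t" by simp
      also have "\<dots> \<le> Y + (2 * k + 4) * Y + f k * Y"
        using mult_le_mono2[OF Y(1), of "2 * k + 4"] by (intro add_mono Y(2) tY) simp
      also have "\<dots> \<le> m k * Y" by (simp add: m_def algebra_simps)
      finally have Te: "T (C, k') \<le> (m k * Y) ^ e" using e[of "(C, k')"] power_mono le_trans by blast
      have "t' \<le> t + (3 * N + 4) + T (C, k')" using t' by simp
      also have "\<dots> \<le> f k * Y + (3 * N + 4) * Y + (m k * Y) ^ e"
        using tY Y(1) Te by (intro add_mono) auto
      also have "\<dots> \<le> m k * Y + (m k * Y) ^ e" by (simp add: m_def algebra_simps)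
      also have "\<dots> \<le> (m k * Y) ^ (e + 1) + (m k * Y) ^ (e + 1)"
      proof (rule add_mono)
        have "1 \<le> m k * Y" using Y(1) by (simp add: m_def)
        then show "m k * Y \<le> (m k * Y) ^ (e + 1)" "(m k * Y) ^ e \<le> (m k * Y) ^ (e + 1)"
          using power_increasing[of 1 "e + 1" "m k * Y"] power_increasing[of e "e + 1" "m k * Y"] by auto
      qed
      also have "\<dots> = 2 * (m k * Y) ^ (e + 1)" by simp
      also have "\<dots> \<le> (m k * Y) * (m k * Y) ^ (e + 1)"
      proof (rule mult_right_mono)
        have "2 * 1 \<le> m k * Y" by (rule mult_mono) (use Y in \<open>auto simp: m_def\<close>)
        then show "2 \<le> m k * Y" by simp
      qed simp
      also have "\<dots> = (m k * Y) ^ (e + 2)" by simp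
      also have "\<dots> = m k ^ (e + 2) * Y ^ (e + 2)" by (rule power_mult_distrib)
      also have "\<dots> = F k * dsize x ^ ((c + 1) * (e + 2))" by (simp only: F_def Y_def power_mult)
      finally show ?thesis .
    qed
    moreover have "runs (Seq p (Seq (clear N) q)) (Node x (enc_nat k)) t'
        (Node (enc_ext_rhf ?es ?ts ?fs) (enc_nat (red_weight d k')))"
      using t'(2) s'(2) unfolding runs_def encode_reduction by blast
    moreover have "red_weight d k' \<le> h k"
      using k' by (auto simp: red_weight_def h_def slots_def intro!: power_mono)
    moreover have "(enc_ext_rhf ?es ?ts ?fs, red_weight d k') \<in> instances (ext_rhf_where P)"
      using red_input red_weight P by (force simp: ext_rhf_where_def vertices_def)
    moreover have "(x, k) \<in> yes A \<longleftrightarrow> (enc_ext_rhf ?es ?ts ?fs, red_weight d k') \<in> yes (ext_rhf_where P)"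
    proof -
      have "(x, k) \<in> yes A \<longleftrightarrow> (\<exists>S\<subseteq>input_nodes C. card S = k' \<and> accepts C S)"
        unfolding yes C(1) using C(2-4) by (auto simp: weighted_circuit_sat_def)
      also have "\<dots> \<longleftrightarrow> extends_to_minimal_rhf (vertices ?ts) (indices ?es) (edge ?es) ((!) ?ts) ((!) ?fs)"
        by (rule weighted_sat_iff_extends[OF C(2-4)])
      also have "\<dots> \<longleftrightarrow> (enc_ext_rhf ?es ?ts ?fs, red_weight d k') \<in> yes (ext_rhf_where P)"
        using red_input[of d C k'] red_weight[of d C k'] P[of "length (red_vertices d C k')"]
        by (auto simp: ext_rhf_where_def vertices_def)
      finally show ?thesis .
    qed
    ultimately show "\<exists>x' k' t. runs (Seq p (Seq (clear N) q)) (Node x (enc_nat k)) t (Node x' (enc_nat k')) \<and>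
        t \<le> F k * dsize x ^ ((c + 1) * (e + 2)) \<and> k' \<le> h k \<and> (x', k') \<in> instances (ext_rhf_where P) \<and>
        ((x, k) \<in> yes A \<longleftrightarrow> (x', k') \<in> yes (ext_rhf_where P))" by blast
  qed
qed

theorem theorem14: "W_hard 3 ext_rhf \<and> W_hard 3 ext_rhf_injective"
  unfolding W_hard_def W_def ext_rhf_def ext_rhf_injective_def
  by (auto intro!: W3_reduces inj_onI)

end
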